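(* Let $p\ge1$, $k\ge1$, $r\in\{0,\dots,p-1\}$, $q=p-r$, and suppose the model $(c,\{f_i\}_{i=0}^k)$ belongs to $\mathcal M_r$ (see context), with associated $\alpha,\mu,\theta,\chi,\psi$. Let $\mathscr M_\mu=\{z\in\mathbb R^p:\theta(z)=-\mu\}$. Let $N\subset\mathscr M_\mu$ be the set of $z\in\mathscr M_\mu$ at which $v\mapsto\chi^{-1}\begin{bmatrix}\psi(z)+v\\-\mu\end{bmatrix}$ is not differentiable at $v=0$, and $N_0$ the union of $N$ with the set of $z\in\mathscr M_\mu\setminus N$ at which the Jacobian of this map at $v=0$ is non-invertible. For $\mathfrak z\in\mathbb R^{kp}$ and $u\in\mathbb R^p$ let $z_\infty(u;\mathfrak z)=\lim_{t\to\infty}z_t(u;\mathfrak z)$, where $z_t(u;\mathfrak z)$ is as in the context. Then: (1) the full set of long-run multiplier matrices, i.e. the set of Jacobians $\partial_u z_\infty(u;\mathfrak z)|_{u=0}$ over all $\mathfrak z\in\mathbb R^{kp}$ at which this Jacobian exists, is $\{\Theta_\infty(z):z\in\mathscr M_\mu\setminus N\}$, where $$\Theta_\infty(z)\defeq\partial_u\left.\chi^{-1}\begin{bmatrix}\psi(z)+\alpha_\perp^\top u\\-\mu\end{bmatrix}\right|_{u=0}=\partial_v\left.\chi^{-1}\begin{bmatrix}\psi(z)+v\\-\mu\end{bmatrix}\right|_{v=0}\alpha_\perp^\top;$$ (2) $\operatorname{rank}\Theta_\infty(z)=q$ for every $z\in\mathscr M_\mu\setminus N_0$.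
   Context: Model: for $c\in\mathbb R^p$ and maps $f_0,\dots,f_k:\mathbb R^p\to\mathbb R^p$ with $f_i(0)=0$, the nonlinear VAR($k$) is $f_0(z_t)=c+\sum_{i=1}^k f_i(z_{t-i})+u_t$. (When $k=1$, blocks indexed by $1,\dots,k-1$ are empty.) Define $g_j(z)=-\sum_{i=j+1}^k f_i(z)$; $\pi(z)=-f_0(z)+\sum_{i=1}^k f_i(z)$; $\mathbf g(z)=(g_1(z)^\top,\dots,g_{k-1}(z)^\top)^\top$. $D\in\mathbb R^{p(k-1)\times p(k-1)}$ has $-I_p$ diagonal blocks, $I_p$ blocks immediately above the diagonal, zeros elsewhere; $E=(I_p,0_{p\times p(k-2)})^\top$. For $\alpha$ of rank $r$, $\alpha_\perp$ is $p\times q$ of rank $q$ with $\alpha_\perp^\top\alpha=0$; $\boldsymbol\alpha=\begin{bmatrix}\alpha & E^\top\\ 0 & I_{p(k-1)}\end{bmatrix}$; for $\theta:\mathbb R^p\to\mathbb R^r$, $\boldsymbol\theta(z)=(\theta(z)^\top,\mathbf g(z)^\top)^\top$, $\mathbf D_0=\begin{bmatrix}0_{r\times p}&0\\0&D\end{bmatrix}$. Joint spectral radius: $\rho_{JSR}(\mathcal A)=\limsup_{t}\sup\{\rho(M_1\cdots M_t)^{1/t}:M_s\in\mathcal A\}$. Class $\mathcal M_r$: the model belongs to $\mathcal M_r$ if for some $\alpha\in\mathbb R^{p\times r}$ of rank $r$, $\bar b<\infty$, $\bar\rho<1$: (i) $f_0$ is a homeomorphism of $\mathbb R^p$; (ii)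 there exist $\mu\in\mathbb R^r$, $\theta:\mathbb R^p\to\mathbb R^r$ with $c=\alpha\mu$, $\pi=\alpha\theta$; (iii) there is a closed $\mathcal B\subset\mathbb R^{kp\times[p(k-1)+r]}$ with $\max_{\mathcal B}\|\boldsymbol\beta\|\le\bar b$ and $\rho_{JSR}(\{I+\boldsymbol\beta^\top\boldsymbol\alpha:\boldsymbol\beta\in\mathcal B\})\le\bar\rho$, such that for all $\mathbf z=(z^\top,\boldsymbol\zeta^\top)^\top,\mathbf z'\in\mathbb R^{kp}$ some $\boldsymbol\beta\in\mathcal B$ satisfies $[\boldsymbol\theta(f_0^{-1}(z))+\mathbf D_0\mathbf z]-[\boldsymbol\theta(f_0^{-1}(z'))+\mathbf D_0\mathbf z']=\boldsymbol\beta^\top(\mathbf z-\mathbf z')$. Define $h(z)=f_0(z)-\sum_{i=1}^{k-1}g_i(z)$, $\psi=\alpha_\perp^\top h$, $\chi(z)=(\psi(z)^\top,\theta(z)^\top)^\top$ (a homeomorphism of $\mathbb R^p$). Impulse paths: for $\tau\in\mathbb N$, $\mathfrak z=(\mathfrak z_{(1)}^\top,\dots,\mathfrak z_{(k)}^\top)^\top\in\mathbb R^{kp}$ and $u\in\mathbb R^p$, $z_t(u;\mathfrak z)$ ($t\ge\tau$) is defined by $z_{\tau-i}=\mathfrak z_{(i)}$ and $f_0(z_t)=c+\sum_{i=1}^kf_i(z_{t-i})+u_t$ with $u_\tau=u$, $u_t=0$ for $t>\tau$. *)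

theory Defs
  imports "Jordan_Normal_Form.Spectral_Radius" "Jordan_Normal_Form.DL_Rank"
    "HOL-Library.Extended_Real"
begin

text \<open>Vectors in R^n are JNF vectors in carrier_vec n (dimension n may be 0);
  matrices are JNF matrices. Euclidean/Frobenius norms are written out.\<close>

definition vnorm :: "real vec \<Rightarrow> real" where
  "vnorm v = sqrt (\<Sum>i<dim_vec v. (v $ i)^2)"

definition mnorm :: "real mat \<Rightarrow> real" where
  "mnorm A = sqrt (\<Sum>i<dim_row A. \<Sum>j<dim_col A. (A $$ (i,j))^2)"

definition cont_vec :: "nat \<Rightarrow> nat \<Rightarrow> (real vec \<Rightarrow> real vec) \<Rightarrow> bool" where
  "cont_vec n m F \<longleftrightarrow> (\<forall>x\<in>carrier_vec n. F x \<in> carrier_vec m) \<and>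
     (\<forall>x\<in>carrier_vec n. \<forall>e>0. \<exists>d>0. \<forall>y\<in>carrier_vec n.
        vnorm (y - x) < d \<longrightarrow> vnorm (F y - F x) < e)"

definition homeo_vec :: "nat \<Rightarrow> (real vec \<Rightarrow> real vec) \<Rightarrow> bool" where
  "homeo_vec p F \<longleftrightarrow> bij_betw F (carrier_vec p) (carrier_vec p) \<and> cont_vec p p F \<and>
     cont_vec p p (the_inv_into (carrier_vec p) F)"

definition has_jac :: "(real vec \<Rightarrow> real vec) \<Rightarrow> real mat \<Rightarrow> real vec \<Rightarrow> nat \<Rightarrow> nat \<Rightarrow> bool" where
  "has_jac F J x n m \<longleftrightarrow> J \<in> carrier_mat m n \<and> x \<in> carrier_vec n \<and> F x \<in> carrier_vec m \<and>
     (\<forall>e>0. \<exists>d>0. \<forall>h\<in>carrier_vec n. vnorm h < d \<longrightarrow>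
        vnorm (F (x + h) - F x - J *\<^sub>v h) \<le> e * vnorm h)"

definition differentiable_vec :: "(real vec \<Rightarrow> real vec) \<Rightarrow> real vec \<Rightarrow> nat \<Rightarrow> nat \<Rightarrow> bool" where
  "differentiable_vec F x n m \<longleftrightarrow> (\<exists>J. has_jac F J x n m)"

definition jacobian :: "(real vec \<Rightarrow> real vec) \<Rightarrow> real vec \<Rightarrow> nat \<Rightarrow> nat \<Rightarrow> real mat" where
  "jacobian F x n m = (THE J. has_jac F J x n m)"

abbreviation mrank :: "nat \<Rightarrow> real mat \<Rightarrow> nat" where
  "mrank n A \<equiv> vec_space.rank n (A :: real mat)"

definition jsr :: "nat \<Rightarrow> real mat set \<Rightarrow> ereal" where
  "jsr n A = limsup (\<lambda>t. SUP Ms \<in> {Ms. length Ms = t \<and> set Ms \<subseteq> A}.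
      ereal (root t (if n = 0 then 0
        else spectral_radius (map_mat complex_of_real (foldr (*) Ms (1\<^sub>m n))))))"

definition closed_mats :: "nat \<Rightarrow> nat \<Rightarrow> real mat set \<Rightarrow> bool" where
  "closed_mats n m B \<longleftrightarrow> (\<forall>X M. (\<forall>i. X i \<in> B) \<longrightarrow> M \<in> carrier_mat n m \<longrightarrow>
      (\<lambda>i. mnorm (X i - M)) \<longlonglongrightarrow> 0 \<longrightarrow> M \<in> B)"

definition nvar_model :: "nat \<Rightarrow> nat \<Rightarrow> real vec \<Rightarrow> (nat \<Rightarrow> real vec \<Rightarrow> real vec) \<Rightarrow> bool" where
  "nvar_model p k c f \<longleftrightarrow> c \<in> carrier_vec p \<and>
     (\<forall>i\<le>k. \<forall>x\<in>carrier_vec p. f i x \<in> carrier_vec p) \<and> (\<forall>i\<le>k. f i (0\<^sub>v p) = 0\<^sub>v p)"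

definition f0inv :: "nat \<Rightarrow> (nat \<Rightarrow> real vec \<Rightarrow> real vec) \<Rightarrow> real vec \<Rightarrow> real vec" where
  "f0inv p f = the_inv_into (carrier_vec p) (f 0)"

definition gfun :: "nat \<Rightarrow> nat \<Rightarrow> (nat \<Rightarrow> real vec \<Rightarrow> real vec) \<Rightarrow> nat \<Rightarrow> real vec \<Rightarrow> real vec" where
  "gfun p k f j z = vec p (\<lambda>l. - (\<Sum>i\<in>{j+1..k}. f i z $ l))"

definition pifun :: "nat \<Rightarrow> nat \<Rightarrow> (nat \<Rightarrow> real vec \<Rightarrow> real vec) \<Rightarrow> real vec \<Rightarrow> real vec" where
  "pifun p k f z = vec p (\<lambda>l. - (f 0 z $ l) + (\<Sum>i\<in>{1..k}. f i z $ l))"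

definition boldg :: "nat \<Rightarrow> nat \<Rightarrow> (nat \<Rightarrow> real vec \<Rightarrow> real vec) \<Rightarrow> real vec \<Rightarrow> real vec" where
  "boldg p k f z = vec (p * (k - 1)) (\<lambda>l. gfun p k f (l div p + 1) z $ (l mod p))"

text \<open>D: -I_p diagonal blocks, I_p blocks immediately above the diagonal.\<close>
definition Dmat :: "nat \<Rightarrow> nat \<Rightarrow> real mat" where
  "Dmat p k = mat (p * (k - 1)) (p * (k - 1))
     (\<lambda>(a, b). if a = b then -1 else if b = a + p then 1 else 0)"

definition Emat :: "nat \<Rightarrow> nat \<Rightarrow> real mat" where
  "Emat p k = mat (p * (k - 1)) p (\<lambda>(a, b). if a = b then 1 else 0)"

definition boldalpha :: "nat \<Rightarrow> nat \<Rightarrow> nat \<Rightarrow> real mat \<Rightarrow> real mat" where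
  "boldalpha p k r \<alpha> = four_block_mat \<alpha> (transpose_mat (Emat p k))
      (0\<^sub>m (p * (k - 1)) r) (1\<^sub>m (p * (k - 1)))"

definition D0mat :: "nat \<Rightarrow> nat \<Rightarrow> nat \<Rightarrow> real mat" where
  "D0mat p k r = four_block_mat (0\<^sub>m r p) (0\<^sub>m r (p * (k - 1)))
      (0\<^sub>m (p * (k - 1)) p) (Dmat p k)"

definition Fmap :: "nat \<Rightarrow> nat \<Rightarrow> nat \<Rightarrow> (nat \<Rightarrow> real vec \<Rightarrow> real vec) \<Rightarrow> (real vec \<Rightarrow> real vec)
     \<Rightarrow> real vec \<Rightarrow> real vec" where
  "Fmap p k r f \<theta> bz = (\<theta> (f0inv p f (vec_first bz p)) @\<^sub>v boldg p k f (f0inv p f (vec_first bz p)))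
      + D0mat p k r *\<^sub>v bz"

definition in_Mr :: "nat \<Rightarrow> nat \<Rightarrow> nat \<Rightarrow> real vec \<Rightarrow> (nat \<Rightarrow> real vec \<Rightarrow> real vec)
     \<Rightarrow> real mat \<Rightarrow> real vec \<Rightarrow> (real vec \<Rightarrow> real vec) \<Rightarrow> bool" where
  "in_Mr p k r c f \<alpha> \<mu> \<theta> \<longleftrightarrow>
     \<alpha> \<in> carrier_mat p r \<and> mrank p \<alpha> = r \<and>
     homeo_vec p (f 0) \<and>
     \<mu> \<in> carrier_vec r \<and> (\<forall>z\<in>carrier_vec p. \<theta> z \<in> carrier_vec r) \<and>
     c = \<alpha> *\<^sub>v \<mu> \<and> (\<forall>z\<in>carrier_vec p. pifun p k f z = \<alpha> *\<^sub>v \<theta> z) \<and>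
     (\<exists>B bb \<rho>b. \<rho>b < 1 \<and> B \<subseteq> carrier_mat (k * p) (p * (k - 1) + r) \<and>
        closed_mats (k * p) (p * (k - 1) + r) B \<and> (\<forall>\<beta>\<in>B. mnorm \<beta> \<le> bb) \<and>
        jsr (p * (k - 1) + r)
          ((\<lambda>\<beta>. 1\<^sub>m (p * (k - 1) + r) + transpose_mat \<beta> * boldalpha p k r \<alpha>) ` B) \<le> ereal \<rho>b \<and>
        (\<forall>bz\<in>carrier_vec (k * p). \<forall>bz'\<in>carrier_vec (k * p). \<exists>\<beta>\<in>B.
           Fmap p k r f \<theta> bz - Fmap p k r f \<theta> bz' = transpose_mat \<beta> *\<^sub>v (bz - bz')))"

definition hfun :: "nat \<Rightarrow> nat \<Rightarrow> (nat \<Rightarrow> real vec \<Rightarrow> real vec) \<Rightarrow> real vec \<Rightarrow> real vec" where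
  "hfun p k f z = vec p (\<lambda>l. f 0 z $ l - (\<Sum>i\<in>{1..k-1}. gfun p k f i z $ l))"

definition psifun :: "nat \<Rightarrow> nat \<Rightarrow> (nat \<Rightarrow> real vec \<Rightarrow> real vec) \<Rightarrow> real mat \<Rightarrow> real vec \<Rightarrow> real vec" where
  "psifun p k f \<alpha>p z = transpose_mat \<alpha>p *\<^sub>v hfun p k f z"

definition chifun :: "nat \<Rightarrow> nat \<Rightarrow> (nat \<Rightarrow> real vec \<Rightarrow> real vec) \<Rightarrow> real mat \<Rightarrow> (real vec \<Rightarrow> real vec)
     \<Rightarrow> real vec \<Rightarrow> real vec" where
  "chifun p k f \<alpha>p \<theta> z = psifun p k f \<alpha>p z @\<^sub>v \<theta> z"

definition chiinv :: "nat \<Rightarrow> nat \<Rightarrow> (nat \<Rightarrow> real vec \<Rightarrow> real vec) \<Rightarrow> real mat \<Rightarrow> (real vec \<Rightarrow> real vec)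
     \<Rightarrow> real vec \<Rightarrow> real vec" where
  "chiinv p k f \<alpha>p \<theta> = the_inv_into (carrier_vec p) (chifun p k f \<alpha>p \<theta>)"

definition blk :: "nat \<Rightarrow> real vec \<Rightarrow> nat \<Rightarrow> real vec" where
  "blk p fz i = vec p (\<lambda>j. fz $ ((i - 1) * p + j))"

text \<open>New value z_{tau+s}, given xs = [z_{tau+s-k}, ..., z_{tau+s-1}] (so xs!(k-i) = z_{tau+s-i}).\<close>
definition ip_new :: "nat \<Rightarrow> nat \<Rightarrow> real vec \<Rightarrow> (nat \<Rightarrow> real vec \<Rightarrow> real vec) \<Rightarrow> real vec
     \<Rightarrow> real vec list \<Rightarrow> nat \<Rightarrow> real vec" where
  "ip_new p k c f u xs s = f0inv p f (vec p (\<lambda>l. c $ l + (\<Sum>i\<in>{1..k}. f i (xs ! (k - i)) $ l)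
      + (if s = 0 then u $ l else 0)))"

primrec ip_state :: "nat \<Rightarrow> nat \<Rightarrow> real vec \<Rightarrow> (nat \<Rightarrow> real vec \<Rightarrow> real vec) \<Rightarrow> real vec
     \<Rightarrow> real vec \<Rightarrow> nat \<Rightarrow> real vec list" where
  "ip_state p k c f u fz 0 = map (\<lambda>j. blk p fz (k - j)) [0..<k]"
| "ip_state p k c f u fz (Suc s) =
     tl (ip_state p k c f u fz s) @ [ip_new p k c f u (ip_state p k c f u fz s) s]"

text \<open>z_t(u; frak z) for t >= tau (value for t < tau is irrelevant).\<close>
definition impulse_path :: "nat \<Rightarrow> nat \<Rightarrow> real vec \<Rightarrow> (nat \<Rightarrow> real vec \<Rightarrow> real vec) \<Rightarrow> nat
     \<Rightarrow> real vec \<Rightarrow> real vec \<Rightarrow> nat \<Rightarrow> real vec" where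
  "impulse_path p k c f \<tau> u fz t =
     ip_new p k c f u (ip_state p k c f u fz (t - \<tau>)) (t - \<tau>)"

definition z_inf :: "nat \<Rightarrow> nat \<Rightarrow> real vec \<Rightarrow> (nat \<Rightarrow> real vec \<Rightarrow> real vec) \<Rightarrow> nat
     \<Rightarrow> real vec \<Rightarrow> real vec \<Rightarrow> real vec" where
  "z_inf p k c f \<tau> u fz = (THE L. L \<in> carrier_vec p \<and>
      (\<lambda>t. vnorm (impulse_path p k c f \<tau> u fz t - L)) \<longlonglongrightarrow> 0)"

end

theory Submission imports Defs "HOL-Analysis.L2_Norm" begin

text \<open>In state-space form the model reads \<open>x' = x + A G(x)\<close> with \<open>G(x) - G(y) = \<beta>\<^sup>T (x - y)\<close>, so that
  \<open>G(x') = (I + \<beta>\<^sup>T A) G(x)\<close>. A joint spectral radius below 1 makes products of such factors decay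
  geometrically; hence trajectories converge to a zero of \<open>G\<close>, i.e. to a point of the attractor
  \<open>\<theta> = -\<mu>\<close>. The functional \<open>trend\<close> annihilates \<open>A\<close>, is therefore conserved, equals \<open>\<psi>\<close> at
  stationary states, and is moved by an impulse \<open>u\<close> by exactly \<open>\<alpha>\<^sub>\<bottom>\<^sup>T u\<close>. This identifies the limit as
  \<open>\<chi>\<inverse>(\<psi>(z) + \<alpha>\<^sub>\<bottom>\<^sup>T u, -\<mu>)\<close>. Uniqueness of the limit point holds because \<open>ker trend = range A\<close>
  and no factor \<open>I + \<beta>\<^sup>T A\<close> has eigenvalue 1.

  Since the joint spectral radius is defined through spectral radii, the decay requires the
  Berger--Wang theorem. If it failed, there would be a norm in which an arbitrarily long
  product hardly shrinks some vector. In coordinates of an almost Auerbach basis the orbit of this vector lies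
  in a fixed box, so two of its points nearly coincide. This gives a
  normalized product \<open>Q\<close> with bounded entries and an almost fixed vector, so \<open>det (Q - I)\<close> is almost 0,
  although all eigenvalues of \<open>Q\<close> stay away from 1.\<close>

section \<open>Norms and determinants\<close>

text \<open>The state pairs \<open>f 0\<close> of the current value with sums of the lagged
  \<open>g i\<close>. These coordinates, rather than the raw lags, make one period of the recursion
  an increment \<open>A *\<^sub>v G x\<close>, which is the form that the secant condition of the
  class fits. The obstacle in the spectral part is that the norms arising there have no distortion
  bound fixed in advance: their equivalence constant may grow with every improvement of the growth
  rate. Hence each norm is handled in coordinates where all constants depend only on
  \<open>n\<close> and \<kappa>. The length of the contracting products is then fixed before the
  norm, every improvement gains the same factor, and finitely many of them lead below 1.
  \<open>chiinv\<close> is a definite description, so its value is known only where a unique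
  preimage is exhibited. On the fibre \<theta> = -\<mu> existence also comes from the dynamics: the
  system is run from a state of prescribed trend. The Jacobian statements then reduce to the linear
  substitution of v by \<alpha>_\<bottom>^T u.\<close>

lemma vnorm_L2_set: "vnorm v = L2_set (\<lambda>i. v $ i) {..<dim_vec v}"
  by (simp add: vnorm_def L2_set_def)

lemma vnorm_nonneg [simp]: "0 \<le> vnorm v"
  by (simp add: vnorm_L2_set)

lemma vnorm_triangle:
  assumes "x \<in> carrier_vec n" "y \<in> carrier_vec n"
  shows "vnorm (x + y) \<le> vnorm x + vnorm y"
proof -
  have "vnorm (x + y) = L2_set (\<lambda>i. x $ i + y $ i) {..<n}"
    using assms by (auto simp: vnorm_L2_set intro!: L2_set_cong)
  then show ?thesis
    using L2_set_triangle_ineq[of "\<lambda>i. x $ i" "\<lambda>i. y $ i" "{..<n}"] assms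
    by (simp add: vnorm_L2_set)
qed

lemma vnorm_smult: "vnorm (a \<cdot>\<^sub>v x) = \<bar>a\<bar> * vnorm x"
  by (simp add: vnorm_def power_mult_distrib sum_distrib_left[symmetric] real_sqrt_mult)

lemma vnorm_minus_commute:
  assumes "x \<in> carrier_vec n" "y \<in> carrier_vec n"
  shows "vnorm (x - y) = vnorm (y - x)"
  using assms by (auto simp: vnorm_def power2_commute intro!: sum.cong)

lemma vnorm_diff_triangle:
  assumes "x \<in> carrier_vec n" "y \<in> carrier_vec n" "z \<in> carrier_vec n"
  shows "vnorm (x - z) \<le> vnorm (x - y) + vnorm (y - z)"
proof -
  have "x - z = (x - y) + (y - z)" using assms by (intro eq_vecI) auto
  then show ?thesis using vnorm_triangle[of "x - y" n "y - z"] assms by simp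
qed

lemma component_le_vnorm: "i < dim_vec v \<Longrightarrow> \<bar>v $ i\<bar> \<le> vnorm v"
  using member_le_L2_set[of "{..<dim_vec v}" i "\<lambda>i. \<bar>v $ i\<bar>"]
  by (simp add: vnorm_L2_set L2_set_def)

lemma vnorm_le_sum: "vnorm v \<le> (\<Sum>i<dim_vec v. \<bar>v $ i\<bar>)"
  unfolding vnorm_L2_set by (rule L2_set_le_sum_abs)

lemma vnorm_eq_0_iff: "v \<in> carrier_vec n \<Longrightarrow> vnorm v = 0 \<longleftrightarrow> v = 0\<^sub>v n"
  unfolding vnorm_L2_set by (auto simp: L2_set_eq_0_iff)

lemma entry_le_mnorm:
  assumes "i < dim_row A" "j < dim_col A"
  shows "\<bar>A $$ (i,j)\<bar> \<le> mnorm A"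
proof -
  have "(A $$ (i,j))^2 \<le> (\<Sum>j<dim_col A. (A $$ (i,j))^2)"
    using assms by (intro member_le_sum) auto
  also have "\<dots> \<le> (\<Sum>i<dim_row A. \<Sum>j<dim_col A. (A $$ (i,j))^2)"
    using assms by (intro member_le_sum[of i _ "\<lambda>i. \<Sum>j<dim_col A. (A $$ (i,j))^2"]) (auto intro: sum_nonneg)
  finally show ?thesis unfolding mnorm_def by (metis real_sqrt_abs real_sqrt_le_iff)
qed

lemma mult_mat_vec_bound:
  assumes A: "A \<in> carrier_mat m n" and x: "x \<in> carrier_vec n"
    and c: "\<And>i j. i < m \<Longrightarrow> j < n \<Longrightarrow> \<bar>A $$ (i,j)\<bar> \<le> c"
  shows "vnorm (A *\<^sub>v x) \<le> real m * real n * c * vnorm x"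
proof -
  have "\<bar>(A *\<^sub>v x) $ i\<bar> \<le> real n * c * vnorm x" if i: "i < m" for i
  proof -
    have "(A *\<^sub>v x) $ i = (\<Sum>j<n. A $$ (i,j) * x $ j)"
      using A x i by (auto simp: scalar_prod_def atLeast0LessThan intro!: sum.cong)
    also have "\<bar>\<dots>\<bar> \<le> (\<Sum>j<n. \<bar>A $$ (i,j) * x $ j\<bar>)" by (rule sum_abs)
    also have "\<dots> \<le> (\<Sum>j<n. c * vnorm x)"
    proof (rule sum_mono)
      fix j assume j: "j \<in> {..<n}"
      have "0 \<le> c" using c[OF i, of j] j by auto
      then show "\<bar>A $$ (i,j) * x $ j\<bar> \<le> c * vnorm x"
        unfolding abs_mult using c[OF i] component_le_vnorm[of j x] x j by (intro mult_mono) auto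
    qed
    finally show ?thesis by simp
  qed
  then have "(\<Sum>i<m. \<bar>(A *\<^sub>v x) $ i\<bar>) \<le> (\<Sum>i<m. real n * c * vnorm x)"
    by (intro sum_mono) auto
  then show ?thesis using vnorm_le_sum[of "A *\<^sub>v x"] A by simp
qed

lemma abs_det_le:
  fixes A :: "real mat"
  assumes A: "A \<in> carrier_mat n n" and c: "\<And>i j. i < n \<Longrightarrow> j < n \<Longrightarrow> \<bar>A $$ (i,j)\<bar> \<le> c"
  shows "\<bar>det A\<bar> \<le> fact n * c ^ n"
proof -
  let ?P = "{p. p permutes {0..<n}}"
  have "\<bar>det A\<bar> \<le> (\<Sum>p\<in>?P. \<bar>signof p * (\<Prod>i = 0..<n. A $$ (i, p i))\<bar>)"
    unfolding det_def'[OF A] by (rule sum_abs)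
  also have "\<dots> \<le> (\<Sum>p\<in>?P. c ^ n)"
  proof (rule sum_mono)
    fix p assume "p \<in> ?P"
    then have p: "p i < n" if "i < n" for i using that permutes_in_image[of p "{0..<n}" i] by auto
    have "\<bar>\<Prod>i = 0..<n. A $$ (i, p i)\<bar> \<le> (\<Prod>i = 0..<n. c)"
      unfolding abs_prod by (intro prod_mono) (use c p in auto)
    then show "\<bar>signof p * (\<Prod>i = 0..<n. A $$ (i, p i))\<bar> \<le> c ^ n"
      by (simp add: abs_mult sign_def)
  qed
  also have "\<dots> = fact n * c ^ n"
    using card_permutations[of "{0..<n}" n] by simp
  finally show ?thesis .
qed

text \<open>Multiplying \<open>A *\<^sub>v a\<close> by the adjugate recovers \<open>det A\<close>
  times \<open>a\<close>, and cofactors are bounded through the entries. Thus a bounded matrix that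
  nearly annihilates a vector of fixed size has a small determinant, with constants depending only
  on \<open>n\<close> and \<open>c\<close>.\<close>

lemma abs_det_mult_le:
  fixes A :: "real mat"
  assumes A: "A \<in> carrier_mat n n" and a: "a \<in> carrier_vec n"
    and c: "\<And>i j. i < n \<Longrightarrow> j < n \<Longrightarrow> \<bar>A $$ (i,j)\<bar> \<le> c"
    and \<delta>: "\<And>i. i < n \<Longrightarrow> \<bar>(A *\<^sub>v a) $ i\<bar> \<le> \<delta>" and l: "l < n"
  shows "\<bar>det A\<bar> * \<bar>a $ l\<bar> \<le> real n * (fact (n - 1) * c ^ (n - 1)) * \<delta>"
proof -
  note adj = adj_mat[OF A]
  have entry: "\<bar>adj_mat A $$ (l,j)\<bar> \<le> fact (n - 1) * c ^ (n - 1)" if j: "j < n" for j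
  proof -
    have "\<bar>det (mat_delete A j l)\<bar> \<le> fact (n - 1) * c ^ (n - 1)"
      by (rule abs_det_le[OF mat_delete_carrier[OF A]]) (use A c in \<open>auto simp: mat_delete_def\<close>)
    then show ?thesis using A j l by (simp add: adj_mat_def cofactor_def abs_mult power_abs)
  qed
  have "adj_mat A *\<^sub>v (A *\<^sub>v a) = det A \<cdot>\<^sub>v a"
    using adj A a by (simp flip: assoc_mult_mat_vec) (auto intro!: eq_vecI)
  then have "det A * a $ l = (adj_mat A *\<^sub>v (A *\<^sub>v a)) $ l"
    using a l by simp
  also have "\<dots> = (\<Sum>j<n. adj_mat A $$ (l,j) * (A *\<^sub>v a) $ j)"
    using A a adj l by (auto simp: scalar_prod_def atLeast0LessThan intro!: sum.cong)
  also have "\<bar>\<dots>\<bar> \<le> (\<Sum>j<n. \<bar>adj_mat A $$ (l,j) * (A *\<^sub>v a) $ j\<bar>)" by (rule sum_abs)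
  also have "\<dots> \<le> (\<Sum>j<n. (fact (n - 1) * c ^ (n - 1)) * \<delta>)"
  proof (rule sum_mono)
    fix j assume "j \<in> {..<n}"
    then have "j < n" by simp
    then show "\<bar>adj_mat A $$ (l,j) * (A *\<^sub>v a) $ j\<bar> \<le> (fact (n - 1) * c ^ (n - 1)) * \<delta>"
      unfolding abs_mult using entry[of j] \<delta>[of j] by (intro mult_mono) auto
  qed
  finally show ?thesis by (simp add: abs_mult)
qed

text \<open>Over the complex numbers the determinant factors, up to sign, into the differences of
  \<open>x\<close> and the eigenvalues, each of modulus at least \<open>x - b\<close>. This lower
  bound is played against \<open>abs_det_mult_le\<close>.\<close>

lemma abs_det_char_ge:
  fixes A :: "real mat"
  assumes A: "A \<in> carrier_mat n n" and "0 \<le> b" "b \<le> x"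
    and ev: "\<And>e. eigenvalue (map_mat complex_of_real A) e \<Longrightarrow> cmod e \<le> b"
  shows "(x - b) ^ n \<le> \<bar>det (A - x \<cdot>\<^sub>m 1\<^sub>m n)\<bar>"
proof -
  let ?A = "map_mat complex_of_real A"
  have cA: "?A \<in> carrier_mat n n" using A by simp
  obtain as where as: "char_poly ?A = (\<Prod>a\<leftarrow>as. [:- a, 1:])" "length as = n"
    using char_poly_factorized[OF cA] by blast
  have le: "cmod a \<le> b" if "a \<in> set as" for a
  proof -
    have "poly (char_poly ?A) a = 0" using linear_poly_root[OF that] as by simp
    then show ?thesis using ev eigenvalue_root_char_poly[OF cA] by blast
  qed
  have "(x - b) ^ length as \<le> cmod (poly (\<Prod>a\<leftarrow>as. [:- a, 1:]) (of_real x))"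
    using le
  proof (induction as)
    case (Cons a as)
    have "x - b \<le> cmod (of_real x - a)"
      using norm_triangle_ineq2[of "of_real x" a] Cons.prems[of a] assms(2,3) by simp
    then have "(x - b) * (x - b) ^ length as
        \<le> cmod (of_real x - a) * cmod (poly (\<Prod>a\<leftarrow>as. [:- a, 1:]) (of_real x))"
      using Cons assms(2,3) by (intro mult_mono) auto
    moreover have "poly (\<Prod>a\<leftarrow>a # as. [:- a, 1:]) (of_real x)
        = (of_real x - a) * poly (\<Prod>a\<leftarrow>as. [:- a, 1:]) (of_real x)"
      by (simp add: algebra_simps)
    ultimately show ?case by (simp only: norm_mult length_Cons power_Suc)
  qed simp
  also have "poly (\<Prod>a\<leftarrow>as. [:- a, 1:]) (of_real x) = poly (char_poly ?A) (of_real x)"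
    using as by simp
  also have "\<dots> = of_real (poly (char_poly A) x)"
    by (simp add: of_real_hom.char_poly_hom[OF A])
  also have "poly (char_poly A) x = det (- char_matrix A x)"
    by (rule char_poly_matrix[OF A])
  also have "cmod (of_real (det (- char_matrix A x))) = \<bar>det (char_matrix A x)\<bar>"
  proof -
    have "- char_matrix A x = (-1) \<cdot>\<^sub>m char_matrix A x" by (intro eq_matI) auto
    then show ?thesis using det_smult[of "-1" "char_matrix A x"]
      by (simp add: abs_mult power_abs norm_mult norm_power)
  qed
  also have "char_matrix A x = A - x \<cdot>\<^sub>m 1\<^sub>m n"
    using A unfolding char_matrix_def by (intro eq_matI) auto
  finally show ?thesis using as by simp
qed

section \<open>Products of matrices with small joint spectral radius\<close>

lemma mult_mat_unit_vec:
  fixes A :: "'a :: comm_ring_1 mat"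
  shows "A \<in> carrier_mat m n \<Longrightarrow> j < n \<Longrightarrow> A *\<^sub>v unit_vec n j = col A j"
  by (intro eq_vecI) auto

lemma smult_mult_mat_vec:
  fixes A :: "'a :: comm_ring_1 mat"
  shows "A \<in> carrier_mat m n \<Longrightarrow> x \<in> carrier_vec n \<Longrightarrow> (a \<cdot>\<^sub>m A) *\<^sub>v x = a \<cdot>\<^sub>v (A *\<^sub>v x)"
  by (intro eq_vecI) auto

text \<open>The columns of \<open>B\<close> are vectors of the unit ball of \<open>v\<close> with
  nearly maximal determinant. By Cramer's rule the \<open>i\<close>-th coordinate of
  \<open>x\<close> is the factor by which the determinant changes when column \<open>i\<close> is
  replaced by \<open>x\<close>; near maximality bounds it by 2. \<open>C\<close> only makes the
  supremum positive, so the resulting bounds are uniform over all such \<open>v\<close>.\<close>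

lemma almost_auerbach_basis:
  fixes v :: "real vec \<Rightarrow> real"
  assumes lower: "\<And>x. x \<in> carrier_vec n \<Longrightarrow> vnorm x \<le> v x"
    and upper: "\<And>x. x \<in> carrier_vec n \<Longrightarrow> v x \<le> C * vnorm x"
    and hom: "\<And>a x. x \<in> carrier_vec n \<Longrightarrow> v (a \<cdot>\<^sub>v x) = \<bar>a\<bar> * v x"
  obtains B B' where "B \<in> carrier_mat n n" "B' \<in> carrier_mat n n" "B * B' = 1\<^sub>m n" "B' * B = 1\<^sub>m n"
    "\<And>j. j < n \<Longrightarrow> v (col B j) \<le> 1"
    "\<And>x i. x \<in> carrier_vec n \<Longrightarrow> i < n \<Longrightarrow> \<bar>(B' *\<^sub>v x) $ i\<bar> \<le> 2 * v x"
proof -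
  define K where "K = {B \<in> carrier_mat n n. \<forall>j<n. v (col B j) \<le> 1}"
  define S where "S = (\<lambda>B. \<bar>det B\<bar>) ` K"
  have "\<bar>det B\<bar> \<le> fact n * 1 ^ n" if "B \<in> K" for B
  proof (rule abs_det_le)
    show B: "B \<in> carrier_mat n n" using that by (simp add: K_def)
    fix i j assume ij: "i < n" "j < n"
    have "\<bar>col B j $ i\<bar> \<le> vnorm (col B j)" using B ij by (intro component_le_vnorm) auto
    also have "\<dots> \<le> v (col B j)" using B ij by (intro lower) auto
    also have "\<dots> \<le> 1" using that ij by (simp add: K_def)
    finally show "\<bar>B $$ (i,j)\<bar> \<le> 1" using B ij by simp
  qed
  then have bdd: "bdd_above S" unfolding S_def by (auto intro!: bdd_aboveI2)
  \<comment> \<open>Small enough that the vectors \<open>a \<cdot>\<^sub>v unit_vec n j\<close> lie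
    in the unit ball of \<open>v\<close>; hence \<open>Sup S\<close> is at least
    \<open>a ^ n\<close> and positive.\<close>
  define a where "a = 1 / (\<bar>C\<bar> + 1)"
  have a: "0 < a" by (simp add: a_def add_pos_nonneg)
  have "a \<cdot>\<^sub>m 1\<^sub>m n \<in> K"
  proof -
    have "v (col (a \<cdot>\<^sub>m 1\<^sub>m n) j) \<le> 1" if j: "j < n" for j
    proof -
      have "col (a \<cdot>\<^sub>m 1\<^sub>m n) j = a \<cdot>\<^sub>v unit_vec n j" using j by (intro eq_vecI) (auto simp: unit_vec_def)
      moreover have "vnorm (unit_vec n j) \<le> 1"
        using vnorm_le_sum[of "unit_vec n j"] sum.remove[of "{..<n}" j "\<lambda>i. \<bar>unit_vec n j $ i\<bar> :: real"] j
        by simp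
      then have "v (unit_vec n j) \<le> \<bar>C\<bar>"
        using upper[of "unit_vec n j"] mult_mono[of C "\<bar>C\<bar>" "vnorm (unit_vec n j)" 1] abs_ge_self[of C] by simp
      then have "a * v (unit_vec n j) \<le> 1" by (simp add: a_def divide_le_eq)
      ultimately show ?thesis using hom[of "unit_vec n j" a] a by simp
    qed
    then show ?thesis by (simp add: K_def)
  qed
  moreover have "\<bar>det (a \<cdot>\<^sub>m 1\<^sub>m n)\<bar> = a ^ n" using a by (simp add: abs_mult power_abs)
  ultimately have "a ^ n \<in> S" unfolding S_def by force
  then have Sup: "0 < Sup S" "S \<noteq> {}"
    using cSup_upper[OF _ bdd, of "a ^ n"] zero_less_power[OF a, of n] by auto
  \<comment> \<open>Half of the supremum suffices, which avoids a compactness argument for a true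
    maximiser; the price is the factor 2.\<close>
  obtain B where B: "B \<in> K" "Sup S / 2 < \<bar>det B\<bar>"
    using less_cSup_iff[OF Sup(2) bdd, of "Sup S / 2"] Sup(1) by (auto simp: S_def)
  have cB: "B \<in> carrier_mat n n" using B by (simp add: K_def)
  have d: "det B \<noteq> 0" using B Sup by auto
  define B' where "B' = (1 / det B) \<cdot>\<^sub>m adj_mat B"
  note adj = adj_mat[OF cB]
  have cB': "B' \<in> carrier_mat n n" using adj by (simp add: B'_def)
  have BB': "B * B' = 1\<^sub>m n" "B' * B = 1\<^sub>m n"
    using adj cB d by (auto simp: B'_def mult_smult_distrib[OF cB] mult_smult_assoc_mat[OF _ cB] intro!: eq_matI)
  have coord: "\<bar>(B' *\<^sub>v x) $ i\<bar> \<le> 2" if x: "x \<in> carrier_vec n" "v x \<le> 1" and i: "i < n" for x i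
  proof -
    have "B *\<^sub>v (B' *\<^sub>v x) = x" using cB cB' x BB' by (simp flip: assoc_mult_mat_vec)
    then have det: "det (replace_col B x i) = (B' *\<^sub>v x) $ i * det B"
      using cramer_lemma_mat[OF cB, of "B' *\<^sub>v x" i] cB' x i by simp
    have "col (replace_col B x i) j = (if j = i then x else col B j)" if "j < n" for j
      using cB x that by (auto simp: replace_col_def intro!: eq_vecI)
    then have "replace_col B x i \<in> K"
      using B x cB by (auto simp: K_def replace_col_def)
    then have "\<bar>det (replace_col B x i)\<bar> \<le> Sup S"
      unfolding S_def using bdd[unfolded S_def] by (intro cSup_upper) auto
    then have "\<bar>(B' *\<^sub>v x) $ i\<bar> * \<bar>det B\<bar> \<le> 2 * \<bar>det B\<bar>"
      using B(2) unfolding det abs_mult by linarith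
    then show ?thesis using d by (simp add: mult_le_cancel_right)
  qed
  have "\<bar>(B' *\<^sub>v x) $ i\<bar> \<le> 2 * v x" if x: "x \<in> carrier_vec n" and i: "i < n" for x i
  proof (cases "v x = 0")
    case True
    then have "vnorm x = 0" using lower[OF x] vnorm_nonneg[of x] by linarith
    then have "x = 0\<^sub>v n" using vnorm_eq_0_iff[OF x] by simp
    then show ?thesis using True cB' i by simp
  next
    case False
    then have pos: "0 < v x" using lower[OF x] vnorm_nonneg[of x] by linarith
    have "\<bar>(B' *\<^sub>v ((1 / v x) \<cdot>\<^sub>v x)) $ i\<bar> \<le> 2"
      using hom[OF x, of "1 / v x"] pos x i by (intro coord) auto
    also have "B' *\<^sub>v ((1 / v x) \<cdot>\<^sub>v x) = (1 / v x) \<cdot>\<^sub>v (B' *\<^sub>v x)"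
      using cB' x by (rule mult_mat_vec)
    finally show ?thesis using pos cB' i by (simp add: abs_mult divide_le_eq)
  qed
  then show thesis using that[OF cB cB' BB'] B by (auto simp: K_def)
qed

text \<open>The box is cut into cells of side \<delta>, indexed by lists of floors. \<open>N\<close>
  exceeds the number of cells and depends only on \<open>n\<close>, \<open>b\<close> and \<delta>,
  not on the sequence; two points in one cell differ by at most \<delta> in each coordinate.\<close>

lemma pigeonhole_box:
  fixes b \<delta> :: real
  assumes "0 < \<delta>"
  shows "\<exists>N\<ge>1. \<forall>y :: nat \<Rightarrow> real vec. (\<forall>j\<le>N. \<forall>i<n. \<bar>y j $ i\<bar> \<le> b) \<longrightarrow>
           (\<exists>i j. i < j \<and> j \<le> N \<and> (\<forall>l<n. \<bar>y j $ l - y i $ l\<bar> \<le> \<delta>))"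
proof -
  define m where "m = {\<lfloor>- b / \<delta>\<rfloor>..\<lfloor>b / \<delta>\<rfloor>}"
  define T where "T = {xs :: int list. set xs \<subseteq> m \<and> length xs = n}"
  have fin: "finite T" unfolding T_def by (rule finite_lists_length_eq) (simp add: m_def)
  have "\<exists>i j. i < j \<and> j \<le> card T + 1 \<and> (\<forall>l<n. \<bar>y j $ l - y i $ l\<bar> \<le> \<delta>)"
    if y: "\<And>i j. j \<le> card T + 1 \<Longrightarrow> i < n \<Longrightarrow> \<bar>y j $ i\<bar> \<le> b" for y :: "nat \<Rightarrow> real vec"
  proof -
    define c where "c j = map (\<lambda>i. \<lfloor>y j $ i / \<delta>\<rfloor>) [0..<n]" for j
    have "\<lfloor>y j $ i / \<delta>\<rfloor> \<in> m" if "j \<le> card T + 1" "i < n" for i j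
      using y[OF that] \<open>0 < \<delta>\<close> by (auto simp: m_def abs_le_iff divide_right_mono intro!: floor_mono)
        (metis divide_minus_left divide_right_mono le_less minus_le_iff)
    then have "c ` {..card T + 1} \<subseteq> T" by (auto simp: c_def T_def)
    then have "card (c ` {..card T + 1}) < card {..card T + 1}"
      using card_mono[OF fin, of "c ` {..card T + 1}"] by simp
    then have "\<not> inj_on c {..card T + 1}" by (rule pigeonhole)
    then obtain i j where ij: "i < j" "j \<le> card T + 1" "c i = c j"
      unfolding inj_on_def by (metis atMost_iff linorder_neqE_nat)
    have "\<bar>y j $ l - y i $ l\<bar> \<le> \<delta>" if "l < n" for l
    proof -
      have "c i ! l = c j ! l" using ij by simp
      then have "\<lfloor>y i $ l / \<delta>\<rfloor> = \<lfloor>y j $ l / \<delta>\<rfloor>" using that by (simp add: c_def)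
      then have "\<bar>y j $ l / \<delta> - y i $ l / \<delta>\<bar> < 1" by linarith
      then have "\<bar>(y j $ l - y i $ l) / \<delta>\<bar> < 1" by (simp add: diff_divide_distrib)
      then show ?thesis using \<open>0 < \<delta>\<close> by (simp add: abs_divide divide_less_eq)
    qed
    then show ?thesis using ij by blast
  qed
  then show ?thesis by (intro exI[of _ "card T + 1"]) auto
qed

section \<open>Products over lists of matrices and norms adapted to them\<close>

abbreviation mat_prod :: "nat \<Rightarrow> real mat list \<Rightarrow> real mat" where
  "mat_prod n Ms \<equiv> foldr (*) Ms (1\<^sub>m n)"

lemma mat_prod_carrier [simp]: "set Ms \<subseteq> carrier_mat n n \<Longrightarrow> mat_prod n Ms \<in> carrier_mat n n"
  by (induction Ms) auto

lemma mat_prod_append: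
  assumes "set Ms \<subseteq> carrier_mat n n" "set Ns \<subseteq> carrier_mat n n"
  shows "mat_prod n (Ms @ Ns) = mat_prod n Ms * mat_prod n Ns"
  using assms
proof (induction Ms)
  case (Cons M Ms)
  then show ?case by (simp add: assoc_mult_mat[of M n n _ n _ n])
qed (simp add: mat_prod_carrier[THEN left_mult_one_mat])

lemma mat_prod_concat_replicate:
  assumes "set Ms \<subseteq> carrier_mat n n"
  shows "mat_prod n (concat (replicate m Ms)) = mat_prod n Ms ^\<^sub>m m"
proof (induction m)
  case (Suc m)
  have "concat (replicate (Suc m) Ms) = concat (replicate m Ms) @ Ms"
    by (induction m) auto
  then show ?case using Suc assms mat_prod_append[of "concat (replicate m Ms)" n Ms]
    by (auto simp: subset_iff)
qed (use mat_prod_carrier[OF assms] in simp)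

lemma gauge_mat_prod_le:
  assumes "set Ms \<subseteq> \<A>" "\<A> \<subseteq> carrier_mat n n" "0 \<le> \<rho>"
    and "\<And>M x. M \<in> \<A> \<Longrightarrow> x \<in> carrier_vec n \<Longrightarrow> v (M *\<^sub>v x) \<le> \<rho> * v x" and "x \<in> carrier_vec n"
  shows "v (mat_prod n Ms *\<^sub>v x) \<le> \<rho> ^ length Ms * (v x :: real)"
  using assms(1)
proof (induction Ms)
  case (Cons M Ms)
  then have c: "M \<in> carrier_mat n n" "mat_prod n Ms \<in> carrier_mat n n" using assms(2) by auto
  then have "v (M *\<^sub>v (mat_prod n Ms *\<^sub>v x)) \<le> \<rho> * v (mat_prod n Ms *\<^sub>v x)"
    using Cons.prems assms(4,5) by auto
  also have "\<dots> \<le> \<rho> * (\<rho> ^ length Ms * v x)" using Cons assms(3) by (intro mult_left_mono) auto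
  finally show ?case using c assms(5) by simp
qed (use assms(5) in simp)

text \<open>Triangle inequality, adding one coordinate at a time along the truncations
  \<open>w k\<close>. It ensures that a vector of substantial gauge has a substantial
  coordinate.\<close>

lemma gauge_mult_mat_vec_le:
  fixes v :: "real vec \<Rightarrow> real"
  assumes hom: "\<And>a x. x \<in> carrier_vec n \<Longrightarrow> v (a \<cdot>\<^sub>v x) = \<bar>a\<bar> * v x"
    and tri: "\<And>x y. x \<in> carrier_vec n \<Longrightarrow> y \<in> carrier_vec n \<Longrightarrow> v (x + y) \<le> v x + v y"
    and B: "B \<in> carrier_mat n m" "\<And>j. j < m \<Longrightarrow> v (col B j) \<le> 1" and a: "a \<in> carrier_vec m"
  shows "v (B *\<^sub>v a) \<le> (\<Sum>l<m. \<bar>a $ l\<bar>)"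
proof -
  define w where "w k = vec m (\<lambda>l. if l < k then a $ l else 0)" for k
  have "v (B *\<^sub>v w k) \<le> (\<Sum>l<k. \<bar>a $ l\<bar>)" if "k \<le> m" for k
    using that
  proof (induction k)
    case 0
    have "w 0 = 0\<^sub>v m" by (auto simp: w_def)
    then have "B *\<^sub>v w 0 = 0\<^sub>v n" using B by (auto intro!: eq_vecI)
    moreover have "0 \<cdot>\<^sub>v 0\<^sub>v n = (0\<^sub>v n :: real vec)" by auto
    then have "v (0\<^sub>v n) = 0" using hom[of "0\<^sub>v n" 0] by simp
    ultimately show ?case by simp
  next
    case (Suc k)
    have "w (Suc k) = w k + a $ k \<cdot>\<^sub>v unit_vec m k"
      using Suc.prems by (auto simp: w_def unit_vec_def less_Suc_eq)
    then have "B *\<^sub>v w (Suc k) = B *\<^sub>v w k + a $ k \<cdot>\<^sub>v (B *\<^sub>v unit_vec m k)"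
      using B by (simp add: mult_add_distrib_mat_vec[of _ n m] mult_mat_vec[of _ n m] w_def)
    also have "B *\<^sub>v unit_vec m k = col B k"
      using B Suc.prems by (simp add: mult_mat_unit_vec)
    finally have "v (B *\<^sub>v w (Suc k)) \<le> v (B *\<^sub>v w k) + \<bar>a $ k\<bar> * v (col B k)"
      using tri[of "B *\<^sub>v w k" "a $ k \<cdot>\<^sub>v col B k"] hom[of "col B k" "a $ k"] B(1) Suc.prems
        col_dim[of B k] by (simp add: w_def)
    moreover have "\<bar>a $ k\<bar> * v (col B k) \<le> \<bar>a $ k\<bar> * 1"
      using B Suc.prems by (intro mult_left_mono) auto
    ultimately show ?case using Suc by simp
  qed
  from this[of m] have "v (B *\<^sub>v w m) \<le> (\<Sum>l<m. \<bar>a $ l\<bar>)" by simp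
  moreover have "w m = a" using a by (auto simp: w_def)
  ultimately show ?thesis by simp
qed

text \<open>The equivalence constant is quantified existentially on purpose: results about such
  norms are to hold uniformly, so no bound may mention it.\<close>

definition dominating_norm :: "nat \<Rightarrow> (real vec \<Rightarrow> real) \<Rightarrow> bool" where
  "dominating_norm n v \<longleftrightarrow>
     (\<forall>x\<in>carrier_vec n. vnorm x \<le> v x) \<and> (\<exists>C. \<forall>x\<in>carrier_vec n. v x \<le> C * vnorm x) \<and>
     (\<forall>a. \<forall>x\<in>carrier_vec n. v (a \<cdot>\<^sub>v x) = \<bar>a\<bar> * v x) \<and>
     (\<forall>x\<in>carrier_vec n. \<forall>y\<in>carrier_vec n. v (x + y) \<le> v x + v y)"

text \<open>The order of quantifiers is the point: \<open>N\<close> is chosen before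
  \<open>v\<close>, \<rho> and \<open>Ms\<close>. If a product of length \<open>N\<close> failed to
  halve the trivial bound \<open>\<rho> ^ N\<close>, the normalised orbit would keep gauge above
  1/2, and recurrence would produce a segment of factors with an almost fixed vector. The condition
  \<open>1 \<le> \<rho>\<close> keeps the normalised eigenvalues of this segment at modulus at most
  \<kappa>.\<close>

lemma long_products_contract:
  fixes \<A> :: "real mat set"
  assumes \<A>: "\<A> \<subseteq> carrier_mat n n" and \<kappa>: "0 \<le> \<kappa>" "\<kappa> < 1"
    and ev: "\<And>Ms e. Ms \<noteq> [] \<Longrightarrow> set Ms \<subseteq> \<A> \<Longrightarrow>
       eigenvalue (map_mat complex_of_real (mat_prod n Ms)) e \<Longrightarrow> cmod e \<le> \<kappa> ^ length Ms"
  shows "\<exists>N\<ge>1. \<forall>v \<rho> Ms. \<forall>x\<in>carrier_vec n. 1 \<le> \<rho> \<longrightarrow> dominating_norm n v \<longrightarrow>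
     (\<forall>M\<in>\<A>. \<forall>x\<in>carrier_vec n. v (M *\<^sub>v x) \<le> \<rho> * v x) \<longrightarrow>
     set Ms \<subseteq> \<A> \<longrightarrow> length Ms = N \<longrightarrow> v (mat_prod n Ms *\<^sub>v x) \<le> \<rho> ^ N / 2 * v x"
proof -
  \<comment> \<open>\<open>K\<close> is the constant of \<open>abs_det_mult_le\<close> for entries
    bounded by 3. With this \<delta>, \<open>n * K * \<delta>\<close> is at most a quarter of
    \<open>(1 - \<kappa>) ^ n\<close>, whereas the determinant bound will demand more than a half.
    The added 1s keep the denominator positive when \<open>n = 0\<close>.\<close>
  define K where "K = real n * (fact (n - 1) * 3 ^ (n - 1))"
  define \<delta> where "\<delta> = (1 - \<kappa>) ^ n / (4 * (real n + 1) * (K + 1))"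
  have K: "0 \<le> K" by (simp add: K_def)
  then have \<delta>: "0 < \<delta>" using \<kappa> by (simp add: \<delta>_def)
  obtain N where N: "1 \<le> N" and pigeon: "\<And>y :: nat \<Rightarrow> real vec. (\<And>i j. j \<le> N \<Longrightarrow> i < n \<Longrightarrow> \<bar>y j $ i\<bar> \<le> 2) \<Longrightarrow>
      \<exists>i j. i < j \<and> j \<le> N \<and> (\<forall>l<n. \<bar>y j $ l - y i $ l\<bar> \<le> \<delta>)"
    using pigeonhole_box[OF \<delta>, of n 2] by metis
  have "v (mat_prod n Ms *\<^sub>v x) \<le> \<rho> ^ N / 2 * v x"
    if \<rho>: "1 \<le> \<rho>" and v: "dominating_norm n v"
      and contr: "\<And>M x. M \<in> \<A> \<Longrightarrow> x \<in> carrier_vec n \<Longrightarrow> v (M *\<^sub>v x) \<le> \<rho> * v x"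
      and Ms: "set Ms \<subseteq> \<A>" "length Ms = N" and x: "x \<in> carrier_vec n"
    for v \<rho> Ms x
  proof (rule ccontr)
    obtain C where lower: "\<And>x. x \<in> carrier_vec n \<Longrightarrow> vnorm x \<le> v x"
      and upper: "\<And>x. x \<in> carrier_vec n \<Longrightarrow> v x \<le> C * vnorm x"
      and hom: "\<And>a x. x \<in> carrier_vec n \<Longrightarrow> v (a \<cdot>\<^sub>v x) = \<bar>a\<bar> * v x"
      and tri: "\<And>x y. x \<in> carrier_vec n \<Longrightarrow> y \<in> carrier_vec n \<Longrightarrow> v (x + y) \<le> v x + v y"
      using v unfolding dominating_norm_def by blast
    assume neg: "\<not> ?thesis"
    note contr_prod = gauge_mat_prod_le[OF _ \<A>, of _ \<rho> v, OF _ _ contr]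
    have prod_carrier: "mat_prod n Ns \<in> carrier_mat n n" if "set Ns \<subseteq> \<A>" for Ns
      using that \<A> by auto
    have "0 \<le> v x" using lower[OF x] vnorm_nonneg[of x] by linarith
    moreover have "v x \<noteq> 0" using neg contr_prod[OF Ms(1) _ _ _ x] \<rho> by auto
    ultimately have vx: "0 < v x" by simp
    \<comment> \<open>The orbit of \<open>x\<close> under ever longer tails of \<open>Ms\<close>,
      rescaled by the trivial growth \<open>\<rho> ^ j\<close>. Its gauge starts at 1, never
      increases, and by the negated claim still exceeds 1/2 at \<open>N\<close>.
      \<open>W i j\<close> is the segment of factors leading from \<open>y i\<close> to
      \<open>y j\<close>.\<close>
    define y where "y j = (1 / (\<rho> ^ j * v x)) \<cdot>\<^sub>v (mat_prod n (drop (N - j) Ms) *\<^sub>v x)" for j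
    define W where "W i j = mat_prod n (take (j - i) (drop (N - j) Ms))" for i j
    have sub: "set (drop a Ms) \<subseteq> \<A>" "set (take b (drop a Ms)) \<subseteq> \<A>" for a b
      using Ms(1) set_drop_subset[of a Ms] set_take_subset[of b "drop a Ms"] by auto
    have yc: "y j \<in> carrier_vec n" for j
      unfolding y_def using prod_carrier[OF sub(1)] x by (simp add: mult_mat_vec_carrier[of _ n n])
    have Wc: "W i j \<in> carrier_mat n n" for i j unfolding W_def by (rule prod_carrier[OF sub(2)])
    have step: "y j = (1 / \<rho> ^ (j - i)) \<cdot>\<^sub>v (W i j *\<^sub>v y i)" if "i \<le> j" "j \<le> N" for i j
    proof -
      have "drop (N - j) Ms = take (j - i) (drop (N - j) Ms) @ drop (N - i) Ms"
      proof -
        have "drop (N - i) Ms = drop (j - i) (drop (N - j) Ms)" using that by simp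
        then show ?thesis by (simp only: append_take_drop_id)
      qed
      then have "mat_prod n (drop (N - j) Ms) = W i j * mat_prod n (drop (N - i) Ms)"
        using mat_prod_append[of "take (j - i) (drop (N - j) Ms)" n "drop (N - i) Ms"] sub \<A>
        unfolding W_def by (metis subset_trans)
      moreover have "\<rho> ^ j = \<rho> ^ (j - i) * \<rho> ^ i" using that by (simp flip: power_add)
      ultimately show ?thesis
        unfolding y_def using x Wc[of i j] prod_carrier[OF sub(1)[of "N - i"]]
        by (simp add: mult_mat_vec[of _ n n] smult_smult_assoc assoc_mult_mat_vec[of _ n n _ n] mult.assoc)
    qed
    have mono: "v (y j) \<le> v (y i)" if "i \<le> j" "j \<le> N" for i j
    proof -
      have "v (W i j *\<^sub>v y i) \<le> \<rho> ^ (j - i) * v (y i)"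
        using contr_prod[OF sub(2) _ _ _ yc, of "j - i" "N - j" i] \<rho> that Ms(2) by (simp add: W_def)
      then show ?thesis
        unfolding step[OF that] using hom[of "W i j *\<^sub>v y i"] Wc[of i j] yc[of i] \<rho>
        by (simp add: divide_le_eq mult.commute)
    qed
    have y0: "v (y 0) = 1" using vx x Ms(2) by (simp add: y_def hom)
    have yN: "1 / 2 < v (y N)"
      using neg vx x \<rho> prod_carrier[OF Ms(1)] by (simp add: y_def hom field_simps)
    obtain B B' where B: "B \<in> carrier_mat n n" "B' \<in> carrier_mat n n" "B * B' = 1\<^sub>m n" "B' * B = 1\<^sub>m n"
      and col: "\<And>j. j < n \<Longrightarrow> v (col B j) \<le> 1"
      and coord: "\<And>x i. x \<in> carrier_vec n \<Longrightarrow> i < n \<Longrightarrow> \<bar>(B' *\<^sub>v x) $ i\<bar> \<le> 2 * v x"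
      using almost_auerbach_basis[of n v C, OF lower upper hom] by metis
    have "\<exists>i j. i < j \<and> j \<le> N \<and> (\<forall>l<n. \<bar>(B' *\<^sub>v y j) $ l - (B' *\<^sub>v y i) $ l\<bar> \<le> \<delta>)"
    proof (rule pigeon)
      fix i j assume "j \<le> N" "i < n"
      then show "\<bar>(B' *\<^sub>v y j) $ i\<bar> \<le> 2"
        using coord[OF yc, of i j] mono[of 0 j] y0 by simp
    qed
    then obtain i j where ij: "i < j" "j \<le> N"
      and close: "\<And>l. l < n \<Longrightarrow> \<bar>(B' *\<^sub>v y j) $ l - (B' *\<^sub>v y i) $ l\<bar> \<le> \<delta>" by blast
    define a where "a = B' *\<^sub>v y i"
    define s where "s = j - i"
    define \<sigma> where "\<sigma> = \<rho> ^ s"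
    have \<sigma>: "1 \<le> \<sigma>" using \<rho> by (simp add: \<sigma>_def)
    have ac: "a \<in> carrier_vec n" using B yc by (simp add: a_def)
    define U where "U = W i j - \<sigma> \<cdot>\<^sub>m 1\<^sub>m n"
    have Uc: "U \<in> carrier_mat n n" unfolding U_def by (intro minus_carrier_mat smult_carrier_mat one_carrier_mat)
    \<comment> \<open>As \<open>U\<close> already subtracts \<sigma> times the identity, this
      \<open>Q\<close> is the normalised segment minus the identity, written in the new coordinates.
      It sends \<open>a\<close>, the coordinates of \<open>y i\<close>, to the small difference
      between the coordinates of \<open>y j\<close> and \<open>y i\<close>.\<close>
    define Q where "Q = (1 / \<sigma>) \<cdot>\<^sub>m (B' * U * B)"
    have Qc: "Q \<in> carrier_mat n n" using B Uc by (simp add: Q_def)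
    have Q_eq: "Q *\<^sub>v z = (1 / \<sigma>) \<cdot>\<^sub>v (B' *\<^sub>v (W i j *\<^sub>v (B *\<^sub>v z))) - z" if z: "z \<in> carrier_vec n" for z
    proof -
      have Bz: "B *\<^sub>v z \<in> carrier_vec n" using B z by simp
      have "U *\<^sub>v (B *\<^sub>v z) = W i j *\<^sub>v (B *\<^sub>v z) - \<sigma> \<cdot>\<^sub>v (B *\<^sub>v z)"
        unfolding U_def using Wc[of i j] Bz
        by (subst minus_mult_distrib_mat_vec[of _ n n]) (auto simp: smult_mult_mat_vec[of _ n n])
      then have "B' *\<^sub>v (U *\<^sub>v (B *\<^sub>v z)) = B' *\<^sub>v (W i j *\<^sub>v (B *\<^sub>v z)) - \<sigma> \<cdot>\<^sub>v (B' *\<^sub>v (B *\<^sub>v z))"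
        using B Wc[of i j] Bz by (simp add: mult_minus_distrib_mat_vec[of _ n n] mult_mat_vec[of _ n n])
      also have "B' *\<^sub>v (B *\<^sub>v z) = z" using B z by (simp flip: assoc_mult_mat_vec)
      finally have "(B' * U * B) *\<^sub>v z = B' *\<^sub>v (W i j *\<^sub>v (B *\<^sub>v z)) - \<sigma> \<cdot>\<^sub>v z"
        using B Uc z by (simp add: assoc_mult_mat_vec[of _ n n _ n])
      moreover have "Q *\<^sub>v z = (1 / \<sigma>) \<cdot>\<^sub>v ((B' * U * B) *\<^sub>v z)"
        unfolding Q_def using B Uc z by (intro smult_mult_mat_vec[of _ n n]) auto
      ultimately show ?thesis using \<sigma> B Wc[of i j] z
        by (auto intro!: eq_vecI simp: field_simps)
    qed
    \<comment> \<open>At most 2 from the coordinates of the rescaled image of a column in the unit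
      ball, and at most 1 from the identity.\<close>
    have entries: "\<bar>Q $$ (b,c)\<bar> \<le> 3" if bc: "b < n" "c < n" for b c
    proof -
      have colc: "col B c \<in> carrier_vec n" using B(1) col_dim[of B c] by simp
      have "v (W i j *\<^sub>v col B c) \<le> \<sigma> * v (col B c)"
        using contr_prod[OF sub(2)[of "j - i" "N - j"], of "col B c"] \<rho> ij Ms(2) colc
        by (simp add: W_def \<sigma>_def s_def)
      also have "\<dots> \<le> \<sigma> * 1" using \<sigma> col bc by (intro mult_left_mono) auto
      finally have "\<bar>(B' *\<^sub>v (W i j *\<^sub>v col B c)) $ b\<bar> \<le> 2 * \<sigma>"
        using coord[of "W i j *\<^sub>v col B c" b] Wc[of i j] B bc by auto
      then have le2: "\<bar>(1 / \<sigma>) * (B' *\<^sub>v (W i j *\<^sub>v col B c)) $ b\<bar> \<le> 2"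
        using \<sigma> by (simp add: abs_mult divide_le_eq)
      have "Q $$ (b,c) = (Q *\<^sub>v unit_vec n c) $ b" using Qc bc by (simp add: mult_mat_unit_vec)
      also have "\<dots> = (1 / \<sigma>) * (B' *\<^sub>v (W i j *\<^sub>v col B c)) $ b - unit_vec n c $ b"
        using B Wc[of i j] bc by (simp add: Q_eq mult_mat_unit_vec)
      finally have "Q $$ (b,c) = (1 / \<sigma>) * (B' *\<^sub>v (W i j *\<^sub>v col B c)) $ b - unit_vec n c $ b" .
      moreover have "\<bar>unit_vec n c $ b :: real\<bar> \<le> 1" using bc by simp
      ultimately show ?thesis using le2 by linarith
    qed
    have "Q *\<^sub>v a = B' *\<^sub>v y j - B' *\<^sub>v y i"
    proof -
      have "B *\<^sub>v a = y i" using B yc[of i] by (simp add: a_def flip: assoc_mult_mat_vec)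
      then show ?thesis using Q_eq[OF ac] B Wc[of i j] yc[of i] step[of i j] ij
        by (simp add: a_def s_def \<sigma>_def mult_mat_vec[of _ n n])
    qed
    then have Qa: "\<bar>(Q *\<^sub>v a) $ l\<bar> \<le> \<delta>" if "l < n" for l
      using close[OF that] B yc that by simp
    have "1 / 2 < v (y i)" using yN mono[of i N] ij by simp
    also have "y i = B *\<^sub>v a" using B yc[of i] by (simp add: a_def flip: assoc_mult_mat_vec)
    also have "v (B *\<^sub>v a) \<le> (\<Sum>l<n. \<bar>a $ l\<bar>)"
      by (rule gauge_mult_mat_vec_le[OF hom tri B(1) col ac])
    finally have a_big: "1 / 2 < (\<Sum>l<n. \<bar>a $ l\<bar>)" .
    \<comment> \<open>Similarity preserves the determinant, so apart from the scaling only the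
      spectrum of the segment enters. Its eigenvalues have modulus at most
      \<open>\<kappa> ^ s\<close>, and \<sigma> \<ge> 1 gives
      \<open>(1 - \<kappa>) * \<sigma> \<le> \<sigma> - \<kappa> ^ s\<close>.\<close>
    have det: "(1 - \<kappa>) ^ n \<le> \<bar>det Q\<bar>"
    proof -
      have "det Q = (1 / \<sigma>) ^ n * (det B' * det U * det B)"
        unfolding Q_def using B Uc det_smult[of "1 / \<sigma>" "B' * U * B"] det_mult[of B' n U] det_mult[of "B' * U" n B]
        by simp
      also have "det B' * det U * det B = det U"
        using det_mult[OF B(1,2)] B(3) by (simp add: mult.commute mult.left_commute)
      finally have "\<bar>det Q\<bar> = (1 / \<sigma>) ^ n * \<bar>det U\<bar>" using \<sigma> by (simp add: abs_mult power_abs)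
      moreover have "(\<sigma> - \<kappa> ^ s) ^ n \<le> \<bar>det U\<bar>"
        unfolding U_def
      proof (rule abs_det_char_ge[OF Wc])
        show "\<kappa> ^ s \<le> \<sigma>" using \<kappa> \<sigma> power_le_one[of \<kappa> s] by simp
        fix e assume e: "eigenvalue (map_mat complex_of_real (W i j)) e"
        have "length (take (j - i) (drop (N - j) Ms)) = s" using ij Ms(2) by (simp add: s_def)
        moreover from this have "take (j - i) (drop (N - j) Ms) \<noteq> []" using ij by (auto simp: s_def)
        ultimately show "cmod e \<le> \<kappa> ^ s" using ev[OF _ sub(2) e[unfolded W_def]] by simp
      qed (use \<kappa> in simp)
      moreover have "(1 - \<kappa>) ^ n * \<sigma> ^ n \<le> (\<sigma> - \<kappa> ^ s) ^ n"
      proof -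
        have "\<kappa> ^ s \<le> \<kappa>" using \<kappa> ij power_decreasing[of 1 s \<kappa>] by (simp add: s_def)
        also have "\<dots> \<le> \<kappa> * \<sigma>" using mult_left_mono[OF \<sigma> \<kappa>(1)] by simp
        finally have "(1 - \<kappa>) * \<sigma> \<le> \<sigma> - \<kappa> ^ s" by (simp add: algebra_simps)
        then show ?thesis using \<kappa> \<sigma> by (simp add: power_mono flip: power_mult_distrib)
      qed
      ultimately show ?thesis using \<sigma> by (simp add: power_divide pos_le_divide_eq)
    qed
    have "(1 - \<kappa>) ^ n * \<bar>a $ l\<bar> \<le> K * \<delta>" if "l < n" for l
      using abs_det_mult_le[OF Qc ac entries Qa that] mult_right_mono[OF det, of "\<bar>a $ l\<bar>"] by (simp add: K_def)
    then have "(\<Sum>l<n. (1 - \<kappa>) ^ n * \<bar>a $ l\<bar>) \<le> (\<Sum>l<n. K * \<delta>)" by (intro sum_mono) auto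
    then have "(1 - \<kappa>) ^ n * (\<Sum>l<n. \<bar>a $ l\<bar>) \<le> real n * (K * \<delta>)" by (simp add: sum_distrib_left)
    also have "\<dots> \<le> (real n + 1) * ((K + 1) * \<delta>)" using K \<delta> by (intro mult_mono) auto
    also have "\<dots> = (1 - \<kappa>) ^ n / 4"
    proof -
      have "a * (b * (x / (4 * a * b))) = x / 4" if "a \<noteq> 0" "b \<noteq> 0" for a b x :: real
        using that by simp
      from this[of "real n + 1" "K + 1"] show ?thesis using K unfolding \<delta>_def by simp
    qed
    also have "\<dots> < (1 - \<kappa>) ^ n * (1 / 2)" using \<kappa> by simp
    also have "\<dots> < (1 - \<kappa>) ^ n * (\<Sum>l<n. \<bar>a $ l\<bar>)" using \<kappa> a_big by (intro mult_strict_left_mono) auto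
    finally show False .
  qed
  then show ?thesis using N by blast
qed

text \<open>A crude rate \<rho>0 read off from the entries is lowered repeatedly. For a known rate
  \<rho>, the supremum of the rescaled Euclidean norms over all products is a norm in which every
  single matrix expands by at most \<rho>; the halving of products of length \<open>N\<close> in
  this norm yields a better rate.\<close>

lemma joint_spectral_decay:
  fixes \<A> :: "real mat set"
  assumes \<A>: "\<A> \<subseteq> carrier_mat n n" and \<kappa>: "0 \<le> \<kappa>" "\<kappa> < 1"
    and bdd: "\<And>M i j. M \<in> \<A> \<Longrightarrow> i < n \<Longrightarrow> j < n \<Longrightarrow> \<bar>M $$ (i,j)\<bar> \<le> b"
    and ev: "\<And>Ms e. Ms \<noteq> [] \<Longrightarrow> set Ms \<subseteq> \<A> \<Longrightarrow>
       eigenvalue (map_mat complex_of_real (mat_prod n Ms)) e \<Longrightarrow> cmod e \<le> \<kappa> ^ length Ms"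
  shows "\<exists>C \<gamma>. 0 < \<gamma> \<and> \<gamma> < 1 \<and> (\<forall>Ms. set Ms \<subseteq> \<A> \<longrightarrow>
     (\<forall>x\<in>carrier_vec n. vnorm (mat_prod n Ms *\<^sub>v x) \<le> C * \<gamma> ^ length Ms * vnorm x))"
proof -
  obtain N where N: "1 \<le> N" and half: "\<And>v \<rho> Ms x. 1 \<le> \<rho> \<Longrightarrow> dominating_norm n v \<Longrightarrow>
     (\<And>M x. M \<in> \<A> \<Longrightarrow> x \<in> carrier_vec n \<Longrightarrow> v (M *\<^sub>v x) \<le> \<rho> * v x) \<Longrightarrow>
     set Ms \<subseteq> \<A> \<Longrightarrow> length Ms = N \<Longrightarrow> x \<in> carrier_vec n \<Longrightarrow> v (mat_prod n Ms *\<^sub>v x) \<le> \<rho> ^ N / 2 * v x"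
    using long_products_contract[OF \<A> \<kappa> ev] by blast
  have prod_carrier: "mat_prod n Ns \<in> carrier_mat n n" if "set Ns \<subseteq> \<A>" for Ns
    using that \<A> by auto
  define grows where "grows \<rho> C \<longleftrightarrow> (\<forall>Ms. set Ms \<subseteq> \<A> \<longrightarrow>
     (\<forall>x\<in>carrier_vec n. vnorm (mat_prod n Ms *\<^sub>v x) \<le> C * \<rho> ^ length Ms * vnorm x))" for \<rho> C :: real
  define \<eta> where "\<eta> = root N (1 / 2)"
  have \<eta>: "0 < \<eta>" "\<eta> < 1" "\<eta> ^ N = 1 / 2" using N by (simp_all add: \<eta>_def)
  \<comment> \<open>\<open>N\<close> depends neither on the norm nor on \<open>\<rho>\<close>, so as long as \<open>\<rho> \<ge> 1\<close> a growth rate \<open>\<rho>\<close> can be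
    improved by the fixed factor \<open>\<eta>\<close>.\<close>
  have improve: "\<exists>C'. grows (\<eta> * \<rho>) C'" if \<rho>: "1 \<le> \<rho>" and gr: "grows \<rho> C" for \<rho> C
  proof -
    define nrm where "nrm x Ms = vnorm (mat_prod n Ms *\<^sub>v x) / \<rho> ^ length Ms" for x Ms
    \<comment> \<open>Finite by \<open>grows \<rho> C\<close>. The empty product makes it dominate
      \<open>vnorm\<close>, and appending a factor \<open>M\<close> to a product gives
      \<open>v (M *\<^sub>v x) \<le> \<rho> * v x\<close>.\<close>
    define v where "v x = (SUP Ms\<in>{Ms. set Ms \<subseteq> \<A>}. nrm x Ms)" for x
    have nrm_le: "nrm x Ms \<le> C * vnorm x" if "x \<in> carrier_vec n" "set Ms \<subseteq> \<A>" for x Ms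
      using gr that \<rho> by (simp add: nrm_def grows_def divide_le_eq mult_ac)
    have bddv: "bdd_above (nrm x ` {Ms. set Ms \<subseteq> \<A>})" if "x \<in> carrier_vec n" for x
      using nrm_le[OF that] by (intro bdd_aboveI2) auto
    have le_v: "nrm x Ms \<le> v x" if "x \<in> carrier_vec n" "set Ms \<subseteq> \<A>" for x Ms
      unfolding v_def using that bddv by (intro cSUP_upper) auto
    have v_le: "v x \<le> c" if "\<And>Ms. set Ms \<subseteq> \<A> \<Longrightarrow> nrm x Ms \<le> c" for x c
    proof -
      have "[] \<in> {Ms. set Ms \<subseteq> \<A>}" by simp
      then show ?thesis unfolding v_def using that by (intro cSUP_least) blast+
    qed
    have lower: "vnorm x \<le> v x" if x: "x \<in> carrier_vec n" for x
      using le_v[OF x, of "[]"] x by (simp add: nrm_def)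
    have upper: "v x \<le> C * vnorm x" if x: "x \<in> carrier_vec n" for x
      using nrm_le[OF x] by (rule v_le)
    have nrm_smult: "nrm (a \<cdot>\<^sub>v x) Ms = \<bar>a\<bar> * nrm x Ms" if "x \<in> carrier_vec n" "set Ms \<subseteq> \<A>" for a x Ms
      using that prod_carrier[OF that(2)] by (simp add: nrm_def mult_mat_vec[of _ n n] vnorm_smult)
    have hom_le: "v (a \<cdot>\<^sub>v x) \<le> \<bar>a\<bar> * v x" if x: "x \<in> carrier_vec n" for a x
      using nrm_smult[OF x] le_v[OF x] by (intro v_le) (simp add: mult_left_mono)
    have hom: "v (a \<cdot>\<^sub>v x) = \<bar>a\<bar> * v x" if x: "x \<in> carrier_vec n" for a x
    proof (cases "a = 0")
      case True
      then show ?thesis using hom_le[OF x, of 0] lower[of "0 \<cdot>\<^sub>v x"] x by (simp add: vnorm_smult)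
    next
      case False
      then have "v x \<le> \<bar>1 / a\<bar> * v (a \<cdot>\<^sub>v x)"
        using hom_le[of "a \<cdot>\<^sub>v x" "1 / a"] x by (simp add: smult_smult_assoc)
      then have "\<bar>a\<bar> * v x \<le> v (a \<cdot>\<^sub>v x)" using False by (simp add: field_simps)
      then show ?thesis using hom_le[OF x, of a] by simp
    qed
    have tri: "v (x + y) \<le> v x + v y" if xy: "x \<in> carrier_vec n" "y \<in> carrier_vec n" for x y
    proof (rule v_le)
      fix Ms assume Ms: "set Ms \<subseteq> \<A>"
      have "nrm (x + y) Ms \<le> nrm x Ms + nrm y Ms"
        using vnorm_triangle[of "mat_prod n Ms *\<^sub>v x" n "mat_prod n Ms *\<^sub>v y"] xy prod_carrier[OF Ms] \<rho>
        by (simp add: nrm_def mult_add_distrib_mat_vec[of _ n n] divide_right_mono flip: add_divide_distrib)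
      then show "nrm (x + y) Ms \<le> v x + v y" using le_v[OF xy(1) Ms] le_v[OF xy(2) Ms] by linarith
    qed
    have contr: "v (M *\<^sub>v x) \<le> \<rho> * v x" if M: "M \<in> \<A>" and x: "x \<in> carrier_vec n" for M x
    proof (rule v_le)
      fix Ms assume Ms: "set Ms \<subseteq> \<A>"
      have Mc: "M \<in> carrier_mat n n" using M \<A> by auto
      have "mat_prod n (Ms @ [M]) = mat_prod n Ms * M"
        using mat_prod_append[of Ms n "[M]"] Mc Ms \<A> by auto
      then have "nrm (M *\<^sub>v x) Ms = \<rho> * nrm x (Ms @ [M])"
        unfolding nrm_def using Mc prod_carrier[OF Ms] x \<rho>
        by (simp add: assoc_mult_mat_vec[of _ n n _ n])
      also have "\<dots> \<le> \<rho> * v x" using le_v[OF x, of "Ms @ [M]"] M Ms \<rho> by (intro mult_left_mono) auto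
      finally show "nrm (M *\<^sub>v x) Ms \<le> \<rho> * v x" .
    qed
    have dom: "dominating_norm n v"
      unfolding dominating_norm_def using lower upper hom tri by blast
    have half': "v (mat_prod n Ms *\<^sub>v x) \<le> \<rho> ^ N / 2 * v x"
      if "set Ms \<subseteq> \<A>" "length Ms = N" "x \<in> carrier_vec n" for Ms x
      by (rule half[OF \<rho> dom contr that])
    \<comment> \<open>Each block of length \<open>N\<close> gains the factor
      \<open>\<eta> ^ N\<close>, which is 1/2. The leading 2 pays for an incomplete last block,
      where \<open>\<eta> ^ length Ms\<close> is still at least 1/2.\<close>
    have main: "v (mat_prod n Ms *\<^sub>v x) \<le> 2 * (\<eta> * \<rho>) ^ length Ms * v x"
      if "set Ms \<subseteq> \<A>" "x \<in> carrier_vec n" for Ms x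
      using that(1)
    proof (induction "length Ms" arbitrary: Ms rule: less_induct)
      case less
      have pos: "0 \<le> v x" using lower[OF that(2)] vnorm_nonneg[of x] by linarith
      show ?case
      proof (cases "length Ms < N")
        case True
        have "1 \<le> 2 * \<eta> ^ length Ms"
          using power_decreasing[of "length Ms" N \<eta>] True \<eta> by simp
        then have "1 * (\<rho> ^ length Ms * v x) \<le> 2 * \<eta> ^ length Ms * (\<rho> ^ length Ms * v x)"
          using pos \<rho> by (intro mult_right_mono) auto
        moreover have "v (mat_prod n Ms *\<^sub>v x) \<le> \<rho> ^ length Ms * v x"
          using gauge_mat_prod_le[of Ms \<A> n \<rho> v x] less.prems \<A> contr that(2) \<rho> by simp
        ultimately show ?thesis by (simp add: power_mult_distrib mult_ac)
      next
        case False
        define Ns where "Ns = drop N Ms"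
        have Ns: "set Ns \<subseteq> \<A>" "set (take N Ms) \<subseteq> \<A>" "length (take N Ms) = N" "length Ms = N + length Ns"
          using less.prems set_drop_subset[of N Ms] set_take_subset[of N Ms] False by (auto simp: Ns_def)
        have "mat_prod n Ms = mat_prod n (take N Ms) * mat_prod n Ns"
          using mat_prod_append[of "take N Ms" n Ns] subset_trans[OF Ns(1) \<A>] subset_trans[OF Ns(2) \<A>]
          by (simp add: Ns_def)
        then have "v (mat_prod n Ms *\<^sub>v x) = v (mat_prod n (take N Ms) *\<^sub>v (mat_prod n Ns *\<^sub>v x))"
          using prod_carrier[OF Ns(1)] prod_carrier[OF Ns(2)] that(2)
          by (simp add: assoc_mult_mat_vec[of _ n n _ n])
        also have "\<dots> \<le> \<rho> ^ N / 2 * v (mat_prod n Ns *\<^sub>v x)"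
          using half'[OF Ns(2,3)] prod_carrier[OF Ns(1)] that(2) by simp
        also have "\<dots> \<le> \<rho> ^ N / 2 * (2 * (\<eta> * \<rho>) ^ length Ns * v x)"
          using less.hyps[of Ns] Ns N \<rho> by (intro mult_left_mono) auto
        also have "\<dots> = 2 * (\<eta> * \<rho>) ^ length Ms * v x"
          using \<eta>(3) Ns(4) by (simp add: power_add power_mult_distrib)
        finally show ?thesis .
      qed
    qed
    have "vnorm (mat_prod n Ms *\<^sub>v x) \<le> (2 * C) * (\<eta> * \<rho>) ^ length Ms * vnorm x"
      if Ms: "set Ms \<subseteq> \<A>" and x: "x \<in> carrier_vec n" for Ms x
    proof -
      have "vnorm (mat_prod n Ms *\<^sub>v x) \<le> v (mat_prod n Ms *\<^sub>v x)"
        using lower prod_carrier[OF Ms] x by simp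
      also have "\<dots> \<le> 2 * (\<eta> * \<rho>) ^ length Ms * v x" by (rule main[OF Ms x])
      also have "\<dots> \<le> 2 * (\<eta> * \<rho>) ^ length Ms * (C * vnorm x)"
        using upper[OF x] \<eta> \<rho> by (intro mult_left_mono) auto
      finally show ?thesis by (simp add: mult_ac)
    qed
    then show ?thesis unfolding grows_def by blast
  qed
  define \<rho>0 where "\<rho>0 = max 1 (real n * real n * \<bar>b\<bar>)"
  have \<rho>0: "1 \<le> \<rho>0" by (simp add: \<rho>0_def)
  have base: "grows \<rho>0 1"
  proof -
    have "vnorm (M *\<^sub>v x) \<le> \<rho>0 * vnorm x" if "M \<in> \<A>" "x \<in> carrier_vec n" for M x
    proof -
      have "vnorm (M *\<^sub>v x) \<le> real n * real n * \<bar>b\<bar> * vnorm x"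
      proof (rule mult_mat_vec_bound)
        fix i j assume "i < n" "j < n"
        then show "\<bar>M $$ (i,j)\<bar> \<le> \<bar>b\<bar>" using bdd[OF that(1), of i j] by linarith
      qed (use that \<A> in auto)
      also have "\<dots> \<le> \<rho>0 * vnorm x" by (intro mult_right_mono) (auto simp: \<rho>0_def)
      finally show ?thesis .
    qed
    then show ?thesis
      using gauge_mat_prod_le[where v = vnorm and \<rho> = \<rho>0, OF _ \<A>]
      unfolding grows_def by (simp add: \<rho>0_def)
  qed
  \<comment> \<open>An improvement presupposes a rate of at least 1; hence the disjunction, whose
    first case records that a rate below 1 has already been reached.\<close>
  have iter: "(\<exists>\<rho> C. 0 < \<rho> \<and> \<rho> < 1 \<and> grows \<rho> C) \<or> (\<exists>C. grows (\<eta> ^ m * \<rho>0) C)" for m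
  proof (induction m)
    case (Suc m)
    then show ?case
    proof (elim disjE)
      assume "\<exists>C. grows (\<eta> ^ m * \<rho>0) C"
      then obtain C where C: "grows (\<eta> ^ m * \<rho>0) C" by blast
      show ?thesis
      proof (cases "\<eta> ^ m * \<rho>0 < 1")
        case True
        moreover have "0 < \<eta> ^ m * \<rho>0" using \<eta> by (simp add: \<rho>0_def)
        ultimately show ?thesis using C by blast
      next
        case False
        then show ?thesis using improve[OF _ C] by (simp add: mult_ac)
      qed
    qed blast
  qed (use base in auto)
  obtain m where "\<eta> ^ m < 1 / \<rho>0"
    using real_arch_pow_inv[of "1 / \<rho>0" \<eta>] \<eta> \<rho>0 by auto
  then have m: "\<eta> ^ m * \<rho>0 < 1" "0 < \<eta> ^ m * \<rho>0" using \<eta> \<rho>0 by (auto simp: field_simps)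
  have "\<exists>\<rho> C. 0 < \<rho> \<and> \<rho> < 1 \<and> grows \<rho> C" using iter[of m] m by blast
  then show ?thesis unfolding grows_def by blast
qed

text \<open>Passing to powers transfers the asymptotic bound to products of every positive length.\<close>
lemma jsr_imp_eigenvalue_bound:
  assumes \<A>: "\<A> \<subseteq> carrier_mat n n" and jsr: "jsr n \<A> < ereal \<kappa>" "0 < \<kappa>"
    and Ms: "Ms \<noteq> []" "set Ms \<subseteq> \<A>"
    and e: "eigenvalue (map_mat complex_of_real (mat_prod n Ms)) e"
  shows "cmod e \<le> \<kappa> ^ length Ms"
proof -
  \<comment> \<open>In dimension 0 there are no eigenvalues, so the default value in the definition
    of \<open>jsr\<close> does not intervene.\<close>
  have n: "0 < n"
  proof -
    have "map_mat complex_of_real (mat_prod n Ms) \<in> carrier_mat n n"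
      using mat_prod_carrier[of Ms n] Ms \<A> by auto
    then show ?thesis using e by (rule eigenvalue_imp_nonzero_dim)
  qed
  have "\<forall>\<^sub>F t in sequentially. (SUP Ms \<in> {Ms. length Ms = t \<and> set Ms \<subseteq> \<A>}.
      ereal (root t (if n = 0 then 0
        else spectral_radius (map_mat complex_of_real (mat_prod n Ms))))) < ereal \<kappa>"
    using jsr(1) unfolding jsr_def by (rule Limsup_lessD)
  then obtain T where T: "\<And>t Ns. T \<le> t \<Longrightarrow> length Ns = t \<Longrightarrow> set Ns \<subseteq> \<A> \<Longrightarrow>
      root t (spectral_radius (map_mat complex_of_real (mat_prod n Ns))) \<le> \<kappa>"
  proof (clarsimp simp: eventually_sequentially)
    fix T assume *: "\<forall>t\<ge>T. (SUP Ms \<in> {Ms. length Ms = t \<and> set Ms \<subseteq> \<A>}.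
      ereal (root t (if n = 0 then 0
        else spectral_radius (map_mat complex_of_real (mat_prod n Ms))))) < ereal \<kappa>"
    assume that: "\<And>T. (\<And>t Ns. T \<le> t \<Longrightarrow> length Ns = t \<Longrightarrow> set Ns \<subseteq> \<A> \<Longrightarrow>
      root t (spectral_radius (map_mat complex_of_real (mat_prod n Ns))) \<le> \<kappa>) \<Longrightarrow> thesis"
    show thesis
    proof (rule that[of T])
      fix t Ns assume Ns: "T \<le> t" "length Ns = t" "set Ns \<subseteq> \<A>"
      then have "ereal (root t (if n = 0 then 0
        else spectral_radius (map_mat complex_of_real (mat_prod n Ns)))) \<le> (SUP Ms \<in> {Ms. length Ms = t \<and> set Ms \<subseteq> \<A>}.
      ereal (root t (if n = 0 then 0
        else spectral_radius (map_mat complex_of_real (mat_prod n Ms)))))"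
        by (intro SUP_upper) auto
      also have "\<dots> < ereal \<kappa>" using * Ns by blast
      finally show "root t (spectral_radius (map_mat complex_of_real (mat_prod n Ns))) \<le> \<kappa>"
        using n by simp
    qed
  qed
  \<comment> \<open>Enough copies to reach the lengths where the eventual bound holds; being a
    successor, \<open>m\<close> also permits cancelling the \<open>m\<close>-th power at the
    end.\<close>
  define m where "m = T + 1"
  define Ns where "Ns = concat (replicate m Ms)"
  define t where "t = length Ns"
  have t: "t = m * length Ms" by (simp add: t_def Ns_def length_concat sum_list_replicate)
  have Ns: "set Ns \<subseteq> \<A>" using Ms by (auto simp: Ns_def)
  have "1 \<le> length Ms" using Ms(1) by (simp add: Suc_le_eq)
  then have tT: "T \<le> t" "0 < t" unfolding t m_def by (auto simp: algebra_simps intro: le_trans[of T "T * length Ms"])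
  let ?c = "map_mat complex_of_real"
  have cM: "?c (mat_prod n Ms) \<in> carrier_mat n n" "?c (mat_prod n Ns) \<in> carrier_mat n n"
    using mat_prod_carrier[of Ms n] mat_prod_carrier[of Ns n] Ms(2) Ns \<A> by auto
  have pow: "?c (mat_prod n Ns) = ?c (mat_prod n Ms) ^\<^sub>m m"
    unfolding Ns_def using Ms(2) \<A>
    by (subst mat_prod_concat_replicate) (auto simp: of_real_hom.mat_hom_pow[OF mat_prod_carrier])
  obtain w where w: "eigenvector (?c (mat_prod n Ms)) w e" using e by (auto simp: eigenvalue_def)
  then have "eigenvector (?c (mat_prod n Ns)) w (e ^ m)"
    using eigenvector_pow[OF cM(1) w, of m] cM unfolding eigenvector_def pow by auto
  then have "e ^ m \<in> spectrum (?c (mat_prod n Ns))"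
    unfolding spectrum_def eigenvalue_def by blast
  then have le: "cmod (e ^ m) \<le> spectral_radius (?c (mat_prod n Ns))" (is "_ \<le> ?S")
    using spectral_radius_mem_max(2)[OF cM(2) n] by blast
  then have S: "0 \<le> ?S" using norm_ge_zero order_trans by blast
  note le
  also have "?S = root t ?S ^ t" using real_root_pow_pos2[OF tT(2) S] by simp
  also have "\<dots> \<le> \<kappa> ^ t"
    using T[OF tT(1) t_def[symmetric] Ns] real_root_ge_zero[OF S] by (rule power_mono)
  finally have "cmod e ^ m \<le> (\<kappa> ^ length Ms) ^ m"
    unfolding t by (simp add: norm_power mult.commute flip: power_mult)
  then show ?thesis using jsr(2) power_le_imp_le_base[of "cmod e" T "\<kappa> ^ length Ms"] by (simp add: m_def)
qed

section \<open>Rank and orthogonal complements\<close>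

lemma vec_eq_0_if_self_orthogonal:
  fixes v :: "real vec"
  assumes "v \<in> carrier_vec n" "v \<bullet> v = 0"
  shows "v = 0\<^sub>v n"
proof -
  have "(\<Sum>i<n. (v $ i)^2) = 0"
    using assms by (simp add: scalar_prod_def power2_eq_square atLeast0LessThan)
  then have "vnorm v = 0" using assms(1) by (simp add: vnorm_def)
  then show ?thesis using vnorm_eq_0_iff[OF assms(1)] by simp
qed

lemma full_column_rank_imp_inj:
  fixes A :: "real mat"
  assumes A: "A \<in> carrier_mat n m" and rank: "mrank n A = m"
    and v: "v \<in> carrier_vec m" "A *\<^sub>v v = 0\<^sub>v n"
  shows "v = 0\<^sub>v m"
proof -
  interpret vec_space "TYPE(real)" n .
  \<comment> \<open>Linear independence concerns the set of columns, where a repeated column would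
    go unnoticed. Repetition is excluded by counting: the rank is at most the number of distinct
    columns.\<close>
  have "distinct (cols A)"
  proof -
    obtain S where S: "maximal S (\<lambda>T. T \<subseteq> set (cols A) \<and> lin_indpt T)"
      using maximal_exists_superset[of "set (cols A)" "\<lambda>T. T \<subseteq> set (cols A) \<and> lin_indpt T" "{}"]
      by (metis (no_types, lifting) List.finite_set empty_subsetI finite.emptyI finite_lin_indpt2 empty_iff)
    have "rank A \<le> card (set (cols A))"
      using rank_card_indpt[OF A S] S by (simp add: maximal_def card_mono)
    then show ?thesis
      using rank A card_length[of "cols A"] card_distinct[of "cols A"] by simp
  qed
  then show ?thesis
    using lin_depI[OF A v(1) _ v(2)] full_rank_lin_indpt[OF A rank] by blast
qed

lemma inverse_mat_exists:
  fixes A :: "'a :: field mat"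
  assumes A: "A \<in> carrier_mat n n" and inj: "\<And>v. v \<in> carrier_vec n \<Longrightarrow> A *\<^sub>v v = 0\<^sub>v n \<Longrightarrow> v = 0\<^sub>v n"
  obtains B where "B \<in> carrier_mat n n" "A * B = 1\<^sub>m n" "B * A = 1\<^sub>m n"
proof -
  have "det A \<noteq> 0" using inj det_0_iff_vec_prod_zero_field[OF A] by blast
  from det_non_zero_imp_unit[OF A this, of "()"] show thesis
    using that by (auto simp: Units_def ring_mat_def)
qed

context
  fixes p r q :: nat and \<alpha> \<alpha>p :: "real mat"
  assumes \<alpha>: "\<alpha> \<in> carrier_mat p r" and \<alpha>_inj: "\<And>v. v \<in> carrier_vec r \<Longrightarrow> \<alpha> *\<^sub>v v = 0\<^sub>v p \<Longrightarrow> v = 0\<^sub>v r"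
    and \<alpha>p: "\<alpha>p \<in> carrier_mat p q" and \<alpha>p_inj: "\<And>v. v \<in> carrier_vec q \<Longrightarrow> \<alpha>p *\<^sub>v v = 0\<^sub>v p \<Longrightarrow> v = 0\<^sub>v q"
    and orth: "transpose_mat \<alpha>p * \<alpha> = 0\<^sub>m q r" and p: "p = r + q"
begin

lemma gram_inj:
  assumes v: "v \<in> carrier_vec q" and 0: "transpose_mat \<alpha>p *\<^sub>v (\<alpha>p *\<^sub>v v) = 0\<^sub>v q"
  shows "v = 0\<^sub>v q"
proof -
  have w: "\<alpha>p *\<^sub>v v \<in> carrier_vec p" using \<alpha>p v by simp
  have "(\<alpha>p *\<^sub>v v) \<bullet> (\<alpha>p *\<^sub>v v) = (transpose_mat \<alpha>p *\<^sub>v (\<alpha>p *\<^sub>v v)) \<bullet> v"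
    using transpose_vec_mult_scalar[OF \<alpha>p v w] by simp
  then have "(\<alpha>p *\<^sub>v v) \<bullet> (\<alpha>p *\<^sub>v v) = 0" using v by (simp add: 0)
  then show ?thesis using vec_eq_0_if_self_orthogonal[OF w] \<alpha>p_inj[OF v] by simp
qed

text \<open>The Gram matrix \<open>transpose_mat \<alpha>p * \<alpha>p\<close> is injective, hence
  invertible, and \<open>S\<close> is \<alpha>p times its inverse. It later provides states of
  prescribed trend and, for each \<open>v\<close>, an impulse \<open>u\<close> with
  \<open>transpose_mat \<alpha>p *\<^sub>v u = v\<close>.\<close>

lemma orthogonal_complement_right_inverse:
  obtains S where "S \<in> carrier_mat p q" "transpose_mat \<alpha>p * S = 1\<^sub>m q"
proof -
  have "transpose_mat \<alpha>p * \<alpha>p \<in> carrier_mat q q" using \<alpha>p by simp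
  then obtain B where B: "B \<in> carrier_mat q q" "transpose_mat \<alpha>p * \<alpha>p * B = 1\<^sub>m q"
    using inverse_mat_exists[of "transpose_mat \<alpha>p * \<alpha>p" q] gram_inj \<alpha>p
    by (metis assoc_mult_mat_vec transpose_carrier_mat)
  then show thesis
    using that[of "\<alpha>p * B"] \<alpha>p by (simp add: assoc_mult_mat[of _ q p _ q _ q])
qed

text \<open>The square matrix formed by the columns of \<alpha> and \<alpha>p is injective because
  the two ranges are orthogonal, hence invertible. So \<open>z\<close> decomposes along both, and
  its part along \<alpha>p vanishes by \<open>gram_inj\<close>.\<close>

lemma orthogonal_complement_kernel:
  assumes z: "z \<in> carrier_vec p" and 0: "transpose_mat \<alpha>p *\<^sub>v z = 0\<^sub>v q"
  obtains w where "w \<in> carrier_vec r" "z = \<alpha> *\<^sub>v w"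
proof -
  \<comment> \<open>The lower blocks have no rows: this is horizontal concatenation.\<close>
  define M where "M = four_block_mat \<alpha> \<alpha>p (0\<^sub>m 0 r) (0\<^sub>m 0 q)"
  have M: "M \<in> carrier_mat p p"
    using four_block_carrier_mat[OF \<alpha>, of "0\<^sub>m 0 q" 0 q] by (simp add: M_def p)
  have split: "M *\<^sub>v (x @\<^sub>v y) = \<alpha> *\<^sub>v x + \<alpha>p *\<^sub>v y"
    if "x \<in> carrier_vec r" "y \<in> carrier_vec q" for x y
    using four_block_mat_mult_vec[OF \<alpha> \<alpha>p _ _ that, of "0\<^sub>m 0 r" 0 "0\<^sub>m 0 q"] \<alpha> \<alpha>p that
    unfolding M_def by (auto intro!: eq_vecI)
  have proj: "transpose_mat \<alpha>p *\<^sub>v (\<alpha> *\<^sub>v x + \<alpha>p *\<^sub>v y) = transpose_mat \<alpha>p *\<^sub>v (\<alpha>p *\<^sub>v y)"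
    if "x \<in> carrier_vec r" "y \<in> carrier_vec q" for x y
  proof -
    have "transpose_mat \<alpha>p *\<^sub>v (\<alpha> *\<^sub>v x) = (transpose_mat \<alpha>p * \<alpha>) *\<^sub>v x"
      using \<alpha> \<alpha>p that by (simp add: assoc_mult_mat_vec[of _ q p _ r])
    also have "\<dots> = 0\<^sub>v q" using that by (auto simp: orth intro!: eq_vecI)
    finally show ?thesis using \<alpha> \<alpha>p that by (simp add: mult_add_distrib_mat_vec[of _ q p])
  qed
  have inj: "v = 0\<^sub>v p" if v: "v \<in> carrier_vec p" "M *\<^sub>v v = 0\<^sub>v p" for v
  proof -
    define x y where "x = vec_first v r" and "y = vec_last v q"
    have xy: "x \<in> carrier_vec r" "y \<in> carrier_vec q" "v = x @\<^sub>v y"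
      using v(1) by (simp_all add: x_def y_def p)
    then have s: "\<alpha> *\<^sub>v x + \<alpha>p *\<^sub>v y = 0\<^sub>v p" using split[OF xy(1,2)] v(2) by simp
    have "transpose_mat \<alpha>p *\<^sub>v 0\<^sub>v p = 0\<^sub>v q" using \<alpha>p by (intro eq_vecI) auto
    then have "y = 0\<^sub>v q"
      using proj[OF xy(1,2)] s by (intro gram_inj[OF xy(2)]) simp
    have "\<alpha>p *\<^sub>v 0\<^sub>v q = 0\<^sub>v p" using \<alpha>p by (intro eq_vecI) auto
    with \<open>y = 0\<^sub>v q\<close> have "\<alpha> *\<^sub>v x = 0\<^sub>v p" using s \<alpha> xy by simp
    then have "x = 0\<^sub>v r" by (rule \<alpha>_inj[OF xy(1)])
    then show ?thesis using xy(3) \<open>y = 0\<^sub>v q\<close> by (auto simp: p)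
  qed
  obtain B where B: "B \<in> carrier_mat p p" "M * B = 1\<^sub>m p" using inverse_mat_exists[OF M inj] by blast
  define x y where "x = vec_first (B *\<^sub>v z) r" and "y = vec_last (B *\<^sub>v z) q"
  have "B *\<^sub>v z \<in> carrier_vec (r + q)" using B z by (simp add: p)
  then have xy: "x \<in> carrier_vec r" "y \<in> carrier_vec q" "B *\<^sub>v z = x @\<^sub>v y"
    by (simp_all add: x_def y_def)
  have "z = M *\<^sub>v (B *\<^sub>v z)" using M B z by (simp flip: assoc_mult_mat_vec)
  then have zxy: "z = \<alpha> *\<^sub>v x + \<alpha>p *\<^sub>v y" using split[OF xy(1,2)] xy(3) by simp
  then have "y = 0\<^sub>v q" using 0 proj[OF xy(1,2)] by (intro gram_inj[OF xy(2)]) simp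
  then have "z = \<alpha> *\<^sub>v x" using zxy \<alpha> \<alpha>p xy by (auto intro!: eq_vecI)
  then show thesis using that xy(1) by blast
qed

end

text \<open>\<open>K\<close> is onto by its right inverse, so \<open>J * K\<close> has the column
  space of \<open>J\<close>; \<open>J\<close> is one-to-one by its left inverse, so this space has
  dimension \<open>q\<close>.\<close>

lemma rank_mult_one_sided_inverses:
  fixes J K L S :: "real mat"
  assumes J: "J \<in> carrier_mat p q" and K: "K \<in> carrier_mat q m" and L: "L \<in> carrier_mat q p" and S: "S \<in> carrier_mat m q"
    and LJ: "L * J = 1\<^sub>m q" and KS: "K * S = 1\<^sub>m q"
  shows "mrank p (J * K) = q"
proof -
  interpret vec_space "TYPE(real)" p .
  have inj: "v = 0\<^sub>v q" if "v \<in> carrier_vec q" "J *\<^sub>v v = 0\<^sub>v p" for v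
  proof -
    have "v = L *\<^sub>v (J *\<^sub>v v)" using J L that(1) LJ by (simp flip: assoc_mult_mat_vec)
    then show ?thesis using L by (auto simp: that(2))
  qed
  have dist: "distinct (cols J)"
  proof -
    have "col J i \<noteq> col J j" if ij: "i < q" "j < q" "i \<noteq> j" for i j
    proof
      assume eq: "col J i = col J j"
      have "unit_vec q i - unit_vec q j = (0\<^sub>v q :: real vec)"
        using J ij eq by (intro inj) (auto simp: mult_minus_distrib_mat_vec[of _ p q] mult_mat_unit_vec)
      then have "(unit_vec q i - unit_vec q j) $ i = (0 :: real)" using ij by simp
      then show False using ij by simp
    qed
    then show ?thesis using J by (simp add: distinct_conv_nth)
  qed
  have "lin_indpt (set (cols J))" using lin_depE[OF J _ dist] inj by blast
  then have "rank J = q" by (rule lin_indpt_full_rank[OF J dist])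
  moreover have "col_space (J * K) = col_space J"
  proof -
    have JK: "J * K \<in> carrier_mat p m" using J K by simp
    have "{y \<in> carrier_vec p. \<exists>x\<in>carrier_vec m. (J * K) *\<^sub>v x = y} =
      {y \<in> carrier_vec p. \<exists>x\<in>carrier_vec q. J *\<^sub>v x = y}"
    proof (intro Collect_cong conj_cong refl iffI; elim bexE)
      fix x y assume "x \<in> carrier_vec m" "(J * K) *\<^sub>v x = y"
      then show "\<exists>x\<in>carrier_vec q. J *\<^sub>v x = y"
        using J K by (intro bexI[of _ "K *\<^sub>v x"]) (auto simp: assoc_mult_mat_vec[of _ p q _ m])
    next
      fix x y assume x: "x \<in> carrier_vec q" "J *\<^sub>v x = y"
      have "K *\<^sub>v (S *\<^sub>v x) = x" using K S x(1) KS by (simp flip: assoc_mult_mat_vec)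
      then show "\<exists>x\<in>carrier_vec m. (J * K) *\<^sub>v x = y"
        using J K S x by (intro bexI[of _ "S *\<^sub>v x"]) (auto simp: assoc_mult_mat_vec[of _ p q _ m])
    qed
    then show ?thesis using col_space_eq[of "J * K" m] col_space_eq[of J q] J K JK by simp
  qed
  ultimately show ?thesis by (simp add: rank_def col_space_def)
qed

section \<open>Jacobians\<close>

lemma mult_mat_vec_lipschitz:
  assumes "A \<in> carrier_mat m n"
  obtains c where "0 < c" "\<And>x. x \<in> carrier_vec n \<Longrightarrow> vnorm (A *\<^sub>v x) \<le> c * vnorm x"
proof
  let ?c = "real m * real n * mnorm A"
  have "0 \<le> mnorm A" by (simp add: mnorm_def sum_nonneg)
  \<comment> \<open>The summand 1 keeps the constant positive even for the zero matrix, so that it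
    can serve as a divisor.\<close>
  then show "0 < ?c + 1" by (simp add: add_nonneg_pos)
  fix x :: "real vec" assume x: "x \<in> carrier_vec n"
  have "vnorm (A *\<^sub>v x) \<le> ?c * vnorm x"
    using assms x entry_le_mnorm[of _ A] by (intro mult_mat_vec_bound) auto
  also have "\<dots> \<le> (?c + 1) * vnorm x" by (intro mult_right_mono) auto
  finally show "vnorm (A *\<^sub>v x) \<le> (?c + 1) * vnorm x" .
qed

lemma has_jac_unique:
  assumes "has_jac F J x n m" "has_jac F J' x n m"
  shows "J = J'"
proof -
  note J = assms(1)[unfolded has_jac_def] and J' = assms(2)[unfolded has_jac_def]
  have Jm: "J \<in> carrier_mat m n" "J' \<in> carrier_mat m n" using J J' by auto
  have cols: "J *\<^sub>v unit_vec n j = J' *\<^sub>v unit_vec n j" if j: "j < n" for j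
  proof -
    let ?e = "unit_vec n j :: real vec"
    define D where "D = vnorm (J *\<^sub>v ?e - J' *\<^sub>v ?e)"
    have ec: "?e \<in> carrier_vec n" by simp
    have "D \<le> 2 * e * vnorm ?e" if e: "0 < e" for e
    proof -
      obtain d where d: "0 < d" "\<And>h. h \<in> carrier_vec n \<Longrightarrow> vnorm h < d \<Longrightarrow> vnorm (F (x + h) - F x - J *\<^sub>v h) \<le> e * vnorm h"
        using J e by blast
      obtain d' where d': "0 < d'" "\<And>h. h \<in> carrier_vec n \<Longrightarrow> vnorm h < d' \<Longrightarrow> vnorm (F (x + h) - F x - J' *\<^sub>v h) \<le> e * vnorm h"
        using J' e by blast
      define s where "s = min d d' / (vnorm ?e + 1)"
      have s: "0 < s" using d d' by (simp add: s_def add_nonneg_pos)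
      have "s * vnorm ?e < min d d'"
      proof -
        have "s * vnorm ?e < s * (vnorm ?e + 1)" using s by simp
        also have "\<dots> = min d d'" using vnorm_nonneg[of ?e] by (simp add: s_def add_nonneg_eq_0_iff)
        finally show ?thesis .
      qed
      then have sm: "vnorm (s \<cdot>\<^sub>v ?e) < d" "vnorm (s \<cdot>\<^sub>v ?e) < d'" using s by (auto simp: vnorm_smult)
      let ?h = "s \<cdot>\<^sub>v ?e"
      define a where "a = F (x + ?h)"
      have Jc: "J \<in> carrier_mat m n" "J' \<in> carrier_mat m n" "F x \<in> carrier_vec m" using J J' by auto
      have "s * D = vnorm (s \<cdot>\<^sub>v (J *\<^sub>v ?e - J' *\<^sub>v ?e))" using s by (simp add: D_def vnorm_smult)
      also have "s \<cdot>\<^sub>v (J *\<^sub>v ?e - J' *\<^sub>v ?e) = J *\<^sub>v ?h - J' *\<^sub>v ?h"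
        using Jc ec by (auto simp: mult_mat_vec[of _ m n] algebra_simps intro!: eq_vecI)
      finally have sD: "s * D = vnorm (J *\<^sub>v ?h - J' *\<^sub>v ?h)" .
      \<comment> \<open>\<open>has_jac\<close> fixes the dimension of \<open>F\<close> only at
        \<open>x\<close> itself. A difference takes the dimension of its second operand, so
        \<open>w\<close> still lies in the right carrier.\<close>
      define w where "w = F (x + ?h) - F x"
      have w: "w \<in> carrier_vec m" unfolding w_def using Jc(3) by (metis carrier_vecD carrier_vecI index_minus_vec(2))
      have "s * D \<le> vnorm (J *\<^sub>v ?h - w) + vnorm (w - J' *\<^sub>v ?h)"
        unfolding sD using Jc ec w by (intro vnorm_diff_triangle[of _ m]) auto
      also have "vnorm (J *\<^sub>v ?h - w) = vnorm (w - J *\<^sub>v ?h)"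
        using Jc ec w by (intro vnorm_minus_commute[of _ m]) auto
      also have "vnorm (w - J *\<^sub>v ?h) + vnorm (w - J' *\<^sub>v ?h) \<le> e * vnorm ?h + e * vnorm ?h"
        unfolding w_def using sm by (intro add_mono d(2) d'(2)) auto
      finally have "s * D \<le> s * (2 * e * vnorm ?e)" using s by (simp add: vnorm_smult)
      then show ?thesis using s by simp
    qed
    then have le: "D \<le> 2 * e * vnorm ?e" if "0 < e" for e using that .
    have "D \<le> 0"
    proof (rule field_le_epsilon)
      fix e :: real assume e: "0 < e"
      let ?N = "2 * vnorm ?e + 1"
      have N: "0 < ?N" using vnorm_nonneg[of ?e] by linarith
      have "D \<le> 2 * (e / ?N) * vnorm ?e" using N e by (intro le) simp
      also have "\<dots> = e * (2 * vnorm ?e / ?N)" by simp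
      also have "\<dots> \<le> e * 1" using N e by (intro mult_left_mono) auto
      finally show "D \<le> 0 + e" by simp
    qed
    then have "vnorm (J *\<^sub>v ?e - J' *\<^sub>v ?e) = 0" using vnorm_nonneg[of "J *\<^sub>v ?e - J' *\<^sub>v ?e"] by (simp add: D_def)
    moreover have "J *\<^sub>v ?e - J' *\<^sub>v ?e \<in> carrier_vec m"
      using J J' by (intro minus_carrier_vec mult_mat_vec_carrier[of _ m n]) auto
    ultimately have "J *\<^sub>v ?e - J' *\<^sub>v ?e = 0\<^sub>v m" using vnorm_eq_0_iff by blast
    then have "(J *\<^sub>v ?e - J' *\<^sub>v ?e) $ i = 0" if "i < m" for i using that by simp
    then show ?thesis using J J' by (intro eq_vecI) auto
  qed
  show ?thesis
  proof (rule eq_matI)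
    fix i j assume "i < dim_row J'" "j < dim_col J'"
    then have ij: "i < m" "j < n" using J' by auto
    have "col J j = col J' j"
      using cols[OF ij(2)] by (simp only: mult_mat_unit_vec[OF Jm(1) ij(2)] mult_mat_unit_vec[OF Jm(2) ij(2)])
    then have "col J j $ i = col J' j $ i" by simp
    then show "J $$ (i,j) = J' $$ (i,j)" using ij Jm by simp
  qed (use Jm in auto)
qed

lemma jacobian_eqI: "has_jac F J x n m \<Longrightarrow> jacobian F x n m = J"
  unfolding jacobian_def using has_jac_unique by blast

lemma has_jac_cong:
  assumes "\<And>y. y \<in> carrier_vec n \<Longrightarrow> F y = G y"
  shows "has_jac F J x n m \<longleftrightarrow> has_jac G J x n m"
  using assms unfolding has_jac_def by (metis add_carrier_vec)

text \<open>The chain rule for a linear inner map. Applied both to \<alpha>p^T and to its right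
  inverse, it transfers differentiability between the variables u and v in both directions.\<close>

lemma has_jac_comp_linear:
  assumes F: "has_jac F J (0\<^sub>v n) n m" and K: "K \<in> carrier_mat n l"
  shows "has_jac (\<lambda>u. F (K *\<^sub>v u)) (J * K) (0\<^sub>v l) l m"
proof -
  note F' = F[unfolded has_jac_def]
  have K0: "K *\<^sub>v 0\<^sub>v l = 0\<^sub>v n" using K by (intro eq_vecI) auto
  obtain c where c: "0 < c" "\<And>x. x \<in> carrier_vec l \<Longrightarrow> vnorm (K *\<^sub>v x) \<le> c * vnorm x"
    using mult_mat_vec_lipschitz[OF K] by blast
  have "\<exists>d>0. \<forall>h\<in>carrier_vec l. vnorm h < d \<longrightarrow>
        vnorm (F (K *\<^sub>v (0\<^sub>v l + h)) - F (K *\<^sub>v 0\<^sub>v l) - (J * K) *\<^sub>v h) \<le> e * vnorm h" if e: "0 < e" for e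
  proof -
    obtain d where d: "0 < d" "\<And>h. h \<in> carrier_vec n \<Longrightarrow> vnorm h < d \<Longrightarrow>
        vnorm (F (0\<^sub>v n + h) - F (0\<^sub>v n) - J *\<^sub>v h) \<le> (e / c) * vnorm h"
      using F' e c(1) by (meson divide_pos_pos)
    have "vnorm (F (K *\<^sub>v (0\<^sub>v l + h)) - F (K *\<^sub>v 0\<^sub>v l) - (J * K) *\<^sub>v h) \<le> e * vnorm h"
      if h: "h \<in> carrier_vec l" "vnorm h < d / c" for h
    proof -
      have Kh: "K *\<^sub>v h \<in> carrier_vec n" using K h by simp
      have "vnorm (K *\<^sub>v h) \<le> c * vnorm h" by (rule c(2)[OF h(1)])
      also have "\<dots> < d" using h(2) c(1) by (simp add: field_simps)
      finally have "vnorm (F (0\<^sub>v n + K *\<^sub>v h) - F (0\<^sub>v n) - J *\<^sub>v (K *\<^sub>v h)) \<le> (e / c) * vnorm (K *\<^sub>v h)"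
        by (rule d(2)[OF Kh])
      also have "\<dots> \<le> (e / c) * (c * vnorm h)" using c(2)[OF h(1)] c(1) e by (intro mult_left_mono) auto
      also have "\<dots> = e * vnorm h" using c(1) by simp
      also have "J *\<^sub>v (K *\<^sub>v h) = (J * K) *\<^sub>v h"
        using F' K h by (simp add: assoc_mult_mat_vec[of _ m n _ l])
      finally show ?thesis using Kh h by (simp add: K0)
    qed
    then show ?thesis using d c by (intro exI[of _ "d / c"]) auto
  qed
  then show ?thesis using F' K mult_carrier_mat[of J m n K l] unfolding has_jac_def by (simp add: K0)
qed

lemma differentiable_vec_cong:
  assumes "\<And>y. y \<in> carrier_vec n \<Longrightarrow> F y = G y"
  shows "differentiable_vec F x n m \<longleftrightarrow> differentiable_vec G x n m" "jacobian F x n m = jacobian G x n m"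
  by (simp_all add: differentiable_vec_def jacobian_def has_jac_cong[OF assms])

lemma vec_first_append_vec: "v \<in> carrier_vec n \<Longrightarrow> vec_first (v @\<^sub>v w) n = v"
  by (intro eq_vecI) (auto simp: vec_first_def)

lemma mult_mat_zero_vec:
  fixes A :: "'a :: comm_ring_1 mat"
  shows "A \<in> carrier_mat n m \<Longrightarrow> A *\<^sub>v 0\<^sub>v m = 0\<^sub>v n"
  by (intro eq_vecI) auto

lemma has_jac_jacobian: "differentiable_vec F x n m \<Longrightarrow> has_jac F (jacobian F x n m) x n m"
  unfolding differentiable_vec_def using jacobian_eqI by metis

section \<open>Convergence of feedback systems\<close>

lemma geometric_increments_convergent:
  fixes u :: "nat \<Rightarrow> real"
  assumes le: "\<And>s. \<bar>u (Suc s) - u s\<bar> \<le> K * \<gamma> ^ s" and \<gamma>: "0 < \<gamma>" "\<gamma> < 1"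
  shows "convergent u"
proof -
  have "summable (\<lambda>s. K * \<gamma> ^ s)" using \<gamma> by (intro summable_mult summable_geometric) simp
  then have "summable (\<lambda>s. u (Suc s) - u s)"
    by (rule summable_comparison_test'[of _ 0]) (use le in auto)
  then have "(\<lambda>t. \<Sum>s<t. u (Suc s) - u s) \<longlonglongrightarrow> (\<Sum>s. u (Suc s) - u s)" by (rule summable_LIMSEQ)
  then have "(\<lambda>t. u t - u 0) \<longlonglongrightarrow> (\<Sum>s. u (Suc s) - u s)" by (simp add: sum_lessThan_telescope)
  then have "(\<lambda>t. u t - u 0 + u 0) \<longlonglongrightarrow> (\<Sum>s. u (Suc s) - u s) + u 0" by (intro tendsto_add tendsto_const)
  then show ?thesis by (auto simp: convergent_def)
qed

lemma vnorm_diff_tendsto_zeroI: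
  assumes x: "\<And>s. x s \<in> carrier_vec n" and L: "L \<in> carrier_vec n"
    and lim: "\<And>i. i < n \<Longrightarrow> (\<lambda>s. x s $ i) \<longlonglongrightarrow> L $ i"
  shows "(\<lambda>s. vnorm (x s - L)) \<longlonglongrightarrow> 0"
proof (rule tendsto_sandwich[of "\<lambda>_. 0" _ _ "\<lambda>s. \<Sum>i<n. \<bar>x s $ i - L $ i\<bar>"])
  have "(\<lambda>s. \<Sum>i<n. \<bar>x s $ i - L $ i\<bar>) \<longlonglongrightarrow> (\<Sum>i<n. \<bar>L $ i - L $ i\<bar>)"
    by (intro tendsto_sum tendsto_rabs tendsto_diff tendsto_const lim) auto
  then show "(\<lambda>s. \<Sum>i<n. \<bar>x s $ i - L $ i\<bar>) \<longlonglongrightarrow> 0" by simp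
  show "\<forall>\<^sub>F s in sequentially. vnorm (x s - L) \<le> (\<Sum>i<n. \<bar>x s $ i - L $ i\<bar>)"
    using x L vnorm_le_sum[of "x _ - L"] by (intro always_eventually allI) (auto intro: order_trans[OF vnorm_le_sum])
qed auto

text \<open>An abstraction of the state equation in which the outcome of the spectral argument
  appears as the assumption \<open>decay\<close>. The boundedness of \<B> makes \<open>F\<close>
  Lipschitz; otherwise \<B> enters only through the factors in \<A>.\<close>

locale feedback_system =
  fixes n d :: nat and A :: "real mat" and F :: "real vec \<Rightarrow> real vec" and \<B> :: "real mat set" and b C \<gamma> :: real
  assumes A: "A \<in> carrier_mat n d"
    and F: "\<And>x. x \<in> carrier_vec n \<Longrightarrow> F x \<in> carrier_vec d"
    and \<B>: "\<B> \<subseteq> carrier_mat n d" and \<B>_bdd: "\<And>\<beta> i j. \<beta> \<in> \<B> \<Longrightarrow> i < n \<Longrightarrow> j < d \<Longrightarrow> \<bar>\<beta> $$ (i,j)\<bar> \<le> b"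
    and secant: "\<And>x y. x \<in> carrier_vec n \<Longrightarrow> y \<in> carrier_vec n \<Longrightarrow>
       \<exists>\<beta>\<in>\<B>. F x - F y = transpose_mat \<beta> *\<^sub>v (x - y)"
    and \<gamma>: "0 < \<gamma>" "\<gamma> < 1"
    and decay: "\<And>Ms z. set Ms \<subseteq> (\<lambda>\<beta>. 1\<^sub>m d + transpose_mat \<beta> * A) ` \<B> \<Longrightarrow> z \<in> carrier_vec d \<Longrightarrow>
       vnorm (mat_prod d Ms *\<^sub>v z) \<le> C * \<gamma> ^ length Ms * vnorm z"
begin

definition step :: "real vec \<Rightarrow> real vec" where "step x = x + A *\<^sub>v F x"

abbreviation \<A> where "\<A> \<equiv> (\<lambda>\<beta>. 1\<^sub>m d + transpose_mat \<beta> * A) ` \<B>"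

lemma \<A>_carrier: "\<A> \<subseteq> carrier_mat d d"
  using A \<B> by auto

lemma step_carrier [simp]: "x \<in> carrier_vec n \<Longrightarrow> step x \<in> carrier_vec n"
  using A F by (auto simp: step_def)

lemma F_step:
  assumes x: "x \<in> carrier_vec n"
  shows "\<exists>M\<in>\<A>. F (step x) = M *\<^sub>v F x"
proof -
  have Fx: "F x \<in> carrier_vec d" using F x by simp
  obtain \<beta> where \<beta>: "\<beta> \<in> \<B>" "F (step x) - F x = transpose_mat \<beta> *\<^sub>v (step x - x)"
    using secant[OF step_carrier[OF x] x] by blast
  have \<beta>c: "\<beta> \<in> carrier_mat n d" using \<beta> \<B> by auto
  have "step x - x = A *\<^sub>v F x" using A Fx x by (auto simp: step_def intro!: eq_vecI)
  then have "F (step x) - F x = (transpose_mat \<beta> * A) *\<^sub>v F x"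
    using \<beta> \<beta>c A Fx by (simp add: assoc_mult_mat_vec[of _ d n _ d])
  moreover have "F (step x) = F x + (F (step x) - F x)"
    using F[OF step_carrier[OF x]] Fx by (intro eq_vecI) auto
  ultimately have "F (step x) = F x + (transpose_mat \<beta> * A) *\<^sub>v F x" by simp
  also have "\<dots> = (1\<^sub>m d + transpose_mat \<beta> * A) *\<^sub>v F x"
    using \<beta>c A Fx by (simp add: add_mult_distrib_mat_vec[of _ d d])
  finally show ?thesis using \<beta> by blast
qed

lemma F_funpow:
  assumes x: "x \<in> carrier_vec n"
  shows "(step ^^ s) x \<in> carrier_vec n \<and> (\<exists>Ms. set Ms \<subseteq> \<A> \<and> length Ms = s \<and> F ((step ^^ s) x) = mat_prod d Ms *\<^sub>v F x)"
proof (induction s)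
  case 0
  then show ?case using x F[OF x] by simp
next
  case (Suc s)
  then obtain Ms where Ms: "set Ms \<subseteq> \<A>" "length Ms = s" "F ((step ^^ s) x) = mat_prod d Ms *\<^sub>v F x" by blast
  obtain M where M: "M \<in> \<A>" "F (step ((step ^^ s) x)) = M *\<^sub>v F ((step ^^ s) x)"
    using F_step Suc by blast
  have "M \<in> carrier_mat d d" "mat_prod d Ms \<in> carrier_mat d d"
    using M Ms \<A>_carrier mat_prod_carrier[of Ms d] by auto
  then have "F ((step ^^ Suc s) x) = mat_prod d (M # Ms) *\<^sub>v F x"
    using M(2) Ms(3) F[OF x] by (simp add: assoc_mult_mat_vec[of _ d d _ d])
  then show ?case using Suc M Ms by (intro conjI exI[of _ "M # Ms"]) auto
qed

lemma F_lipschitz: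
  assumes "x \<in> carrier_vec n" "y \<in> carrier_vec n"
  shows "vnorm (F x - F y) \<le> real d * real n * b * vnorm (x - y)"
proof -
  obtain \<beta> where \<beta>: "\<beta> \<in> \<B>" "F x - F y = transpose_mat \<beta> *\<^sub>v (x - y)" using secant[OF assms] by blast
  then have "\<beta> \<in> carrier_mat n d" using \<B> by auto
  then show ?thesis
    unfolding \<beta>(2) using \<B>_bdd[OF \<beta>(1)] assms by (intro mult_mat_vec_bound) auto
qed

text \<open>The increments \<open>A *\<^sub>v F x\<close> inherit the decay of \<open>F\<close>
  along the orbit and are summable in each coordinate. The secant condition makes \<open>F\<close>
  Lipschitz, so \<open>F\<close> vanishes at the limit.\<close>

lemma step_converges:
  assumes x: "x \<in> carrier_vec n"
  obtains L where "L \<in> carrier_vec n" "F L = 0\<^sub>v d" "(\<lambda>s. vnorm ((step ^^ s) x - L)) \<longlonglongrightarrow> 0"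
proof -
  let ?x = "\<lambda>s. (step ^^ s) x"
  have xc: "?x s \<in> carrier_vec n" for s using F_funpow[OF x] by blast
  have F_le: "vnorm (F (?x s)) \<le> C * \<gamma> ^ s * vnorm (F x)" for s
    using F_funpow[OF x, of s] decay[OF _ F[OF x]] by metis
  obtain a where a: "0 < a" "\<And>z. z \<in> carrier_vec d \<Longrightarrow> vnorm (A *\<^sub>v z) \<le> a * vnorm z"
    using mult_mat_vec_lipschitz[OF A] by blast
  have "convergent (\<lambda>s. ?x s $ i)" if i: "i < n" for i
  proof (rule geometric_increments_convergent[OF _ \<gamma>])
    fix s
    have Fs: "F (?x s) \<in> carrier_vec d" using F xc by simp
    have "?x (Suc s) $ i - ?x s $ i = (A *\<^sub>v F (?x s)) $ i"
      using A Fs xc[of s] i by (simp add: step_def)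
    also have "\<bar>\<dots>\<bar> \<le> vnorm (A *\<^sub>v F (?x s))" using A i by (intro component_le_vnorm) simp
    also have "\<dots> \<le> a * (C * \<gamma> ^ s * vnorm (F x))"
      using a(2)[OF Fs] mult_left_mono[OF F_le[of s], of a] a(1) by linarith
    finally show "\<bar>?x (Suc s) $ i - ?x s $ i\<bar> \<le> (a * C * vnorm (F x)) * \<gamma> ^ s" by (simp add: mult_ac)
  qed
  then obtain l where l: "\<And>i. i < n \<Longrightarrow> (\<lambda>s. ?x s $ i) \<longlonglongrightarrow> l i"
    unfolding convergent_def by metis
  define L where "L = vec n l"
  have L: "L \<in> carrier_vec n" by (simp add: L_def)
  have lim: "(\<lambda>s. vnorm (?x s - L)) \<longlonglongrightarrow> 0"
    using l by (intro vnorm_diff_tendsto_zeroI[OF xc L]) (simp add: L_def)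
  have "(\<lambda>s. real d * real n * b * vnorm (?x s - L) + C * \<gamma> ^ s * vnorm (F x)) \<longlonglongrightarrow> real d * real n * b * 0 + C * 0 * vnorm (F x)"
    using \<gamma> by (intro tendsto_intros lim LIMSEQ_realpow_zero) auto
  moreover have "vnorm (F L) \<le> real d * real n * b * vnorm (?x s - L) + C * \<gamma> ^ s * vnorm (F x)" for s
  proof -
    have c: "F L \<in> carrier_vec d" "F (?x s) \<in> carrier_vec d" using F L xc by auto
    have "vnorm (F L - 0\<^sub>v d) \<le> vnorm (F L - F (?x s)) + vnorm (F (?x s) - 0\<^sub>v d)"
      using c by (intro vnorm_diff_triangle[of _ d]) auto
    moreover have "vnorm (F L - F (?x s)) = vnorm (F (?x s) - F L)"
      by (rule vnorm_minus_commute[OF c])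
    ultimately show ?thesis using F_lipschitz[OF xc[of s] L] F_le[of s] c by simp
  qed
  ultimately have "vnorm (F L) \<le> 0"
    by (intro tendsto_lowerbound[of _ 0 sequentially "vnorm (F L)"]) auto
  then have "F L = 0\<^sub>v d" using vnorm_nonneg[of "F L"] vnorm_eq_0_iff[OF F[OF L]] by simp
  then show thesis using that L lim by blast
qed

text \<open>Writing the difference as \<open>A *\<^sub>v w\<close> turns equality of the values into
  \<open>M *\<^sub>v w = w\<close> for a single factor \<open>M\<close>. The decay of the powers of
  \<open>M\<close> forces \<open>w\<close> to vanish; absence of the eigenvalue 1 is thus read off
  from the decay instead of the spectrum.\<close>

lemma zero_unique:
  assumes x: "x \<in> carrier_vec n" "y \<in> carrier_vec n" and eq: "F x = F y"
    and w: "w \<in> carrier_vec d" "x - y = A *\<^sub>v w"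
  shows "x = y"
proof -
  obtain \<beta> where \<beta>: "\<beta> \<in> \<B>" "F x - F y = transpose_mat \<beta> *\<^sub>v (x - y)" using secant[OF x] by blast
  have \<beta>c: "\<beta> \<in> carrier_mat n d" using \<beta> \<B> by auto
  define M where "M = 1\<^sub>m d + transpose_mat \<beta> * A"
  have M: "M \<in> carrier_mat d d" "M \<in> \<A>" using \<beta> \<beta>c A by (auto simp: M_def)
  have "(transpose_mat \<beta> * A) *\<^sub>v w = F x - F y"
    unfolding \<beta>(2) w(2) using \<beta>c A w(1) by (simp add: assoc_mult_mat_vec[of _ d n _ d])
  also have "\<dots> = 0\<^sub>v d" using F[OF x(2)] by (simp add: eq)
  finally have fixed: "M *\<^sub>v w = w"
    using \<beta>c A w(1) by (simp add: M_def add_mult_distrib_mat_vec[of _ d d])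
  have "mat_prod d (replicate s M) *\<^sub>v w = w" for s
  proof (induction s)
    case (Suc s)
    have "set (replicate s M) \<subseteq> carrier_mat d d" using M(1) by auto
    then have "mat_prod d (replicate s M) \<in> carrier_mat d d" by (rule mat_prod_carrier)
    then show ?case using Suc M(1) w(1) fixed
      by (simp add: assoc_mult_mat_vec[of _ d d _ d] del: foldr_replicate)
  qed (use w in simp)
  then have le: "vnorm w \<le> C * \<gamma> ^ s * vnorm w" for s
    using decay[of "replicate s M" w] M(2) w(1) by fastforce
  have "(\<lambda>s. C * \<gamma> ^ s * vnorm w) \<longlonglongrightarrow> C * 0 * vnorm w"
    using \<gamma> by (intro tendsto_intros LIMSEQ_realpow_zero) auto
  then have "vnorm w \<le> C * 0 * vnorm w"
    using le by (intro tendsto_lowerbound[of _ _ sequentially]) auto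
  then have "w = 0\<^sub>v d" using vnorm_nonneg[of w] vnorm_eq_0_iff[OF w(1)] by simp
  then have "A *\<^sub>v w = 0\<^sub>v n" using A by (auto intro!: eq_vecI)
  then have "(x - y) $ i = 0" if "i < n" for i using w(2) that by simp
  then show ?thesis using x by (intro eq_vecI) auto
qed

end

lemma vnorm_vec_first_diff_le:
  assumes "x \<in> carrier_vec n" "y \<in> carrier_vec n" "p \<le> n"
  shows "vnorm (vec_first x p - vec_first y p) \<le> vnorm (x - y)"
proof -
  have "(\<Sum>i<p. ((vec_first x p - vec_first y p) $ i)^2) = (\<Sum>i<p. ((x - y) $ i)^2)"
    using assms by (intro sum.cong) (auto simp: vec_first_def)
  also have "\<dots> \<le> (\<Sum>i<n. ((x - y) $ i)^2)"
    using assms by (intro sum_mono2) auto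
  finally show ?thesis using assms by (simp add: vnorm_def vec_first_def)
qed

lemma vec_eqI_diff:
  fixes x y :: "'a :: ab_group_add vec"
  assumes "x \<in> carrier_vec n" "y \<in> carrier_vec n" "x - y = 0\<^sub>v n"
  shows "x = y"
proof (rule eq_vecI)
  fix i assume "i < dim_vec y"
  then have "i < n" using assms by simp
  then have "(x - y) $ i = 0" by (simp add: assms(3))
  moreover have "(x - y) $ i = x $ i - y $ i" using assms(1,2) \<open>i < n\<close> by simp
  ultimately show "x $ i = y $ i" by simp
qed (use assms in simp)

lemma vnorm_limit_unique:
  assumes x: "\<And>s. x s \<in> carrier_vec n" and L: "L \<in> carrier_vec n" "L' \<in> carrier_vec n"
    and lim: "(\<lambda>s. vnorm (x s - L)) \<longlonglongrightarrow> 0" "(\<lambda>s. vnorm (x s - L')) \<longlonglongrightarrow> 0"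
  shows "L = L'"
proof -
  have "(\<lambda>s. vnorm (x s - L) + vnorm (x s - L')) \<longlonglongrightarrow> 0 + 0" by (intro tendsto_add lim)
  moreover have "vnorm (L - L') \<le> vnorm (x s - L) + vnorm (x s - L')" for s
    using vnorm_diff_triangle[OF L(1) x L(2), of s] vnorm_minus_commute[OF L(1) x, of s] by simp
  ultimately have "vnorm (L - L') \<le> 0 + 0" by (intro tendsto_lowerbound[of _ _ sequentially]) auto
  then have "vnorm (L - L') = 0" using vnorm_nonneg[of "L - L'"] by linarith
  then have "L - L' = 0\<^sub>v n" using vnorm_eq_0_iff[of "L - L'" n] L by simp
  then show ?thesis by (rule vec_eqI_diff[OF L])
qed

text \<open>Summation by parts. \<open>\<phi> i j\<close> stands for a component of f_i at lag j and
  \<open>\<gamma> i j\<close> for that of g_i, so \<phi> at i is the difference of \<gamma> at i and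
  i - 1, with \<gamma> zero at k. Moving every lag to 1 costs exactly the one-period change of the
  sum of the g_i, which the auxiliary block records.\<close>

lemma lag_sum_telescope:
  fixes \<phi> :: "nat \<Rightarrow> nat \<Rightarrow> real"
  assumes "1 \<le> k"
  defines "\<gamma> \<equiv> \<lambda>i j. - (\<Sum>l\<in>{i + 1..k}. \<phi> l j)"
  shows "(\<Sum>i\<in>{1..k}. \<phi> i i) =
    (\<Sum>i\<in>{1..k}. \<phi> i 1) + (\<Sum>i\<in>{1..k - 1}. \<gamma> i i) - (\<Sum>i\<in>{1..k - 1}. \<gamma> i (i + 1))"
proof -
  obtain K where K: "k = Suc K" using assms(1) by (cases k) auto
  have \<phi>: "\<phi> i j = \<gamma> i j - \<gamma> (i - 1) j" if "i \<in> {1..k}" for i j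
  proof -
    have "{i - 1 + 1..k} = insert i {i + 1..k}" using that by auto
    then show ?thesis by (simp add: \<gamma>_def)
  qed
  have "(\<Sum>i\<in>{1..k}. \<phi> i i) = (\<Sum>i\<in>{1..k}. \<gamma> i i) - (\<Sum>i\<in>{1..k}. \<gamma> (i - 1) i)"
    unfolding sum_subtractf[symmetric] by (intro sum.cong \<phi> refl)
  also have "(\<Sum>i\<in>{1..k}. \<gamma> i i) = (\<Sum>i\<in>{1..K}. \<gamma> i i) + \<gamma> k k" by (simp add: K)
  also have "\<gamma> k k = 0" by (simp add: \<gamma>_def)
  also have "(\<Sum>i\<in>{1..k}. \<gamma> (i - 1) i) = (\<Sum>i\<in>{0..K}. \<gamma> i (i + 1))"
    unfolding K One_nat_def by (subst sum.shift_bounds_cl_Suc_ivl) simp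
  also have "\<dots> = \<gamma> 0 1 + (\<Sum>i\<in>{1..K}. \<gamma> i (i + 1))" by (simp add: sum.atLeast_Suc_atMost)
  also have "\<gamma> 0 1 = - (\<Sum>i\<in>{1..k}. \<phi> i 1)" by (simp add: \<gamma>_def)
  finally show ?thesis by (simp add: K)
qed

lemma mult_mat_vec_nth:
  assumes "A \<in> carrier_mat n m" "x \<in> carrier_vec m" "i < n"
  shows "(A *\<^sub>v x) $ i = (\<Sum>j<m. A $$ (i,j) * x $ j)"
  using assms by (auto simp: scalar_prod_def atLeast0LessThan intro!: sum.cong)

section \<open>The state-space form of the autoregression\<close>

locale nvar =
  fixes p k r :: nat and c \<mu> :: "real vec" and f :: "nat \<Rightarrow> real vec \<Rightarrow> real vec"
    and \<alpha> \<alpha>p :: "real mat" and \<theta> :: "real vec \<Rightarrow> real vec"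
  assumes p: "p \<ge> 1" and k: "k \<ge> 1" and r: "r \<le> p - 1"
    and model: "nvar_model p k c f"
    and Mr: "in_Mr p k r c f \<alpha> \<mu> \<theta>"
    and \<alpha>p: "\<alpha>p \<in> carrier_mat p (p - r)" and \<alpha>p_rank: "mrank p \<alpha>p = p - r"
    and orth: "transpose_mat \<alpha>p * \<alpha> = 0\<^sub>m (p - r) r"
begin

abbreviation q where "q \<equiv> p - r"
definition m where "m = p * (k - 1)"

abbreviation A where "A \<equiv> boldalpha p k r \<alpha>"
abbreviation D where "D \<equiv> Dmat p k"
abbreviation ET where "ET \<equiv> transpose_mat (Emat p k)"
abbreviation g where "g \<equiv> gfun p k f"
abbreviation \<psi> where "\<psi> \<equiv> psifun p k f \<alpha>p"

text \<open>Since c = \<alpha> \<mu>, the shift by \<mu> absorbs the constant of the model: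
  \<open>A\<close> maps the added vector to c in the first block and to 0 elsewhere.\<close>

definition G :: "real vec \<Rightarrow> real vec" where "G x = Fmap p k r f \<theta> x + (\<mu> @\<^sub>v 0\<^sub>v m)"

definition T :: "real vec \<Rightarrow> real vec" where "T x = x + A *\<^sub>v G x"

lemma n_eq: "k * p = p + m"
  using k unfolding m_def by (cases k) auto

lemma Mr_facts:
  "\<alpha> \<in> carrier_mat p r" "mrank p \<alpha> = r" "homeo_vec p (f 0)" "\<mu> \<in> carrier_vec r"
  "z \<in> carrier_vec p \<Longrightarrow> \<theta> z \<in> carrier_vec r" "c = \<alpha> *\<^sub>v \<mu>"
  "z \<in> carrier_vec p \<Longrightarrow> pifun p k f z = \<alpha> *\<^sub>v \<theta> z"
  using Mr by (auto simp: in_Mr_def)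

lemma f_carrier: "i \<le> k \<Longrightarrow> x \<in> carrier_vec p \<Longrightarrow> f i x \<in> carrier_vec p"
  using model by (auto simp: nvar_model_def)

lemma c_carrier: "c \<in> carrier_vec p"
  using model by (auto simp: nvar_model_def)

lemma f0_bij: "bij_betw (f 0) (carrier_vec p) (carrier_vec p)"
  using Mr_facts(3) by (simp add: homeo_vec_def)

lemma f0inv_carrier [simp]: "w \<in> carrier_vec p \<Longrightarrow> f0inv p f w \<in> carrier_vec p"
  unfolding f0inv_def using f0_bij by (metis bij_betw_def subset_refl the_inv_into_into)

lemma f0_f0inv [simp]: "w \<in> carrier_vec p \<Longrightarrow> f 0 (f0inv p f w) = w"
  unfolding f0inv_def using f0_bij by (metis bij_betw_def f_the_inv_into_f)

lemma f0inv_f0 [simp]: "z \<in> carrier_vec p \<Longrightarrow> f0inv p f (f 0 z) = z"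
  unfolding f0inv_def using f0_bij by (metis bij_betw_def the_inv_into_f_f)

lemma D_carrier [simp]: "D \<in> carrier_mat m m"
  by (simp add: Dmat_def m_def)

lemma ET_carrier [simp]: "ET \<in> carrier_mat p m"
  by (simp add: Emat_def m_def)

lemma A_carrier: "A \<in> carrier_mat (k * p) (m + r)"
proof -
  have "A \<in> carrier_mat (p + m) (r + m)"
    unfolding boldalpha_def m_def[symmetric] by (intro four_block_carrier_mat Mr_facts(1)) simp
  then show ?thesis by (simp add: n_eq add.commute)
qed

lemma boldg_carrier [simp]: "boldg p k f z \<in> carrier_vec m"
  by (simp add: boldg_def m_def)

lemma G_append:
  assumes w: "w \<in> carrier_vec p" and \<zeta>: "\<zeta> \<in> carrier_vec m"
  shows "G (w @\<^sub>v \<zeta>) = (\<theta> (f0inv p f w) + \<mu>) @\<^sub>v (boldg p k f (f0inv p f w) + D *\<^sub>v \<zeta>)"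
proof -
  have "D0mat p k r *\<^sub>v (w @\<^sub>v \<zeta>) = (0\<^sub>m r p *\<^sub>v w + 0\<^sub>m r m *\<^sub>v \<zeta>) @\<^sub>v (0\<^sub>m m p *\<^sub>v w + D *\<^sub>v \<zeta>)"
    unfolding D0mat_def m_def[symmetric] by (rule four_block_mat_mult_vec[OF _ _ _ D_carrier w \<zeta>]) auto
  also have "0\<^sub>m r p *\<^sub>v w + 0\<^sub>m r m *\<^sub>v \<zeta> = 0\<^sub>v r" using w \<zeta> by (intro eq_vecI) auto
  also have "0\<^sub>m m p *\<^sub>v w = 0\<^sub>v m" using w by (intro eq_vecI) auto
  also have "0\<^sub>v m + D *\<^sub>v \<zeta> = D *\<^sub>v \<zeta>" using mult_mat_vec_carrier[OF D_carrier \<zeta>] by simp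
  finally have D0: "D0mat p k r *\<^sub>v (w @\<^sub>v \<zeta>) = 0\<^sub>v r @\<^sub>v (D *\<^sub>v \<zeta>)" .
  have first: "vec_first (w @\<^sub>v \<zeta>) p = w" using w by (intro eq_vecI) (auto simp: vec_first_def)
  have c: "\<theta> (f0inv p f w) \<in> carrier_vec r" "D *\<^sub>v \<zeta> \<in> carrier_vec m" "boldg p k f (f0inv p f w) \<in> carrier_vec m"
    using w Mr_facts(5) mult_mat_vec_carrier[OF D_carrier \<zeta>] by auto
  have Fm: "Fmap p k r f \<theta> (w @\<^sub>v \<zeta>) = \<theta> (f0inv p f w) @\<^sub>v (boldg p k f (f0inv p f w) + D *\<^sub>v \<zeta>)"
    unfolding Fmap_def first D0 using c by (subst append_vec_add[of _ r _ _ m]) auto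
  show ?thesis
    unfolding G_def Fm using c Mr_facts(4) by (subst append_vec_add[of _ r _ _ m]) auto
qed

lemma A_append:
  assumes "a \<in> carrier_vec r" "b \<in> carrier_vec m"
  shows "A *\<^sub>v (a @\<^sub>v b) = (\<alpha> *\<^sub>v a + ET *\<^sub>v b) @\<^sub>v b"
proof -
  have "A *\<^sub>v (a @\<^sub>v b) = (\<alpha> *\<^sub>v a + ET *\<^sub>v b) @\<^sub>v (0\<^sub>m m r *\<^sub>v a + 1\<^sub>m m *\<^sub>v b)"
    unfolding boldalpha_def m_def[symmetric]
    by (rule four_block_mat_mult_vec[OF Mr_facts(1) ET_carrier _ _ assms]) auto
  also have "0\<^sub>m m r *\<^sub>v a + 1\<^sub>m m *\<^sub>v b = b" using assms by (intro eq_vecI) auto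
  finally show ?thesis .
qed

lemma split_state:
  assumes "x \<in> carrier_vec (k * p)"
  obtains w \<zeta> where "w \<in> carrier_vec p" "\<zeta> \<in> carrier_vec m" "x = w @\<^sub>v \<zeta>"
  using assms that[of "vec_first x p" "vec_last x m"] by (simp add: n_eq)

lemma T_append:
  assumes w: "w \<in> carrier_vec p" and \<zeta>: "\<zeta> \<in> carrier_vec m"
  defines "z \<equiv> f0inv p f w"
  defines "\<xi> \<equiv> boldg p k f z + D *\<^sub>v \<zeta>"
  shows "T (w @\<^sub>v \<zeta>) = (w + (\<alpha> *\<^sub>v (\<theta> z + \<mu>) + ET *\<^sub>v \<xi>)) @\<^sub>v (\<zeta> + \<xi>)"
proof -
  have c: "\<theta> z + \<mu> \<in> carrier_vec r" "\<xi> \<in> carrier_vec m"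
    using w \<zeta> Mr_facts(4,5) mult_mat_vec_carrier[OF D_carrier \<zeta>] by (auto simp: z_def \<xi>_def)
  have G: "G (w @\<^sub>v \<zeta>) = (\<theta> z + \<mu>) @\<^sub>v \<xi>" unfolding z_def \<xi>_def by (rule G_append[OF w \<zeta>])
  have "\<alpha> *\<^sub>v (\<theta> z + \<mu>) + ET *\<^sub>v \<xi> \<in> carrier_vec p"
    using mult_mat_vec_carrier[OF Mr_facts(1) c(1)] mult_mat_vec_carrier[OF ET_carrier c(2)] by simp
  then show ?thesis unfolding T_def G A_append[OF c] using w \<zeta> c by (simp add: append_vec_add[of _ p _ _ m])
qed

lemma G_carrier: "x \<in> carrier_vec (k * p) \<Longrightarrow> G x \<in> carrier_vec (m + r)"
proof (elim split_state)
  fix w \<zeta> assume c: "w \<in> carrier_vec p" "\<zeta> \<in> carrier_vec m" "x = w @\<^sub>v \<zeta>"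
  have "G (w @\<^sub>v \<zeta>) \<in> carrier_vec (r + m)"
    unfolding G_append[OF c(1,2)] using c Mr_facts(4,5) mult_mat_vec_carrier[OF D_carrier c(2)]
    by (intro append_carrier_vec) auto
  then show ?thesis by (simp add: c add.commute)
qed

lemma feedback: "\<exists>\<B> b C \<gamma>. feedback_system (k * p) (m + r) A G \<B> b C \<gamma>"
proof -
  obtain \<B> bb \<rho>b where \<B>: "\<rho>b < 1" "\<B> \<subseteq> carrier_mat (k * p) (m + r)" "\<And>\<beta>. \<beta> \<in> \<B> \<Longrightarrow> mnorm \<beta> \<le> bb"
    "jsr (m + r) ((\<lambda>\<beta>. 1\<^sub>m (m + r) + transpose_mat \<beta> * A) ` \<B>) \<le> ereal \<rho>b"
    and secant: "\<And>x y. x \<in> carrier_vec (k * p) \<Longrightarrow> y \<in> carrier_vec (k * p) \<Longrightarrow>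
      \<exists>\<beta>\<in>\<B>. Fmap p k r f \<theta> x - Fmap p k r f \<theta> y = transpose_mat \<beta> *\<^sub>v (x - y)"
    using Mr unfolding in_Mr_def m_def[symmetric] by blast
  let ?A = "(\<lambda>\<beta>. 1\<^sub>m (m + r) + transpose_mat \<beta> * A) ` \<B>"
  have bdd: "\<bar>\<beta> $$ (i,j)\<bar> \<le> bb" if "\<beta> \<in> \<B>" "i < k * p" "j < m + r" for \<beta> i j
    using entry_le_mnorm[of i \<beta> j] \<B>(2) \<B>(3)[OF that(1)] that by force
  have Ac: "?A \<subseteq> carrier_mat (m + r) (m + r)" using \<B>(2) A_carrier by auto
  have Abdd: "\<bar>M $$ (i,j)\<bar> \<le> 1 + real (k * p) * (bb * mnorm A)"
    if M: "M \<in> ?A" and ij: "i < m + r" "j < m + r" for M i j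
  proof -
    obtain \<beta> where \<beta>: "\<beta> \<in> \<B>" "M = 1\<^sub>m (m + r) + transpose_mat \<beta> * A" using M by blast
    have \<beta>c: "\<beta> \<in> carrier_mat (k * p) (m + r)" using \<beta> \<B>(2) by auto
    have "M $$ (i,j) = 1\<^sub>m (m + r) $$ (i,j) + (\<Sum>l<k * p. \<beta> $$ (l,i) * A $$ (l,j))"
      using \<beta>(2) \<beta>c A_carrier ij by (auto simp: scalar_prod_def atLeast0LessThan intro!: sum.cong)
    moreover have "\<bar>1\<^sub>m (m + r) $$ (i,j) :: real\<bar> \<le> 1" using ij by simp
    moreover have "\<bar>\<Sum>l<k * p. \<beta> $$ (l,i) * A $$ (l,j)\<bar> \<le> (\<Sum>l<k * p. bb * mnorm A)"
    proof (rule order_trans[OF sum_abs], rule sum_mono)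
      fix l assume "l \<in> {..<k * p}"
      then have l: "l < k * p" by simp
      show "\<bar>\<beta> $$ (l,i) * A $$ (l,j)\<bar> \<le> bb * mnorm A"
        unfolding abs_mult using bdd[OF \<beta>(1) l ij(1)] entry_le_mnorm[of l A j] A_carrier l ij(2)
        by (intro mult_mono) auto
    qed
    ultimately show ?thesis by simp
  qed
  \<comment> \<open>Strictly between the given bound and 1, and positive even if \<rho>b is
    negative. The strict inequality is what lets the limsup control all sufficiently long
    products.\<close>
  define \<kappa> where "\<kappa> = (max \<rho>b 0 + 1) / 2"
  have \<kappa>: "0 < \<kappa>" "\<kappa> < 1" "\<rho>b < \<kappa>" using \<B>(1) by (auto simp: \<kappa>_def)
  have jsr: "jsr (m + r) ?A < ereal \<kappa>" using \<B>(4) \<kappa>(3) by (meson ereal_less_eq(3) less_ereal.simps(1) order_le_less_trans)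
  obtain C \<gamma> where C: "0 < \<gamma>" "\<gamma> < 1" "\<And>Ms x. set Ms \<subseteq> ?A \<Longrightarrow> x \<in> carrier_vec (m + r) \<Longrightarrow>
      vnorm (mat_prod (m + r) Ms *\<^sub>v x) \<le> C * \<gamma> ^ length Ms * vnorm x"
    using joint_spectral_decay[OF Ac less_imp_le[OF \<kappa>(1)] \<kappa>(2) Abdd jsr_imp_eigenvalue_bound[OF Ac jsr \<kappa>(1)]]
    by blast
  have "feedback_system (k * p) (m + r) A G \<B> bb C \<gamma>"
  proof
    fix x y :: "real vec" assume xy: "x \<in> carrier_vec (k * p)" "y \<in> carrier_vec (k * p)"
    have Fm: "dim_vec (Fmap p k r f \<theta> z + (\<mu> @\<^sub>v 0\<^sub>v m)) = r + m" "dim_vec (Fmap p k r f \<theta> z) = r + m" for z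
      using Mr_facts(4) by (auto simp: Fmap_def D0mat_def Dmat_def m_def)
    have "G x - G y = Fmap p k r f \<theta> x - Fmap p k r f \<theta> y"
      unfolding G_def using Mr_facts(4) by (intro eq_vecI) (auto simp: Fm)
    then show "\<exists>\<beta>\<in>\<B>. G x - G y = transpose_mat \<beta> *\<^sub>v (x - y)" using secant[OF xy] by simp
  qed (use A_carrier G_carrier \<B>(2) bdd C in auto)
  then show ?thesis by blast
qed

lemma T_converges:
  assumes "x \<in> carrier_vec (k * p)"
  obtains L where "L \<in> carrier_vec (k * p)" "G L = 0\<^sub>v (m + r)" "(\<lambda>s. vnorm ((T ^^ s) x - L)) \<longlonglongrightarrow> 0"
proof -
  obtain \<B> b C \<gamma> where fb: "feedback_system (k * p) (m + r) A G \<B> b C \<gamma>" using feedback by blast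
  then have "feedback_system.step A G = T"
    by (intro ext) (simp add: feedback_system.step_def T_def)
  then show thesis using feedback_system.step_converges[OF fb assms] that by metis
qed

lemma G_inj_on_range:
  assumes "x \<in> carrier_vec (k * p)" "y \<in> carrier_vec (k * p)" "G x = G y"
    "w \<in> carrier_vec (m + r)" "x - y = A *\<^sub>v w"
  shows "x = y"
  using feedback feedback_system.zero_unique assms by blast

section \<open>The conserved functional and its kernel\<close>

definition trend :: "real mat" where
  "trend = transpose_mat \<alpha>p * four_block_mat (1\<^sub>m p) (- ET) (0\<^sub>m 0 p) (0\<^sub>m 0 m)"

lemma trend_carrier [simp]: "trend \<in> carrier_mat q (k * p)"
proof -
  have "four_block_mat (1\<^sub>m p) (- ET) (0\<^sub>m 0 p) (0\<^sub>m 0 m) \<in> carrier_mat (p + 0) (p + m)"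
    by (intro four_block_carrier_mat) auto
  then show ?thesis unfolding trend_def n_eq using \<alpha>p by (intro mult_carrier_mat) auto
qed

text \<open>Blocks without rows again encode concatenation: \<open>trend\<close> is \<alpha>p^T
  [I, -E^T]. The block -E^T is there to cancel the E^T in the first block row of \<open>A\<close>,
  after which only \<alpha>p^T \<alpha> = 0 remains.\<close>

lemma trend_append:
  assumes w: "w \<in> carrier_vec p" and \<zeta>: "\<zeta> \<in> carrier_vec m"
  shows "trend *\<^sub>v (w @\<^sub>v \<zeta>) = transpose_mat \<alpha>p *\<^sub>v (w - ET *\<^sub>v \<zeta>)"
proof -
  let ?M = "four_block_mat (1\<^sub>m p) (- ET) (0\<^sub>m 0 p) (0\<^sub>m 0 m)"
  have M: "?M \<in> carrier_mat p (p + m)"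
    using four_block_carrier_mat[of "1\<^sub>m p" p p "0\<^sub>m 0 m" 0 m "- ET" "0\<^sub>m 0 p"] by simp
  have "?M *\<^sub>v (w @\<^sub>v \<zeta>) = (1\<^sub>m p *\<^sub>v w + (- ET) *\<^sub>v \<zeta>) @\<^sub>v (0\<^sub>m 0 p *\<^sub>v w + 0\<^sub>m 0 m *\<^sub>v \<zeta>)"
    using w \<zeta> ET_carrier by (intro four_block_mat_mult_vec) auto
  also have "\<dots> = w - ET *\<^sub>v \<zeta>"
    using w \<zeta> ET_carrier by (intro eq_vecI) (auto simp: Emat_def)
  finally show ?thesis
    unfolding trend_def using \<alpha>p M w \<zeta> by (simp add: assoc_mult_mat_vec[of _ q p _ "p + m"])
qed

lemma trend_A: "a \<in> carrier_vec (m + r) \<Longrightarrow> trend *\<^sub>v (A *\<^sub>v a) = 0\<^sub>v q"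
proof -
  assume "a \<in> carrier_vec (m + r)"
  then have "a \<in> carrier_vec (r + m)" by (simp add: add.commute)
  then obtain b \<xi> where ab: "b \<in> carrier_vec r" "\<xi> \<in> carrier_vec m" "a = b @\<^sub>v \<xi>"
    by (metis vec_first_carrier vec_last_carrier vec_first_last_append)
  have c: "\<alpha> *\<^sub>v b \<in> carrier_vec p" "ET *\<^sub>v \<xi> \<in> carrier_vec p"
    using mult_mat_vec_carrier[OF Mr_facts(1) ab(1)] mult_mat_vec_carrier[OF ET_carrier ab(2)] by auto
  have "trend *\<^sub>v (A *\<^sub>v a) = transpose_mat \<alpha>p *\<^sub>v (\<alpha> *\<^sub>v b + ET *\<^sub>v \<xi> - ET *\<^sub>v \<xi>)"
    unfolding ab(3) A_append[OF ab(1,2)] using c ab by (intro trend_append) auto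
  also have "\<alpha> *\<^sub>v b + ET *\<^sub>v \<xi> - ET *\<^sub>v \<xi> = \<alpha> *\<^sub>v b"
    using c by (intro eq_vecI) (auto simp del: index_mult_mat_vec dim_mult_mat_vec)
  also have "transpose_mat \<alpha>p *\<^sub>v (\<alpha> *\<^sub>v b) = (transpose_mat \<alpha>p * \<alpha>) *\<^sub>v b"
    using \<alpha>p Mr_facts(1) ab by (simp add: assoc_mult_mat_vec[of _ q p _ r])
  also have "\<dots> = 0\<^sub>v q" using ab by (auto simp: orth intro!: eq_vecI)
  finally show ?thesis .
qed

lemma T_carrier: "x \<in> carrier_vec (k * p) \<Longrightarrow> T x \<in> carrier_vec (k * p)"
  unfolding T_def using mult_mat_vec_carrier[OF A_carrier G_carrier] by simp

lemma trend_T: "x \<in> carrier_vec (k * p) \<Longrightarrow> trend *\<^sub>v T x = trend *\<^sub>v x"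
  unfolding T_def using mult_mat_vec_carrier[OF A_carrier G_carrier] trend_A[OF G_carrier]
    mult_mat_vec_carrier[OF trend_carrier]
  by (simp add: mult_add_distrib_mat_vec[OF trend_carrier])

lemma trend_funpow:
  "x \<in> carrier_vec (k * p) \<Longrightarrow> (T ^^ s) x \<in> carrier_vec (k * p) \<and> trend *\<^sub>v (T ^^ s) x = trend *\<^sub>v x"
  by (induction s) (auto simp: T_carrier trend_T)

lemma q_split: "p = r + q"
  using p r by simp

lemmas \<alpha>_inj = full_column_rank_imp_inj[OF Mr_facts(1,2)]
lemmas \<alpha>p_inj = full_column_rank_imp_inj[OF \<alpha>p \<alpha>p_rank]

lemma \<alpha>p_kernel:
  assumes "z \<in> carrier_vec p" "transpose_mat \<alpha>p *\<^sub>v z = 0\<^sub>v q"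
  shows "\<exists>w\<in>carrier_vec r. z = \<alpha> *\<^sub>v w"
proof (rule orthogonal_complement_kernel[of \<alpha> p r \<alpha>p q z])
  show "p = r + q" by (rule q_split)
qed (use Mr_facts(1) \<alpha>p \<alpha>_inj \<alpha>p_inj orth assms in blast)+

lemma \<alpha>p_right_inverse:
  obtains S where "S \<in> carrier_mat p q" "transpose_mat \<alpha>p * S = 1\<^sub>m q"
proof (rule orthogonal_complement_right_inverse[of \<alpha> p r \<alpha>p q])
  show "p = r + q" by (rule q_split)
qed (use Mr_facts(1) \<alpha>p \<alpha>_inj \<alpha>p_inj orth that in blast)+

text \<open>Subtracting E^T \<zeta> from the first block leaves a vector orthogonal to the columns
  of \<alpha>p, hence in the range of \<alpha>. Two states of equal trend therefore differ by a
  vector of the form required in \<open>G_inj_on_range\<close>.\<close>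

lemma trend_kernel:
  assumes x: "x \<in> carrier_vec (k * p)" and 0: "trend *\<^sub>v x = 0\<^sub>v q"
  obtains a where "a \<in> carrier_vec (m + r)" "x = A *\<^sub>v a"
proof -
  obtain w \<zeta> where ws: "w \<in> carrier_vec p" "\<zeta> \<in> carrier_vec m" "x = w @\<^sub>v \<zeta>" using split_state[OF x] .
  have E: "ET *\<^sub>v \<zeta> \<in> carrier_vec p" using mult_mat_vec_carrier[OF ET_carrier ws(2)] .
  have "w - ET *\<^sub>v \<zeta> \<in> carrier_vec p" using minus_carrier_vec[OF ws(1) E] .
  moreover have "transpose_mat \<alpha>p *\<^sub>v (w - ET *\<^sub>v \<zeta>) = 0\<^sub>v q"
    using trend_append[OF ws(1,2)] 0 ws(3) by simp
  ultimately obtain b where b: "b \<in> carrier_vec r" "w - ET *\<^sub>v \<zeta> = \<alpha> *\<^sub>v b"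
    using \<alpha>p_kernel by blast
  have "\<alpha> *\<^sub>v b + ET *\<^sub>v \<zeta> = w" unfolding b(2)[symmetric]
    using E ws by (intro eq_vecI) (auto simp del: index_mult_mat_vec dim_mult_mat_vec)
  then have "x = A *\<^sub>v (b @\<^sub>v \<zeta>)" using A_append[OF b(1) ws(2)] ws(3) by simp
  moreover have "b @\<^sub>v \<zeta> \<in> carrier_vec (m + r)"
    using append_carrier_vec[OF b(1) ws(2)] by (simp add: add.commute)
  ultimately show thesis using that by blast
qed

section \<open>The auxiliary block and stationary states\<close>

lemma D_dims [simp]: "dim_row D = m" "dim_col D = m"
  using carrier_matD[OF D_carrier] by auto

lemma E_dims [simp]: "dim_row (Emat p k) = m" "dim_col (Emat p k) = p"
  using carrier_matD[OF ET_carrier] by auto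

text \<open>The auxiliary state block: entry \<open>y l\<close> is the value observed \<open>l\<close> periods before the current one.\<close>
definition zet :: "(nat \<Rightarrow> real vec) \<Rightarrow> real vec" where
  "zet y = vec m (\<lambda>l. \<Sum>i\<in>{l div p + 1..k - 1}. g i (y (i - l div p)) $ (l mod p))"

lemma zet_carrier [simp]: "zet y \<in> carrier_vec m" and zet_dim [simp]: "dim_vec (zet y) = m"
  by (simp_all add: zet_def)

lemma D_mult:
  assumes \<zeta>: "\<zeta> \<in> carrier_vec m" and l: "l < m"
  shows "(D *\<^sub>v \<zeta>) $ l = (if l + p < m then \<zeta> $ (l + p) else 0) - \<zeta> $ l"
proof -
  have entry: "D $$ (l,b) = (if b = l + p then 1 else 0) - (if b = l then 1 else 0)" if "b < m" for b
    using that l p unfolding m_def by (auto simp: Dmat_def)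
  have "(D *\<^sub>v \<zeta>) $ l = (\<Sum>b<m. D $$ (l,b) * \<zeta> $ b)"
    by (rule mult_mat_vec_nth[OF D_carrier \<zeta> l])
  also have "\<dots> = (\<Sum>b<m. (if b = l + p then \<zeta> $ b else 0) - (if b = l then \<zeta> $ b else 0))"
    by (intro sum.cong) (auto simp: entry)
  finally have "(D *\<^sub>v \<zeta>) $ l = (\<Sum>b<m. (if b = l + p then \<zeta> $ b else 0) - (if b = l then \<zeta> $ b else 0))" .
  then show ?thesis using l by (simp add: sum_subtractf)
qed

lemma ET_mult:
  assumes "\<zeta> \<in> carrier_vec m" "l < p"
  shows "(ET *\<^sub>v \<zeta>) $ l = (if l < m then \<zeta> $ l else 0)"
proof -
  have entry: "ET $$ (l,b) = (if b = l then 1 else 0)" if "b < m" for b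
    using that assms(2) unfolding m_def by (auto simp: Emat_def)
  have "(ET *\<^sub>v \<zeta>) $ l = (\<Sum>b<m. ET $$ (l,b) * \<zeta> $ b)"
    by (rule mult_mat_vec_nth[OF ET_carrier assms])
  also have "\<dots> = (\<Sum>b<m. if b = l then \<zeta> $ b else 0)"
    by (intro sum.cong) (auto simp: entry simp del: index_transpose_mat)
  finally have "(ET *\<^sub>v \<zeta>) $ l = (\<Sum>b<m. if b = l then \<zeta> $ b else 0)" .
  then show ?thesis by simp
qed

text \<open>Counting blocks from 0, after one period block b consists of \<open>g (b + 1)\<close> at
  the formerly current value plus the old block b + 1. The upper diagonal of \<open>D\<close>
  fetches that next block and its main diagonal removes the old one; for the last block the
  remaining sum is empty.\<close>

lemma zet_shift:
  assumes "\<And>l. l < k - 1 \<Longrightarrow> y' (Suc l) = y l"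
  shows "zet y' = zet y + (boldg p k f (y 0) + D *\<^sub>v zet y)"
proof (rule eq_vecI)
  fix l assume "l < dim_vec (zet y + (boldg p k f (y 0) + D *\<^sub>v zet y))"
  then have l: "l < m" by (simp add: Dmat_def m_def)
  define b where "b = l div p"
  have b: "b < k - 1" using l p unfolding b_def m_def by (simp add: less_mult_imp_div_less mult.commute)
  have shift: "y' (i - b) = y (i - b - 1)" if "i \<in> {b + 1..k - 1}" for i
  proof -
    have "Suc (i - b - 1) = i - b" "i - b - 1 < k - 1" using that by auto
    then show ?thesis using assms by metis
  qed
  have "zet y' $ l = (\<Sum>i\<in>{b + 1..k - 1}. g i (y (i - b - 1)) $ (l mod p))"
    unfolding zet_def using l shift by (simp add: b_def[symmetric])
  also have "{b + 1..k - 1} = insert (b + 1) {b + 2..k - 1}" using b by auto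
  also have "(\<Sum>i\<in>insert (b + 1) {b + 2..k - 1}. g i (y (i - b - 1)) $ (l mod p)) =
     g (b + 1) (y 0) $ (l mod p) + (\<Sum>i\<in>{b + 2..k - 1}. g i (y (i - (b + 1))) $ (l mod p))"
    by simp
  also have "(\<Sum>i\<in>{b + 2..k - 1}. g i (y (i - (b + 1))) $ (l mod p)) = (if l + p < m then zet y $ (l + p) else 0)"
  proof (cases "l + p < m")
    case True
    have "(l + p) div p = b + 1" "(l + p) mod p = l mod p" using p by (auto simp: b_def)
    then show ?thesis using True by (simp add: zet_def)
  next
    case False
    have "k - 1 \<le> b + 1"
    proof (rule ccontr)
      assume "\<not> ?thesis"
      then have "b + 2 \<le> k - 1" by simp
      then have "p * (b + 2) \<le> m" unfolding m_def by (rule mult_le_mono2)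
      moreover have "l < p * (b + 1)" using p dividend_less_times_div[of p l] by (simp add: b_def algebra_simps)
      ultimately show False using False by (simp add: algebra_simps)
    qed
    then show ?thesis using False by simp
  qed
  also have "g (b + 1) (y 0) $ (l mod p) = boldg p k f (y 0) $ l"
    using l by (simp add: boldg_def b_def m_def)
  finally have "zet y' $ l = boldg p k f (y 0) $ l + (if l + p < m then zet y $ (l + p) else 0)" .
  then show "zet y' $ l = (zet y + (boldg p k f (y 0) + D *\<^sub>v zet y)) $ l"
    using l D_mult[OF zet_carrier l, of y] mult_mat_vec_carrier[OF D_carrier zet_carrier[of y]]
      boldg_carrier[of "y 0"] by (simp del: index_mult_mat_vec dim_mult_mat_vec)
qed (simp add: Dmat_def zet_def m_def)

text \<open>Back substitution: apart from its diagonal, a row of \<open>D\<close> refers only to the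
  following block, so entries vanish from the last block upwards.\<close>

lemma D_inj:
  assumes \<zeta>: "\<zeta> \<in> carrier_vec m" and 0: "D *\<^sub>v \<zeta> = 0\<^sub>v m"
  shows "\<zeta> = 0\<^sub>v m"
proof -
  have "\<zeta> $ l = 0" if "l < m" for l
    using that
  proof (induction "m - l" arbitrary: l rule: less_induct)
    case less
    have "(D *\<^sub>v \<zeta>) $ l = 0" using less.prems by (simp add: 0)
    then have "\<zeta> $ l = (if l + p < m then \<zeta> $ (l + p) else 0)"
      using D_mult[OF \<zeta> less.prems] by simp
    then show ?case using less.hyps[of "l + p"] less.prems p by simp
  qed
  then show ?thesis using \<zeta> by (intro eq_vecI) auto
qed

lemma ET_zet: "l < p \<Longrightarrow> (ET *\<^sub>v zet y) $ l = (\<Sum>i\<in>{1..k - 1}. g i (y i) $ l)"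
proof -
  assume l: "l < p"
  show ?thesis
  proof (cases "l < m")
    case True
    then show ?thesis using l ET_mult[OF zet_carrier l, of y] by (simp add: zet_def)
  next
    \<comment> \<open>An index \<open>l < p\<close> beyond \<open>m\<close> occurs only for
      \<open>k = 1\<close>, when the block is empty and both sides are 0.\<close>
    case False
    then have "m = 0" using l by (cases "k - 1") (auto simp: m_def)
    then have "k - 1 = 0" using p by (simp add: m_def)
    then show ?thesis using False ET_mult[OF zet_carrier l, of y] by simp
  qed
qed

lemma \<psi>_eq:
  assumes z: "z \<in> carrier_vec p"
  shows "\<psi> z = trend *\<^sub>v (f 0 z @\<^sub>v zet (\<lambda>_. z))"
proof -
  have f0: "f 0 z \<in> carrier_vec p" using f_carrier[of 0] z by simp
  have E: "ET *\<^sub>v zet (\<lambda>_. z) \<in> carrier_vec p" using mult_mat_vec_carrier[OF ET_carrier zet_carrier] .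
  have "hfun p k f z = f 0 z - ET *\<^sub>v zet (\<lambda>_. z)"
    using f0 E ET_zet[of _ "\<lambda>_. z"] by (intro eq_vecI) (auto simp: hfun_def simp del: index_mult_mat_vec dim_mult_mat_vec)
  then show ?thesis unfolding psifun_def using trend_append[OF f0 zet_carrier] by simp
qed

lemma \<psi>_carrier: "\<psi> z \<in> carrier_vec q"
  unfolding psifun_def using \<alpha>p by (intro mult_mat_vec_carrier[of _ q p]) (auto simp: hfun_def)

lemma G_stationary:
  assumes z: "z \<in> carrier_vec p" "\<theta> z = - \<mu>"
  shows "G (f 0 z @\<^sub>v zet (\<lambda>_. z)) = 0\<^sub>v (m + r)"
proof -
  have f0: "f 0 z \<in> carrier_vec p" using f_carrier[of 0] z by simp
  \<comment> \<open>A constant history is its own shift, so the update of the auxiliary block must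
    vanish.\<close>
  have "zet (\<lambda>_. z) = zet (\<lambda>_. z) + (boldg p k f z + D *\<^sub>v zet (\<lambda>_. z))"
    by (rule zet_shift) simp
  then have "zet (\<lambda>_. z) $ l = zet (\<lambda>_. z) $ l + (boldg p k f z + D *\<^sub>v zet (\<lambda>_. z)) $ l" if "l < m" for l
    using that D_carrier by (metis index_add_vec(1) carrier_matD(1) dim_mult_mat_vec index_add_vec(2))
  then have "boldg p k f z + D *\<^sub>v zet (\<lambda>_. z) = 0\<^sub>v m"
    using D_carrier by (intro eq_vecI) (auto simp del: index_mult_mat_vec index_add_vec(1))
  moreover have "\<theta> z + \<mu> = 0\<^sub>v r" using z Mr_facts(4) by (intro eq_vecI) auto
  moreover have "0\<^sub>v r @\<^sub>v 0\<^sub>v m = (0\<^sub>v (m + r) :: real vec)" by (intro eq_vecI) auto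
  ultimately show ?thesis using z by (simp add: G_append[OF f0 zet_carrier])
qed

section \<open>Equilibria and the inverse of \<chi> on the attractor\<close>

lemma equilibrium_unique:
  assumes z: "z \<in> carrier_vec p" "\<theta> z = - \<mu>" and z': "z' \<in> carrier_vec p" "\<theta> z' = - \<mu>" and eq: "\<psi> z = \<psi> z'"
  shows "z = z'"
proof -
  define x where "x = (\<lambda>z. f 0 z @\<^sub>v zet (\<lambda>_. z))"
  have xc: "x y \<in> carrier_vec (k * p)" if "y \<in> carrier_vec p" for y
    unfolding x_def n_eq using f_carrier[of 0 y] that by (intro append_carrier_vec) auto
  have "trend *\<^sub>v (x z - x z') = \<psi> z - \<psi> z'"
    using xc z z' by (simp add: mult_minus_distrib_mat_vec[OF trend_carrier] \<psi>_eq x_def)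
  also have "\<dots> = 0\<^sub>v q" using \<psi>_carrier[of z'] by (simp add: eq)
  finally obtain a where a: "a \<in> carrier_vec (m + r)" "x z - x z' = A *\<^sub>v a"
    using trend_kernel[of "x z - x z'"] xc z z' by auto
  have "x z = x z'"
    using G_inj_on_range[OF xc[OF z(1)] xc[OF z'(1)] _ a] G_stationary[OF z] G_stationary[OF z'] by (simp add: x_def)
  then have "f 0 z = f 0 z'"
    using f_carrier[of 0] z z' append_vec_eq[of "f 0 z" p "f 0 z'"] by (simp add: x_def)
  then show ?thesis using f0inv_f0 z(1) z'(1) by metis
qed

text \<open>Recognising the limit state as the stationary state of \<open>z\<close> is what allows
  its trend to be read as \<psi>. Continuity of the inverse of \<open>f 0\<close> turns convergence
  of states into convergence of values.\<close>

lemma trajectory_limit: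
  assumes x: "x \<in> carrier_vec (k * p)"
  obtains z where "z \<in> carrier_vec p" "\<theta> z = - \<mu>" "\<psi> z = trend *\<^sub>v x"
    "(\<lambda>s. vnorm (f0inv p f (vec_first ((T ^^ s) x) p) - z)) \<longlonglongrightarrow> 0"
proof -
  obtain L where L: "L \<in> carrier_vec (k * p)" "G L = 0\<^sub>v (m + r)" "(\<lambda>s. vnorm ((T ^^ s) x - L)) \<longlonglongrightarrow> 0"
    using T_converges[OF x] .
  obtain w \<zeta> where w: "w \<in> carrier_vec p" "\<zeta> \<in> carrier_vec m" "L = w @\<^sub>v \<zeta>" using split_state[OF L(1)] .
  define z where "z = f0inv p f w"
  have z: "z \<in> carrier_vec p" "f 0 z = w" using w by (auto simp: z_def)
  have xc: "(T ^^ s) x \<in> carrier_vec (k * p)" for s using trend_funpow[OF x] by blast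
  have c: "\<theta> z + \<mu> \<in> carrier_vec r" using z Mr_facts(4,5) by auto
  have "0\<^sub>v r @\<^sub>v 0\<^sub>v m = (0\<^sub>v (m + r) :: real vec)" by (intro eq_vecI) auto
  then have "\<theta> z + \<mu> = 0\<^sub>v r \<and> boldg p k f z + D *\<^sub>v \<zeta> = 0\<^sub>v m"
    using L(2) c unfolding w(3) G_append[OF w(1,2)] z_def[symmetric]
    by (metis append_vec_eq zero_carrier_vec)
  then have \<theta>: "\<theta> z + \<mu> = 0\<^sub>v r" and D\<zeta>: "boldg p k f z + D *\<^sub>v \<zeta> = 0\<^sub>v m" by auto
  have \<theta>z: "\<theta> z = - \<mu>"
  proof (rule eq_vecI)
    fix i assume "i < dim_vec (- \<mu>)"
    then have i: "i < r" using Mr_facts(4) by simp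
    have "(\<theta> z + \<mu>) $ i = 0" using i by (simp add: \<theta>)
    then show "\<theta> z $ i = (- \<mu>) $ i" using i Mr_facts(4) by simp
  qed (use Mr_facts(4) Mr_facts(5)[OF z(1)] in simp)
  \<comment> \<open>Both \<zeta> and the auxiliary block of the constant history solve the same
    linear equation for \<open>D\<close>, which has only one solution.\<close>
  have "D *\<^sub>v (\<zeta> - zet (\<lambda>_. z)) = D *\<^sub>v \<zeta> - D *\<^sub>v zet (\<lambda>_. z)"
    using w by (simp add: mult_minus_distrib_mat_vec[OF D_carrier])
  also have "\<dots> = 0\<^sub>v m"
  proof (rule eq_vecI)
    fix l assume "l < dim_vec (0\<^sub>v m :: real vec)"
    then have l: "l < m" by simp
    have "(boldg p k f z + D *\<^sub>v \<zeta>) $ l = 0" using l by (simp add: D\<zeta>)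
    moreover have "zet (\<lambda>_. z) $ l = (zet (\<lambda>_. z) + (boldg p k f z + D *\<^sub>v zet (\<lambda>_. z))) $ l"
      using zet_shift[of "\<lambda>_. z" "\<lambda>_. z"] by simp
    ultimately show "(D *\<^sub>v \<zeta> - D *\<^sub>v zet (\<lambda>_. z)) $ l = 0\<^sub>v m $ l"
      using l mult_mat_vec_carrier[OF D_carrier w(2)] mult_mat_vec_carrier[OF D_carrier zet_carrier[of "\<lambda>_. z"]]
        boldg_carrier[of z] by (simp del: index_mult_mat_vec)
  qed (use mult_mat_vec_carrier[OF D_carrier zet_carrier[of "\<lambda>_. z"]] in simp)
  finally have "\<zeta> - zet (\<lambda>_. z) = 0\<^sub>v m" by (rule D_inj[OF minus_carrier_vec[OF w(2) zet_carrier]])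
  then have "\<zeta> = zet (\<lambda>_. z)" by (rule vec_eqI_diff[OF w(2) zet_carrier])
  then have \<psi>L: "\<psi> z = trend *\<^sub>v L" using \<psi>_eq[OF z(1)] z(2) w(3) by simp
  obtain a where a: "0 < a" "\<And>y. y \<in> carrier_vec (k * p) \<Longrightarrow> vnorm (trend *\<^sub>v y) \<le> a * vnorm y"
    using mult_mat_vec_lipschitz[OF trend_carrier] by blast
  \<comment> \<open>Along the orbit the trend stays that of \<open>x\<close>, so a fixed number is
    bounded by a null sequence.\<close>
  have "vnorm (trend *\<^sub>v x - trend *\<^sub>v L) \<le> a * vnorm ((T ^^ s) x - L)" for s
    using a(2)[of "(T ^^ s) x - L"] xc[of s] L(1) trend_funpow[OF x, of s]
    by (simp add: mult_minus_distrib_mat_vec[OF trend_carrier])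
  moreover have "(\<lambda>s. a * vnorm ((T ^^ s) x - L)) \<longlonglongrightarrow> a * 0" by (intro tendsto_mult tendsto_const L(3))
  ultimately have "vnorm (trend *\<^sub>v x - trend *\<^sub>v L) \<le> a * 0"
    by (intro tendsto_lowerbound[of _ _ sequentially]) auto
  then have "vnorm (trend *\<^sub>v x - trend *\<^sub>v L) = 0" using vnorm_nonneg[of "trend *\<^sub>v x - trend *\<^sub>v L"] by linarith
  moreover have tc: "trend *\<^sub>v x \<in> carrier_vec q" "trend *\<^sub>v L \<in> carrier_vec q"
    using mult_mat_vec_carrier[OF trend_carrier] x L(1) by auto
  ultimately have "trend *\<^sub>v x - trend *\<^sub>v L = 0\<^sub>v q" using vnorm_eq_0_iff[OF minus_carrier_vec[OF tc]] by simp
  then have "trend *\<^sub>v x = trend *\<^sub>v L" by (rule vec_eqI_diff[OF tc])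
  then have \<psi>x: "\<psi> z = trend *\<^sub>v x" using \<psi>L by simp
  have "(\<lambda>s. vnorm (f0inv p f (vec_first ((T ^^ s) x) p) - z)) \<longlonglongrightarrow> 0"
  proof (rule LIMSEQ_I)
    fix e :: real assume e: "0 < e"
    obtain \<delta> where \<delta>: "0 < \<delta>" "\<And>y. y \<in> carrier_vec p \<Longrightarrow> vnorm (y - w) < \<delta> \<Longrightarrow> vnorm (f0inv p f y - f0inv p f w) < e"
      using Mr_facts(3) w(1) e unfolding homeo_vec_def cont_vec_def f0inv_def by blast
    obtain N where N: "\<And>s. N \<le> s \<Longrightarrow> vnorm ((T ^^ s) x - L) < \<delta>"
      using LIMSEQ_D[OF L(3) \<delta>(1)] by auto
    have "vnorm (f0inv p f (vec_first ((T ^^ s) x) p) - z) < e" if "N \<le> s" for s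
    proof -
      have "vec_first L p = w" using w by (intro eq_vecI) (auto simp: vec_first_def)
      then have "vnorm (vec_first ((T ^^ s) x) p - w) < \<delta>"
        using vnorm_vec_first_diff_le[OF xc[of s] L(1), of p] N[OF that] n_eq by simp
      then show ?thesis unfolding z_def by (intro \<delta>(2)) auto
    qed
    then show "\<exists>N. \<forall>s\<ge>N. norm (vnorm (f0inv p f (vec_first ((T ^^ s) x) p) - z) - 0) < e" by auto
  qed
  then show thesis using that z(1) \<theta>z \<psi>x by blast
qed

text \<open>The description ranges over all of \<open>carrier_vec p\<close>, but the second
  component forces every candidate into the fibre \<theta> = -\<mu>, where \<psi> is
  one-to-one.\<close>

lemma chiinv_eqI:
  assumes "z \<in> carrier_vec p" "\<theta> z = - \<mu>" "\<psi> z = v"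
  shows "chiinv p k f \<alpha>p \<theta> (v @\<^sub>v (- \<mu>)) = z"
  unfolding chiinv_def the_inv_into_def
proof (rule the_equality)
  show "z \<in> carrier_vec p \<and> chifun p k f \<alpha>p \<theta> z = v @\<^sub>v (- \<mu>)" using assms by (simp add: chifun_def)
next
  fix y assume y: "y \<in> carrier_vec p \<and> chifun p k f \<alpha>p \<theta> y = v @\<^sub>v (- \<mu>)"
  then have "\<psi> y = v \<and> \<theta> y = - \<mu>"
    using append_vec_eq[OF \<psi>_carrier[of y] \<psi>_carrier[of z]] assms(3) by (simp add: chifun_def)
  then show "y = z" using equilibrium_unique y assms by metis
qed

text \<open>\<psi> maps the attractor onto everything: a start at (S v, 0) has trend v, and the
  equilibrium that it approaches is the preimage sought.\<close>

lemma chiinv_equilibrium: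
  assumes v: "v \<in> carrier_vec q"
  defines "z \<equiv> chiinv p k f \<alpha>p \<theta> (v @\<^sub>v (- \<mu>))"
  shows "z \<in> carrier_vec p" "\<theta> z = - \<mu>" "\<psi> z = v"
proof -
  obtain S where S: "S \<in> carrier_mat p q" "transpose_mat \<alpha>p * S = 1\<^sub>m q" using \<alpha>p_right_inverse .
  have Sv: "S *\<^sub>v v \<in> carrier_vec p" using S v by simp
  have "ET *\<^sub>v 0\<^sub>v m = 0\<^sub>v p" using ET_carrier by (intro eq_vecI) (auto simp: Emat_def)
  then have "trend *\<^sub>v (S *\<^sub>v v @\<^sub>v 0\<^sub>v m) = transpose_mat \<alpha>p *\<^sub>v (S *\<^sub>v v)"
    using trend_append[OF Sv, of "0\<^sub>v m"] Sv by simp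
  also have "\<dots> = v" using S \<alpha>p v by (simp flip: assoc_mult_mat_vec)
  finally have t: "trend *\<^sub>v (S *\<^sub>v v @\<^sub>v 0\<^sub>v m) = v" .
  have "S *\<^sub>v v @\<^sub>v 0\<^sub>v m \<in> carrier_vec (k * p)" unfolding n_eq using Sv by (intro append_carrier_vec) auto
  from trajectory_limit[OF this] obtain y where y: "y \<in> carrier_vec p" "\<theta> y = - \<mu>" "\<psi> y = v"
    unfolding t by metis
  then have "z = y" unfolding z_def by (intro chiinv_eqI)
  then show "z \<in> carrier_vec p" "\<theta> z = - \<mu>" "\<psi> z = v" using y by auto
qed

section \<open>Impulse paths as orbits of the state map\<close>

definition hist :: "real vec \<Rightarrow> real vec \<Rightarrow> nat \<Rightarrow> real vec" where
  "hist u fz j = (if j < k then blk p fz (k - j) else ip_new p k c f u (ip_state p k c f u fz (j - k)) (j - k))"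

lemma ip_state_eq: "ip_state p k c f u fz s = map (\<lambda>i. hist u fz (s + i)) [0..<k]"
proof (induction s)
  case 0
  show ?case by (simp add: hist_def)
next
  case (Suc s)
  have new: "hist u fz (s + k) = ip_new p k c f u (ip_state p k c f u fz s) s" by (simp add: hist_def)
  show ?case
  proof (rule nth_equalityI)
    fix i assume "i < length (ip_state p k c f u fz (Suc s))"
    then have i: "i < k" using k by (simp add: Suc)
    show "ip_state p k c f u fz (Suc s) ! i = map (\<lambda>i. hist u fz (Suc s + i)) [0..<k] ! i"
    proof (cases "i < k - 1")
      case True
      then have "Suc i < k" by simp
      then show ?thesis using i True by (simp add: Suc nth_append nth_tl)
    next
      case False
      then have "i = k - 1" using i by simp
      moreover have "s + k = Suc (s + (k - 1))" using k by simp
      ultimately show ?thesis using i k new by (simp add: Suc nth_append)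
    qed
  qed (use k in \<open>simp add: Suc\<close>)
qed

lemma hist_carrier [simp]: "hist u fz j \<in> carrier_vec p"
  by (auto simp: hist_def blk_def ip_new_def)

lemma f0_hist:
  "f 0 (hist u fz (s + k)) =
     vec p (\<lambda>l. c $ l + (\<Sum>i\<in>{1..k}. f i (hist u fz (s + k - i)) $ l) + (if s = 0 then u $ l else 0))"
proof -
  have "(\<Sum>i\<in>{1..k}. f i (ip_state p k c f u fz s ! (k - i)) $ l) = (\<Sum>i\<in>{1..k}. f i (hist u fz (s + k - i)) $ l)" for l
    by (intro sum.cong) (auto simp: ip_state_eq)
  then show ?thesis by (simp add: hist_def ip_new_def)
qed

text \<open>\<open>hist u fz j\<close> is the value at time \<tau> - k + j, with initial history and
  path in one sequence. Hence \<open>state u fz s\<close> belongs to time \<tau> + s - 1: at s = 0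
  it precedes the impulse, which enters between s = 0 and s = 1.\<close>

definition state :: "real vec \<Rightarrow> real vec \<Rightarrow> nat \<Rightarrow> real vec" where
  "state u fz s = f 0 (hist u fz (s + k - 1)) @\<^sub>v zet (\<lambda>l. hist u fz (s + k - 1 - l))"

lemma f0_carrier [simp]: "z \<in> carrier_vec p \<Longrightarrow> f 0 z \<in> carrier_vec p"
  using f_carrier[of 0 z] by simp

lemma state_carrier: "state u fz s \<in> carrier_vec (k * p)"
  unfolding state_def n_eq by (intro append_carrier_vec) auto

text \<open>The first block is compared through E^T: by \<open>zet_shift\<close> its value on the
  auxiliary block grows by E^T \<xi>, and by \<open>lag_sum_telescope\<close> this is exactly the
  discrepancy between the sum of f_i at lag i, demanded by the recursion, and the sum of f_i at lag
  1, contained in \<pi>.\<close>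

lemma state_Suc:
  assumes u: "u \<in> carrier_vec p"
  shows "state u fz (Suc s) = T (state u fz s) + ((if s = 0 then u else 0\<^sub>v p) @\<^sub>v 0\<^sub>v m)"
proof -
  define y y' where "y l = hist u fz (s + k - 1 - l)" and "y' l = hist u fz (s + k - l)" for l
  define z where "z = hist u fz (s + k - 1)"
  define \<xi> where "\<xi> = boldg p k f z + D *\<^sub>v zet y"
  have z: "z \<in> carrier_vec p" by (simp add: z_def)
  have y0: "y 0 = z" by (simp add: y_def z_def)
  have \<xi>: "\<xi> \<in> carrier_vec m" unfolding \<xi>_def using mult_mat_vec_carrier[OF D_carrier zet_carrier] by simp
  have shift: "zet y' = zet y + \<xi>"
    unfolding \<xi>_def y0[symmetric] by (rule zet_shift) (simp add: y_def y'_def)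
  have E: "ET *\<^sub>v zet y' = ET *\<^sub>v zet y + ET *\<^sub>v \<xi>"
    unfolding shift by (rule mult_add_distrib_mat_vec[OF ET_carrier zet_carrier \<xi>])
  have Ec: "ET *\<^sub>v \<xi> \<in> carrier_vec p" "ET *\<^sub>v zet y \<in> carrier_vec p"
    using mult_mat_vec_carrier[OF ET_carrier] \<xi> by auto
  have \<alpha>: "\<alpha> *\<^sub>v (\<theta> z + \<mu>) = pifun p k f z + c"
    using mult_add_distrib_mat_vec[OF Mr_facts(1) Mr_facts(5)[OF z] Mr_facts(4)] Mr_facts(6) Mr_facts(7)[OF z] by simp
  have pc: "pifun p k f z \<in> carrier_vec p" by (simp add: pifun_def)
  have st: "state u fz s = f 0 z @\<^sub>v zet y" unfolding state_def z_def y_def ..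
  have T: "T (state u fz s) = (f 0 z + (pifun p k f z + c + ET *\<^sub>v \<xi>)) @\<^sub>v zet y'"
    unfolding st using T_append[OF f0_carrier[OF z] zet_carrier[of y]] z
    by (simp add: \<xi>_def[symmetric] shift \<alpha>)
  have "f 0 (hist u fz (s + k)) = f 0 z + (pifun p k f z + c + ET *\<^sub>v \<xi>) + (if s = 0 then u else 0\<^sub>v p)"
  proof (rule eq_vecI)
    fix l assume "l < dim_vec (f 0 z + (pifun p k f z + c + ET *\<^sub>v \<xi>) + (if s = 0 then u else 0\<^sub>v p))"
    then have l: "l < p" using u by (auto split: if_splits)
    define \<phi> where "\<phi> i j = f i (hist u fz (s + k - j)) $ l" for i j
    have gam: "g i (hist u fz (s + k - j)) $ l = - (\<Sum>n\<in>{i + 1..k}. \<phi> n j)" for i j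
      using l by (simp add: gfun_def \<phi>_def)
    have Ey: "(ET *\<^sub>v zet y) $ l = (\<Sum>i\<in>{1..k - 1}. g i (hist u fz (s + k - (i + 1))) $ l)"
      using ET_zet[OF l, of y] by (simp add: y_def)
    have Ey': "(ET *\<^sub>v zet y') $ l = (\<Sum>i\<in>{1..k - 1}. g i (hist u fz (s + k - i)) $ l)"
      using ET_zet[OF l, of y'] by (simp add: y'_def)
    have "(ET *\<^sub>v zet y') $ l = (ET *\<^sub>v zet y) $ l + (ET *\<^sub>v \<xi>) $ l"
      unfolding E using l Ec by (simp del: index_mult_mat_vec)
    then have "(\<Sum>i\<in>{1..k}. \<phi> i i) = (\<Sum>i\<in>{1..k}. \<phi> i 1) + (ET *\<^sub>v \<xi>) $ l"
      using lag_sum_telescope[OF k, of \<phi>] unfolding Ey Ey' gam by simp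
    moreover have "pifun p k f z $ l = - f 0 z $ l + (\<Sum>i\<in>{1..k}. \<phi> i 1)"
      using l by (simp add: pifun_def \<phi>_def z_def)
    moreover have "f 0 (hist u fz (s + k)) $ l = c $ l + (\<Sum>i\<in>{1..k}. \<phi> i i) + (if s = 0 then u $ l else 0)"
      unfolding f0_hist using l by (simp add: \<phi>_def)
    ultimately show "f 0 (hist u fz (s + k)) $ l =
        (f 0 z + (pifun p k f z + c + ET *\<^sub>v \<xi>) + (if s = 0 then u else 0\<^sub>v p)) $ l"
      using l u z Ec pc c_carrier f0_carrier[OF z] by (simp del: index_mult_mat_vec)
  qed (use u f0_carrier[of "hist u fz (s + k)"] in auto)
  moreover have "state u fz (Suc s) = f 0 (hist u fz (s + k)) @\<^sub>v zet y'"
    unfolding state_def using ext[of y' "\<lambda>l. hist u fz (s + k - l)", OF y'_def] by simp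
  ultimately show ?thesis
    unfolding T using u z Ec pc c_carrier f0_carrier[OF z]
    by (subst append_vec_add[of _ p _ _ m]) auto
qed

definition init :: "real vec \<Rightarrow> real vec" where
  "init fz = f 0 (blk p fz 1) @\<^sub>v zet (\<lambda>l. blk p fz (k - (k - 1 - l)))"

lemma state_0: "state u fz 0 = init fz"
proof -
  have "hist u fz (k - 1 - l) = blk p fz (k - (k - 1 - l))" for l using k by (simp add: hist_def)
  from this this[of 0] show ?thesis using k by (simp add: state_def init_def)
qed

lemma init_carrier: "init fz \<in> carrier_vec (k * p)"
  using state_carrier[of u fz 0 for u] by (simp add: state_0)

lemma trend_state_1:
  assumes u: "u \<in> carrier_vec p"
  shows "trend *\<^sub>v state u fz 1 = trend *\<^sub>v init fz + transpose_mat \<alpha>p *\<^sub>v u"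
proof -
  have uc: "u @\<^sub>v 0\<^sub>v m \<in> carrier_vec (k * p)" unfolding n_eq using u by simp
  have "state u fz 1 = T (init fz) + (u @\<^sub>v 0\<^sub>v m)"
    using state_Suc[OF u, of fz 0] by (simp add: state_0)
  then have "trend *\<^sub>v state u fz 1 = trend *\<^sub>v init fz + trend *\<^sub>v (u @\<^sub>v 0\<^sub>v m)"
    using mult_add_distrib_mat_vec[OF trend_carrier T_carrier[OF init_carrier] uc] trend_T[OF init_carrier] by simp
  moreover have "ET *\<^sub>v 0\<^sub>v m = 0\<^sub>v p" by (rule mult_mat_zero_vec[OF ET_carrier])
  then have "trend *\<^sub>v (u @\<^sub>v 0\<^sub>v m) = transpose_mat \<alpha>p *\<^sub>v u"
    using trend_append[OF u, of "0\<^sub>v m"] u by simp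
  ultimately show ?thesis by simp
qed

lemma state_funpow:
  assumes "u \<in> carrier_vec p"
  shows "state u fz (Suc s) = (T ^^ s) (state u fz 1)"
proof (induction s)
  case (Suc s)
  have "0\<^sub>v p @\<^sub>v 0\<^sub>v m = (0\<^sub>v (k * p) :: real vec)" unfolding n_eq by (intro eq_vecI) auto
  then show ?case
    using state_Suc[OF assms, of fz "Suc s"] T_carrier[OF state_carrier[of u fz "Suc s"]] Suc by simp
qed simp

lemma z_inf_eq:
  assumes u: "u \<in> carrier_vec p"
  shows "z_inf p k c f \<tau> u fz = chiinv p k f \<alpha>p \<theta> ((trend *\<^sub>v init fz + transpose_mat \<alpha>p *\<^sub>v u) @\<^sub>v (- \<mu>))"
proof -
  obtain z where z: "z \<in> carrier_vec p" "\<theta> z = - \<mu>" "\<psi> z = trend *\<^sub>v state u fz 1"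
    and lim: "(\<lambda>s. vnorm (f0inv p f (vec_first ((T ^^ s) (state u fz 1)) p) - z)) \<longlonglongrightarrow> 0"
    using trajectory_limit[OF state_carrier] by metis
  have path: "impulse_path p k c f \<tau> u fz t = hist u fz (t - \<tau> + k)" for t
    by (simp add: impulse_path_def hist_def)
  have "f0inv p f (vec_first ((T ^^ s) (state u fz 1)) p) = hist u fz (s + k)" for s
  proof -
    have "state u fz (Suc s) = f 0 (hist u fz (s + k)) @\<^sub>v zet (\<lambda>l. hist u fz (s + k - l))"
      by (simp add: state_def)
    then have "vec_first (state u fz (Suc s)) p = f 0 (hist u fz (s + k))"
      by (simp add: vec_first_append_vec)
    then show ?thesis unfolding state_funpow[OF u] by simp
  qed
  then have "(\<lambda>s. vnorm (impulse_path p k c f \<tau> u fz (s + \<tau>) - z)) \<longlonglongrightarrow> 0"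
    using lim by (simp add: path)
  then have lim': "(\<lambda>t. vnorm (impulse_path p k c f \<tau> u fz t - z)) \<longlonglongrightarrow> 0" by (rule LIMSEQ_offset)
  have "z_inf p k c f \<tau> u fz = z"
    unfolding z_inf_def
  proof (rule the_equality)
    fix L assume L: "L \<in> carrier_vec p \<and> (\<lambda>t. vnorm (impulse_path p k c f \<tau> u fz t - L)) \<longlonglongrightarrow> 0"
    show "L = z"
      by (rule vnorm_limit_unique[of "impulse_path p k c f \<tau> u fz" p]) (use L z(1) lim' path in auto)
  qed (use z(1) lim' in simp)
  also have "z = chiinv p k f \<alpha>p \<theta> ((trend *\<^sub>v init fz + transpose_mat \<alpha>p *\<^sub>v u) @\<^sub>v (- \<mu>))"
    using chiinv_eqI[OF z] trend_state_1[OF u] by simp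
  finally show ?thesis .
qed

text \<open>The stacked vector consists of \<open>k\<close> copies of \<open>z\<close>. The
  resulting state has trend \<psi> z, so this start realises the multiplier at
  \<open>z\<close>.\<close>

lemma init_const:
  assumes z: "z \<in> carrier_vec p"
  shows "init (vec (k * p) (\<lambda>i. z $ (i mod p))) = f 0 z @\<^sub>v zet (\<lambda>_. z)"
proof -
  have "blk p (vec (k * p) (\<lambda>i. z $ (i mod p))) i = z" if i: "1 \<le> i" "i \<le> k" for i
  proof (rule eq_vecI)
    fix j assume "j < dim_vec z"
    then have j: "j < p" using z by simp
    then have "(i - 1) * p + j < (i - 1) * p + p" by simp
    also have "\<dots> = i * p" using i(1) by (cases i) auto
    also have "\<dots> \<le> k * p" using i(2) by (rule mult_le_mono1)
    finally show "blk p (vec (k * p) (\<lambda>i. z $ (i mod p))) i $ j = z $ j" using j by (simp add: blk_def)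
  qed (use z in \<open>simp add: blk_def\<close>)
  \<comment> \<open>Truncated subtraction keeps the lag index between 1 and \<open>k\<close> even
    for \<open>l \<ge> k\<close>.\<close>
  moreover have "1 \<le> k - (k - 1 - l)" for l using k by auto
  ultimately show ?thesis using k by (simp add: init_def)
qed

text \<open>One half for each inclusion between the sets of multipliers: the trend of an arbitrary
  history is \<psi> of some equilibrium, and for given \<open>z\<close> the constant history is a
  witness.\<close>

lemma z_inf_eq_umap:
  "fz \<in> carrier_vec (k * p) \<Longrightarrow> \<exists>z\<in>carrier_vec p. \<theta> z = - \<mu> \<and> (\<forall>u\<in>carrier_vec p.
     z_inf p k c f \<tau> u fz = chiinv p k f \<alpha>p \<theta> ((\<psi> z + transpose_mat \<alpha>p *\<^sub>v u) @\<^sub>v (- \<mu>)))"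
  "z \<in> carrier_vec p \<Longrightarrow> \<exists>fz\<in>carrier_vec (k * p). \<forall>u\<in>carrier_vec p.
     z_inf p k c f \<tau> u fz = chiinv p k f \<alpha>p \<theta> ((\<psi> z + transpose_mat \<alpha>p *\<^sub>v u) @\<^sub>v (- \<mu>))"
proof -
  define z where "z = chiinv p k f \<alpha>p \<theta> ((trend *\<^sub>v init fz) @\<^sub>v (- \<mu>))"
  have "trend *\<^sub>v init fz \<in> carrier_vec q" by (rule mult_mat_vec_carrier[OF trend_carrier init_carrier])
  from chiinv_equilibrium[OF this]
  show "\<exists>z\<in>carrier_vec p. \<theta> z = - \<mu> \<and> (\<forall>u\<in>carrier_vec p.
     z_inf p k c f \<tau> u fz = chiinv p k f \<alpha>p \<theta> ((\<psi> z + transpose_mat \<alpha>p *\<^sub>v u) @\<^sub>v (- \<mu>)))"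
    by (intro bexI[of _ z] conjI ballI) (simp_all add: z_def z_inf_eq)
next
  assume z: "z \<in> carrier_vec p"
  have "trend *\<^sub>v init (vec (k * p) (\<lambda>i. z $ (i mod p))) = \<psi> z"
    by (simp add: init_const[OF z] \<psi>_eq[OF z])
  then show "\<exists>fz\<in>carrier_vec (k * p). \<forall>u\<in>carrier_vec p.
     z_inf p k c f \<tau> u fz = chiinv p k f \<alpha>p \<theta> ((\<psi> z + transpose_mat \<alpha>p *\<^sub>v u) @\<^sub>v (- \<mu>))"
    by (intro bexI[of _ "vec (k * p) (\<lambda>i. z $ (i mod p))"] ballI) (simp_all add: z_inf_eq)
qed

end

section \<open>Long-run multipliers and their rank\<close>

theorem theorem4p2:
  fixes p k r \<tau> :: nat and c \<mu> :: "real vec" and f :: "nat \<Rightarrow> real vec \<Rightarrow> real vec"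
    and \<alpha> \<alpha>p :: "real mat" and \<theta> :: "real vec \<Rightarrow> real vec"
  assumes "p \<ge> 1" and "k \<ge> 1" and "r \<le> p - 1"
    and "nvar_model p k c f"
    and "in_Mr p k r c f \<alpha> \<mu> \<theta>"
    and "\<alpha>p \<in> carrier_mat p (p - r)" and "mrank p \<alpha>p = p - r"
    and "transpose_mat \<alpha>p * \<alpha> = 0\<^sub>m (p - r) r"
  defines "q \<equiv> p - r"
    and "Mmu \<equiv> {z \<in> carrier_vec p. \<theta> z = - \<mu>}"
    and "vmap \<equiv> \<lambda>z v. chiinv p k f \<alpha>p \<theta> ((psifun p k f \<alpha>p z + v) @\<^sub>v (- \<mu>))"
    and "umap \<equiv> \<lambda>z u. chiinv p k f \<alpha>p \<theta>
                 ((psifun p k f \<alpha>p z + transpose_mat \<alpha>p *\<^sub>v u) @\<^sub>v (- \<mu>))"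
  defines "N \<equiv> {z \<in> Mmu. \<not> differentiable_vec (vmap z) (0\<^sub>v q) q p}"
  defines "N0 \<equiv> N \<union> {z \<in> Mmu - N.
              \<not> (\<exists>L \<in> carrier_mat q p. L * jacobian (vmap z) (0\<^sub>v q) q p = 1\<^sub>m q)}"
    and "Theta_inf \<equiv> \<lambda>z. jacobian (umap z) (0\<^sub>v p) p p"
  shows "{jacobian (\<lambda>u. z_inf p k c f \<tau> u fz) (0\<^sub>v p) p p | fz.
            fz \<in> carrier_vec (k * p) \<and> differentiable_vec (\<lambda>u. z_inf p k c f \<tau> u fz) (0\<^sub>v p) p p}
         = Theta_inf ` (Mmu - N)
     \<and> (\<forall>z \<in> Mmu - N. Theta_inf z = jacobian (vmap z) (0\<^sub>v q) q p * transpose_mat \<alpha>p)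
     \<and> (\<forall>z \<in> Mmu - N0. mrank p (Theta_inf z) = q)"
proof -
  interpret nvar p k r c \<mu> f \<alpha> \<alpha>p \<theta> by unfold_locales (fact assms)+
  obtain S where S: "S \<in> carrier_mat p q" "transpose_mat \<alpha>p * S = 1\<^sub>m q"
    using \<alpha>p_right_inverse unfolding q_def .
  have K: "transpose_mat \<alpha>p \<in> carrier_mat q p" using assms(6) by (simp add: q_def)
  have jac_umap: "has_jac (umap z) (J * transpose_mat \<alpha>p) (0\<^sub>v p) p p"
    if "has_jac (vmap z) J (0\<^sub>v q) q p" for z J
    using has_jac_comp_linear[OF that K] unfolding umap_def vmap_def .
  \<comment> \<open>\<open>N\<close> speaks of the variable v, the multipliers of u. One direction
    is the chain rule with \<alpha>p^T; for the other, the right inverse \<open>S\<close> recovers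
    \<open>vmap\<close> as \<open>umap\<close> composed with \<open>S\<close>.\<close>
  have diff: "differentiable_vec (umap z) (0\<^sub>v p) p p \<longleftrightarrow> differentiable_vec (vmap z) (0\<^sub>v q) q p" for z
  proof
    assume "differentiable_vec (umap z) (0\<^sub>v p) p p"
    then obtain J where "has_jac (umap z) J (0\<^sub>v p) p p" unfolding differentiable_vec_def by blast
    from has_jac_comp_linear[OF this S(1)]
    have "differentiable_vec (\<lambda>v. umap z (S *\<^sub>v v)) (0\<^sub>v q) q p" unfolding differentiable_vec_def by blast
    moreover have "umap z (S *\<^sub>v v) = vmap z v" if "v \<in> carrier_vec q" for v
      unfolding umap_def vmap_def using S K that by (simp flip: assoc_mult_mat_vec)
    ultimately show "differentiable_vec (vmap z) (0\<^sub>v q) q p" using differentiable_vec_cong(1) by metis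
  qed (use jac_umap in \<open>auto simp: differentiable_vec_def\<close>)
  have MN: "z \<in> Mmu - N \<longleftrightarrow> z \<in> Mmu \<and> differentiable_vec (umap z) (0\<^sub>v p) p p" for z
    unfolding N_def diff by blast
  have factor: "Theta_inf z = jacobian (vmap z) (0\<^sub>v q) q p * transpose_mat \<alpha>p" if "z \<in> Mmu - N" for z
    using that jacobian_eqI[OF jac_umap[OF has_jac_jacobian]] unfolding N_def Theta_inf_def by blast
  \<comment> \<open>Outside \<open>N0\<close> the p by q Jacobian has a left inverse
    \<open>L\<close>; together with the right inverse \<open>S\<close> of \<alpha>p^T this is the
    setting of \<open>rank_mult_one_sided_inverses\<close>.\<close>
  have rank: "mrank p (Theta_inf z) = q" if z: "z \<in> Mmu - N0" for z
  proof -
    have zN: "z \<in> Mmu - N" using z by (auto simp: N0_def)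
    obtain L where L: "L \<in> carrier_mat q p" "L * jacobian (vmap z) (0\<^sub>v q) q p = 1\<^sub>m q"
      using z zN by (auto simp: N0_def)
    have "has_jac (vmap z) (jacobian (vmap z) (0\<^sub>v q) q p) (0\<^sub>v q) q p"
      using zN by (intro has_jac_jacobian) (auto simp: N_def)
    then have "jacobian (vmap z) (0\<^sub>v q) q p \<in> carrier_mat p q" by (simp add: has_jac_def)
    then show ?thesis
      unfolding factor[OF zN] by (rule rank_mult_one_sided_inverses[OF _ K L(1) S(1) L(2) S(2)])
  qed
  have "{jacobian (\<lambda>u. z_inf p k c f \<tau> u fz) (0\<^sub>v p) p p | fz.
            fz \<in> carrier_vec (k * p) \<and> differentiable_vec (\<lambda>u. z_inf p k c f \<tau> u fz) (0\<^sub>v p) p p}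
         = Theta_inf ` (Mmu - N)" (is "?L = ?R")
  proof (intro equalityI subsetI)
    fix J assume "J \<in> ?L"
    then obtain fz where fz: "fz \<in> carrier_vec (k * p)" "differentiable_vec (\<lambda>u. z_inf p k c f \<tau> u fz) (0\<^sub>v p) p p"
      "J = jacobian (\<lambda>u. z_inf p k c f \<tau> u fz) (0\<^sub>v p) p p" by blast
    obtain z where z: "z \<in> Mmu" "\<And>u. u \<in> carrier_vec p \<Longrightarrow> z_inf p k c f \<tau> u fz = umap z u"
      using z_inf_eq_umap(1)[OF fz(1), of \<tau>] unfolding Mmu_def umap_def by blast
    have cong: "differentiable_vec (\<lambda>u. z_inf p k c f \<tau> u fz) (0\<^sub>v p) p p = differentiable_vec (umap z) (0\<^sub>v p) p p"
      "jacobian (\<lambda>u. z_inf p k c f \<tau> u fz) (0\<^sub>v p) p p = jacobian (umap z) (0\<^sub>v p) p p"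
      using differentiable_vec_cong[of p "\<lambda>u. z_inf p k c f \<tau> u fz" "umap z"] z(2) by blast+
    show "J \<in> ?R" using fz z(1) MN unfolding cong Theta_inf_def by blast
  next
    fix J assume "J \<in> ?R"
    then obtain z where z: "z \<in> Mmu" "differentiable_vec (umap z) (0\<^sub>v p) p p" "J = jacobian (umap z) (0\<^sub>v p) p p"
      unfolding Theta_inf_def using MN by blast
    obtain fz where fz: "fz \<in> carrier_vec (k * p)" "\<And>u. u \<in> carrier_vec p \<Longrightarrow> z_inf p k c f \<tau> u fz = umap z u"
      using z_inf_eq_umap(2)[of z \<tau>] z(1) unfolding Mmu_def umap_def by blast
    have cong: "differentiable_vec (\<lambda>u. z_inf p k c f \<tau> u fz) (0\<^sub>v p) p p = differentiable_vec (umap z) (0\<^sub>v p) p p"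
      "jacobian (\<lambda>u. z_inf p k c f \<tau> u fz) (0\<^sub>v p) p p = jacobian (umap z) (0\<^sub>v p) p p"
      using differentiable_vec_cong[of p "\<lambda>u. z_inf p k c f \<tau> u fz" "umap z"] fz(2) by blast+
    show "J \<in> ?L" using fz(1) z(2,3) unfolding cong[symmetric] by blast
  qed
  then show ?thesis using factor rank by blast
qed

end
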